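(* The symmetrization map $\Phi_W:(\mathrm{Sym}\,L)[\mathrm h]\to A_{\mathrm h}$ is an isomorphism of $\mathbf k[\mathrm h]$-modules and satisfies $\Phi_W(P*_{\mathrm h}R)=\Phi_W(P)\Phi_W(R)$ for all $P,R$; that is, $\Phi_W$ is an isomorphism of $\mathbf k[\mathrm h]$-algebras from $((\mathrm{Sym}\,L)[\mathrm h],*_{\mathrm h})$ to $A_{\mathrm h}$.
   Context: Let $\mathbf k$ be a field of characteristic $0$ and $Q$ a quiver with vertex set $I$. The double $\overline Q$ has edges $e,e^*$ for $e\in Q$, where $e^*$ is the reverse of $e$ and $(e^* )^*=e$; $*$ is the edge-reversal involution. $[e,f]=1$ if $e\in Q,f=e^*$; $[e,f]=-1$ if $f\in Q,e=f^*$; $[e,f]=0$ otherwise. $L$ is the $\mathbf k$-space with basis the cyclic paths (necklaces) in $\overline Q$ up to rotation, including the trivial path at each vertex. $\mathrm{Sym}\,L$ is the symmetric algebra, with product $\&$; its basis consists of collections $P=P_1\&\cdots\&P_k\&v_1\&\cdots\&v_q$, with $P_i=a_{i1}\cdots a_{il_i}$ necklaces of positive length and $v_s\in I$. The set of abstract edges of $P$ is $X=\{(i,j):1\le i\le k,1\le j\le l_i\}$, with $\mathrm{pr}_X(i,j)=a_{ij}$ and $(i,j)+1=(i,j+1)$, $j$ modulo $l_i$. **Cutting and gluing.** Let $Z$ be the set of abstract edges of a collection, $J\subset Z$, and $\phi:J\to J$ an involution taking each edge to one projecting to the reverse edge. Define $f(z)=z+1$ for $z\notin J$, $f(z)=\phi(z)+1$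 for $z\in J$. The glued collection has one member for each orbit of $f$: the necklace of the edges of the orbit not in $J$, read in order, or, if the orbit lies in $J$, the trivial path at the start vertex of any of its edges; the original trivial paths are kept. **Product $*_{\mathrm h}$.** For collections $P,R$ with abstract edges $X,Y$, $$P*_{\mathrm h}R=\sum_{(I_X,I_Y,\phi)}\frac{\mathrm h^{\#I_X}}{2^{\#I_X}}(-1)^{\#(I_Y\cap\mathrm{pr}_Y^{-1}(Q))}PR_{I_X,I_Y,\phi},$$ over $I_X\subset X$, $I_Y\subset Y$, and bijections $\phi:I_X\to I_Y$ with $\mathrm{pr}_Y\circ\phi=*\circ\mathrm{pr}_X$, where $PR_{I_X,I_Y,\phi}$ is the result of cutting and gluing $P\&R$ along $J=I_X\sqcup I_Y$, with $\phi$ extended to an involution; extend $\mathbf k[\mathrm h]$-bilinearly. **The algebra $A_{\mathrm h}$.** For a collection $P$ with $\#X=N$, a height assignment is a bijection $H:X\to\{1,\dots,N\}$; $P_H$ denotes $P$ with the edges labeled by their heights (considered up to isomorphism: rotation of necklaces and reordering of the collection). $A_{\mathrm h}$ is the quotient of the free $\mathbf k[\mathrm h]$-module on all $P_H$ by the relations, for all $P_H$ and all $x,y\in X$ with $H(y)=H(x)+1$, $$P_H-P_{H'}=\mathrm h\,[\mathrm{pr}_X(x),\mathrm{pr}_X(y)]\,P''_{H''},$$ where $H'$ is $H$ with the heights of $x,y$ interchanged, $P''$ is the result of cutting and gluing $P$ along $J=\{x,y\}$ (the right side is zero unless $\mathrm{pr}_X(y)=\mathrm{pr}_X(x)^*$),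 and $H''$ is the height assignment inducing the same order as $H$ on $X\setminus\{x,y\}$. The product $P_H\cdot R_{H'}$ is $P\&R$ with the height assignment restricting in order to $H$ on $P$ and $H'$ on $R$, with all edges of $R$ above all edges of $P$. **$\Phi_W$.** $\Phi_W(P)=\frac1{N!}\sum_HP_H$ over all height assignments $H$ of $P$, $N=\#X$; extend $\mathbf k[\mathrm h]$-linearly. *)

theory Defs
  imports
    "Graph_Theory.Digraph"
    "HOL-Combinatorics.Orbits"
    "HOL-Library.Poly_Mapping"
    "HOL-Library.Multiset"
    "HOL-Library.FuncSet"
    "HOL-Algebra.Algebraic_Closure_Type"
begin

section \<open>The double quiver\<close>

text \<open>
  A quiver is a \<^locale>\<open>wf_digraph\<close>: loops and multiple arcs are allowed, and neither the
  vertex set nor the arc set has to be finite. In the double, \<open>Orig e\<close> stands for \<open>e \<in> Q\<close>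
  and \<open>Star e\<close> for its reverse.
\<close>

datatype 'e dedge = is_orig: Orig 'e | Star 'e

fun rev_edge :: "'e dedge \<Rightarrow> 'e dedge" where
  "rev_edge (Orig e) = Star e"
| "rev_edge (Star e) = Orig e"

definition dedges :: "('v, 'e) pre_digraph \<Rightarrow> 'e dedge set" where
  "dedges Q = Orig ` arcs Q \<union> Star ` arcs Q"

fun dtail :: "('v, 'e) pre_digraph \<Rightarrow> 'e dedge \<Rightarrow> 'v" where
  "dtail Q (Orig e) = tail Q e"
| "dtail Q (Star e) = head Q e"

definition dhead :: "('v, 'e) pre_digraph \<Rightarrow> 'e dedge \<Rightarrow> 'v" where
  "dhead Q a = dtail Q (rev_edge a)"

definition bracket :: "'e dedge \<Rightarrow> 'e dedge \<Rightarrow> 'k::comm_ring_1" where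
  "bracket a b =
     (if is_orig a \<and> b = rev_edge a then 1
      else if is_orig b \<and> a = rev_edge b then - 1
      else 0)"

section \<open>Necklaces and collections\<close>

lemma rotate_inverse: "\<exists>m. xs = rotate m (rotate n xs)"
proof -
  have "rotate (length xs - n mod length xs) (rotate (n mod length xs) xs) = xs"
    by (cases "xs = []") (simp_all add: rotate_rotate less_imp_le)
  then show ?thesis
    by (metis rotate_conv_mod)
qed

lemma equivp_rotation: "equivp (\<lambda>xs ys. \<exists>n. ys = rotate n xs)"
proof (rule equivpI)
  show "reflp (\<lambda>xs ys :: 'a list. \<exists>n. ys = rotate n xs)"
    by (rule reflpI) (metis rotate0 id_apply)
  show "symp (\<lambda>xs ys :: 'a list. \<exists>n. ys = rotate n xs)"
    by (rule sympI) (use rotate_inverse in blast)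
  show "transp (\<lambda>xs ys :: 'a list. \<exists>n. ys = rotate n xs)"
    by (rule transpI) (metis rotate_rotate)
qed

text \<open>
  A member of a collection is a trivial path or a cyclic word up to rotation. The letters are
  elements of \<^typ>\<open>'e dedge\<close> for the collections \<open>P\<close>, and pairs (edge, height) for the
  collections with heights \<open>P\<^sub>H\<close>. A collection is a multiset of members, i.e. a monomial in
  the symmetric algebra.
\<close>

quotient_type 'a necklace = "'a list" / "\<lambda>xs ys. \<exists>n. ys = rotate n xs"
  by (rule equivp_rotation)

datatype ('v, 'a) member = Trivial 'v | Cyclic "'a necklace"

type_synonym ('v, 'a) collection = "('v, 'a) member multiset"

text \<open>
  A presentation \<open>P\<^sub>1 & \<dots> & P\<^sub>k & v\<^sub>1 & \<dots> & v\<^sub>q\<close> of a collection is the list of the words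
  \<open>P\<^sub>i\<close> together with the list of the vertices \<open>v\<^sub>s\<close>.
\<close>

type_synonym ('v, 'a) presentation = "'a list list \<times> 'v list"

definition coll_of :: "('v, 'a) presentation \<Rightarrow> ('v, 'a) collection" where
  "coll_of = (\<lambda>(ws, vs). mset (map (\<lambda>w. Cyclic (abs_necklace w)) ws) + mset (map Trivial vs))"

definition some_pres :: "('v, 'a) collection \<Rightarrow> ('v, 'a) presentation" where
  "some_pres P = (SOME p. coll_of p = P)"

definition cyclic_path :: "('v, 'e) pre_digraph \<Rightarrow> 'e dedge list \<Rightarrow> bool" where
  "cyclic_path Q w \<longleftrightarrow> w \<noteq> [] \<and> set w \<subseteq> dedges Q \<and>
     (\<forall>j < length w. dhead Q (w ! j) = dtail Q (w ! (Suc j mod length w)))"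

definition presentations :: "('v, 'e) pre_digraph \<Rightarrow> ('v, 'e dedge) presentation set" where
  "presentations Q = {(ws, vs). (\<forall>w \<in> set ws. cyclic_path Q w) \<and> set vs \<subseteq> verts Q}"

definition collections :: "('v, 'e) pre_digraph \<Rightarrow> ('v, 'e dedge) collection set" where
  "collections Q = coll_of ` presentations Q"

text \<open>Abstract edges, with indices starting at 0.\<close>

definition abs_edges :: "'a list list \<Rightarrow> (nat \<times> nat) set" where
  "abs_edges ws = {(i, j). i < length ws \<and> j < length (ws ! i)}"

definition edge_at :: "'a list list \<Rightarrow> nat \<times> nat \<Rightarrow> 'a" where
  "edge_at ws = (\<lambda>(i, j). ws ! i ! j)"

definition next_edge :: "'a list list \<Rightarrow> nat \<times> nat \<Rightarrow> nat \<times> nat" where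
  "next_edge ws = (\<lambda>(i, j). (i, Suc j mod length (ws ! i)))"

section \<open>Cutting and gluing\<close>

definition glue_step ::
  "'a list list \<Rightarrow> (nat \<times> nat) set \<Rightarrow> (nat \<times> nat \<Rightarrow> nat \<times> nat) \<Rightarrow> nat \<times> nat \<Rightarrow> nat \<times> nat" where
  "glue_step ws J \<phi> z = (if z \<in> J then next_edge ws (\<phi> z) else next_edge ws z)"

definition orbit_word :: "('z \<Rightarrow> 'z) \<Rightarrow> 'z set \<Rightarrow> 'z list" where
  "orbit_word f S = map (\<lambda>n. (f ^^ n) (SOME z. z \<in> S)) [0..<card S]"

text \<open>
  The function \<open>lab\<close> gives the letters of the glued collection: the edges themselves for
  collections without heights, and the edges with their new heights for collections with heights.
\<close>

definition glued_member ::
  "('v, 'e) pre_digraph \<Rightarrow> 'e dedge list list \<Rightarrow> (nat \<times> nat) set \<Rightarrow> (nat \<times> nat \<Rightarrow> nat \<times> nat) \<Rightarrow>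
   (nat \<times> nat \<Rightarrow> 'b) \<Rightarrow> (nat \<times> nat) set \<Rightarrow> ('v, 'b) member" where
  "glued_member Q ws J \<phi> lab S =
     (if S \<subseteq> J then Trivial (dtail Q (edge_at ws (SOME z. z \<in> S)))
      else Cyclic (abs_necklace (map lab (filter (\<lambda>z. z \<notin> J) (orbit_word (glue_step ws J \<phi>) S)))))"

definition glue ::
  "('v, 'e) pre_digraph \<Rightarrow> ('v, 'e dedge) presentation \<Rightarrow> (nat \<times> nat) set \<Rightarrow>
   (nat \<times> nat \<Rightarrow> nat \<times> nat) \<Rightarrow> (nat \<times> nat \<Rightarrow> 'b) \<Rightarrow> ('v, 'b) collection" where
  "glue Q = (\<lambda>(ws, vs) J \<phi> lab.
     image_mset (glued_member Q ws J \<phi> lab)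
       (mset_set (Orbits.orbit (glue_step ws J \<phi>) ` abs_edges ws))
     + mset (map Trivial vs))"

section \<open>Free modules over polynomials in h\<close>

text \<open>
  The free \<open>k[h]\<close>-module on a set \<open>B\<close> is the set of all \<open>f :: 'b \<Rightarrow>\<^sub>0 'k poly\<close> with
  \<open>Poly_Mapping.keys f \<subseteq> B\<close>; the polynomial variable is \<open>h\<close>.
\<close>

abbreviation kh :: "'k::field_char_0 poly ring" where
  "kh \<equiv> ring_of_type_algebra"

definition scale :: "'r::comm_ring_1 \<Rightarrow> ('b \<Rightarrow>\<^sub>0 'r) \<Rightarrow> ('b \<Rightarrow>\<^sub>0 'r)" where
  "scale c = Poly_Mapping.map ((*) c)"

definition linear_ext :: "('a \<Rightarrow> ('b \<Rightarrow>\<^sub>0 'r)) \<Rightarrow> ('a \<Rightarrow>\<^sub>0 'r) \<Rightarrow> ('b \<Rightarrow>\<^sub>0 'r::comm_ring_1)" where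
  "linear_ext g f = (\<Sum>a\<in>Poly_Mapping.keys f. scale (Poly_Mapping.lookup f a) (g a))"

definition bilinear_ext ::
  "('a \<Rightarrow> 'a \<Rightarrow> ('b \<Rightarrow>\<^sub>0 'r)) \<Rightarrow> ('a \<Rightarrow>\<^sub>0 'r) \<Rightarrow> ('a \<Rightarrow>\<^sub>0 'r) \<Rightarrow> ('b \<Rightarrow>\<^sub>0 'r::comm_ring_1)" where
  "bilinear_ext g f f' = linear_ext (\<lambda>a. linear_ext (g a) f') f"

section \<open>The product on the symmetric algebra\<close>

text \<open>
  In the presentation obtained by concatenation, the abstract edges of the first factor keep
  their indices, and those of the second factor are the remaining ones.
\<close>

definition juxtapose :: "('v, 'a) presentation \<Rightarrow> ('v, 'a) presentation \<Rightarrow> ('v, 'a) presentation" where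
  "juxtapose = (\<lambda>(ws, vs) (us, xs). (ws @ us, vs @ xs))"

definition gluings ::
  "'e dedge list list \<Rightarrow> (nat \<times> nat) set \<Rightarrow> (nat \<times> nat) set \<Rightarrow>
   ((nat \<times> nat) set \<times> (nat \<times> nat) set \<times> (nat \<times> nat \<Rightarrow> nat \<times> nat)) set" where
  "gluings zs XE YE = {(A, B, \<phi>). A \<subseteq> XE \<and> B \<subseteq> YE \<and> \<phi> \<in> extensional A \<and> bij_betw \<phi> A B \<and>
     (\<forall>x\<in>A. edge_at zs (\<phi> x) = rev_edge (edge_at zs x))}"

definition star_basis ::
  "('v, 'e) pre_digraph \<Rightarrow> ('v, 'e dedge) collection \<Rightarrow> ('v, 'e dedge) collection \<Rightarrow>
   ('v, 'e dedge) collection \<Rightarrow>\<^sub>0 'k::field_char_0 poly" where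
  "star_basis Q P R =
     (let p = juxtapose (some_pres P) (some_pres R);
          zs = fst p;
          XE = abs_edges (fst (some_pres P));
          YE = abs_edges zs - XE
      in \<Sum>(A, B, \<phi>) \<in> gluings zs XE YE.
           Poly_Mapping.single
             (glue Q p (A \<union> B) (\<lambda>z. if z \<in> A then \<phi> z else inv_into A \<phi> z) (edge_at zs))
             (Polynomial.monom ((- 1) ^ card {y \<in> B. is_orig (edge_at zs y)} / 2 ^ card A) (card A)))"

text \<open>The algebra \<open>((Sym L)[h], *\<^sub>h)\<close>.\<close>

definition sym_h ::
  "('v, 'e) pre_digraph \<Rightarrow>
   ('k::field_char_0 poly, ('v, 'e dedge) collection \<Rightarrow>\<^sub>0 'k poly) module" where
  "sym_h Q = \<lparr>carrier = {f. Poly_Mapping.keys f \<subseteq> collections Q},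
     mult = bilinear_ext (star_basis Q),
     one = Poly_Mapping.single {#} 1,
     zero = 0, add = (+), module.smult = scale\<rparr>"

section \<open>The algebra of collections with heights\<close>

definition height_assignments :: "(nat \<times> nat) set \<Rightarrow> (nat \<times> nat \<Rightarrow> nat) set" where
  "height_assignments XE = {H \<in> extensional XE. bij_betw H XE {1..card XE}}"

definition with_heights ::
  "('v, 'a) presentation \<Rightarrow> (nat \<times> nat \<Rightarrow> nat) \<Rightarrow> ('v, 'a \<times> nat) collection" where
  "with_heights = (\<lambda>(ws, vs) H. coll_of
     (map (\<lambda>i. map (\<lambda>j. (edge_at ws (i, j), H (i, j))) [0..<length (ws ! i)]) [0..<length ws], vs))"

definition height_collections ::
  "('v, 'e) pre_digraph \<Rightarrow> ('v, 'e dedge \<times> nat) collection set" where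
  "height_collections Q =
     {with_heights p H | p H. p \<in> presentations Q \<and> H \<in> height_assignments (abs_edges (fst p))}"

definition raise_heights :: "nat \<Rightarrow> ('v, 'a \<times> nat) presentation \<Rightarrow> ('v, 'a \<times> nat) presentation" where
  "raise_heights N = (\<lambda>(us, xs). (map (map (\<lambda>(a, h). (a, h + N))) us, xs))"

definition stack ::
  "('v, 'a \<times> nat) collection \<Rightarrow> ('v, 'a \<times> nat) collection \<Rightarrow> ('v, 'a \<times> nat) collection" where
  "stack P R = (let p = some_pres P
     in coll_of (juxtapose p (raise_heights (card (abs_edges (fst p))) (some_pres R))))"

text \<open>The free module on the collections with heights, with the stacking product.\<close>

definition free_h ::
  "('v, 'e) pre_digraph \<Rightarrow>
   ('k::field_char_0 poly, ('v, 'e dedge \<times> nat) collection \<Rightarrow>\<^sub>0 'k poly) module" where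
  "free_h Q = \<lparr>carrier = {f. Poly_Mapping.keys f \<subseteq> height_collections Q},
     mult = bilinear_ext (\<lambda>P R. Poly_Mapping.single (stack P R) 1),
     one = Poly_Mapping.single {#} 1,
     zero = 0, add = (+), module.smult = scale\<rparr>"

definition swap_heights ::
  "(nat \<times> nat \<Rightarrow> nat) \<Rightarrow> nat \<times> nat \<Rightarrow> nat \<times> nat \<Rightarrow> nat \<times> nat \<Rightarrow> nat" where
  "swap_heights H x y = H(x := H y, y := H x)"

text \<open>The height assignment on \<open>Z\<close> inducing the same order as \<open>H\<close>.\<close>

definition restrict_heights ::
  "(nat \<times> nat \<Rightarrow> nat) \<Rightarrow> (nat \<times> nat) set \<Rightarrow> nat \<times> nat \<Rightarrow> nat" where
  "restrict_heights H Z z = card {w \<in> Z. H w \<le> H z}"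

definition relation ::
  "('v, 'e) pre_digraph \<Rightarrow> ('v, 'e dedge) presentation \<Rightarrow> (nat \<times> nat \<Rightarrow> nat) \<Rightarrow>
   nat \<times> nat \<Rightarrow> nat \<times> nat \<Rightarrow> ('v, 'e dedge \<times> nat) collection \<Rightarrow>\<^sub>0 'k::field_char_0 poly" where
  "relation Q p H x y =
     (let ws = fst p; H'' = restrict_heights H (abs_edges ws - {x, y})
      in Poly_Mapping.single (with_heights p H) 1
         - Poly_Mapping.single (with_heights p (swap_heights H x y)) 1
         - Poly_Mapping.single
             (glue Q p {x, y} (\<lambda>z. if z = x then y else x) (\<lambda>z. (edge_at ws z, H'' z)))
             (Polynomial.monom (bracket (edge_at ws x) (edge_at ws y)) 1))"

definition relations ::
  "('v, 'e) pre_digraph \<Rightarrow> (('v, 'e dedge \<times> nat) collection \<Rightarrow>\<^sub>0 'k::field_char_0 poly) set" where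
  "relations Q = {relation Q p H x y | p H x y.
     p \<in> presentations Q \<and> H \<in> height_assignments (abs_edges (fst p)) \<and>
     x \<in> abs_edges (fst p) \<and> y \<in> abs_edges (fst p) \<and> H y = H x + 1}"

definition relation_submodule ::
  "('v, 'e) pre_digraph \<Rightarrow> (('v, 'e dedge \<times> nat) collection \<Rightarrow>\<^sub>0 'k::field_char_0 poly) set" where
  "relation_submodule Q = (\<lambda>N. submodule N kh (free_h Q)) hull relations Q"

text \<open>
  The operations on cosets are those of \<^const>\<open>FactRing\<close>; scalar multiplication is defined in the
  same style. All of them are induced from representatives.
\<close>

definition A_h ::
  "('v, 'e) pre_digraph \<Rightarrow>
   ('k::field_char_0 poly, (('v, 'e dedge \<times> nat) collection \<Rightarrow>\<^sub>0 'k poly) set) module" where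
  "A_h Q = (let F = free_h Q; N = relation_submodule Q; A = F Quot N in
     \<lparr>carrier = carrier A, mult = mult A, one = one A, zero = zero A, add = add A,
      module.smult = (\<lambda>c U. \<Union>u\<in>U. N +>\<^bsub>F\<^esub> (c \<odot>\<^bsub>F\<^esub> u))\<rparr>)"

section \<open>Symmetrization\<close>

definition symm_basis ::
  "('v, 'e dedge) collection \<Rightarrow> ('v, 'e dedge \<times> nat) collection \<Rightarrow>\<^sub>0 'k::field_char_0 poly" where
  "symm_basis P =
     (let p = some_pres P; XE = abs_edges (fst p)
      in \<Sum>H\<in>height_assignments XE. Poly_Mapping.single (with_heights p H) [:1 / fact (card XE):])"

definition Phi_W ::
  "('v, 'e) pre_digraph \<Rightarrow> (('v, 'e dedge) collection \<Rightarrow>\<^sub>0 'k::field_char_0 poly) \<Rightarrow>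
   (('v, 'e dedge \<times> nat) collection \<Rightarrow>\<^sub>0 'k poly) set" where
  "Phi_W Q f = relation_submodule Q +>\<^bsub>free_h Q\<^esub> linear_ext symm_basis f"

section \<open>Associative algebras and module isomorphisms\<close>

text \<open>Unlike \<^locale>\<open>algebra\<close>, the following does not require commutativity.\<close>

locale assoc_algebra = Module.module + ring M +
  assumes smult_mult_left:
      "\<lbrakk>a \<in> carrier R; x \<in> carrier M; y \<in> carrier M\<rbrakk>
        \<Longrightarrow> (a \<odot>\<^bsub>M\<^esub> x) \<otimes>\<^bsub>M\<^esub> y = a \<odot>\<^bsub>M\<^esub> (x \<otimes>\<^bsub>M\<^esub> y)"
    and smult_mult_right:
      "\<lbrakk>a \<in> carrier R; x \<in> carrier M; y \<in> carrier M\<rbrakk>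
        \<Longrightarrow> x \<otimes>\<^bsub>M\<^esub> (a \<odot>\<^bsub>M\<^esub> y) = a \<odot>\<^bsub>M\<^esub> (x \<otimes>\<^bsub>M\<^esub> y)"

definition module_iso ::
  "('r, 'q) ring_scheme \<Rightarrow> ('r, 'a, 'm) module_scheme \<Rightarrow> ('r, 'b, 'n) module_scheme \<Rightarrow> ('a \<Rightarrow> 'b) set"
  where "module_iso R M N = {f. Module.module R M \<and> Module.module R N \<and>
     bij_betw f (carrier M) (carrier N) \<and>
     (\<forall>x\<in>carrier M. \<forall>y\<in>carrier M. f (x \<oplus>\<^bsub>M\<^esub> y) = f x \<oplus>\<^bsub>N\<^esub> f y) \<and>
     (\<forall>c\<in>carrier R. \<forall>x\<in>carrier M. f (c \<odot>\<^bsub>M\<^esub> x) = c \<odot>\<^bsub>N\<^esub> f x)}"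

definition algebra_iso ::
  "('r, 'q) ring_scheme \<Rightarrow> ('r, 'a, 'm) module_scheme \<Rightarrow> ('r, 'b, 'n) module_scheme \<Rightarrow> ('a \<Rightarrow> 'b) set"
  where "algebra_iso R M N =
    {f \<in> module_iso R M N \<inter> ring_iso M N. assoc_algebra R M \<and> assoc_algebra R N}"

end

theory Submission
  imports Defs
begin

text \<open>
  The inverse of symmetrization is the Wick map. It sends \<open>P\<^sub>H\<close> to the sum, over all sets of
  disjoint pairs of mutually reverse abstract edges, of the collection glued along these pairs,
  where a pair \<open>x, y\<close> with \<open>H x < H y\<close> contributes the factor \<open>h [x, y] / 2\<close>. Exchanging two
  adjacent heights affects only the terms that pair these two edges, and gluing in two stages is
  gluing in one; hence the Wick map kills the relations. In the average over the heights of \<open>P\<close>, a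
  term with a pair inside \<open>P\<close> cancels against the one with the two heights of that pair exchanged.
  So only pairs between \<open>P\<close> and \<open>R\<close> survive in the Wick image of \<open>\<Phi>(P) \<Phi>(R)\<close>, which therefore is
  \<open>P *\<^sub>h R\<close>; the case of empty \<open>R\<close> shows that symmetrization is injective. It is surjective by
  induction on the number of edges, as adjacent exchanges connect all height assignments modulo
  collections with fewer edges.
\<close>

section \<open>Cycle decompositions and collections of orbits\<close>

text \<open>The obstacle is that abstract edges exist only after choices: a collection is a multiset
  of rotation classes, and the definitions choose a presentation, a starting edge of each orbit and
  a start vertex. The proof therefore works with a finite index set, a successor permutation and
  labels. A pairing \<open>\<phi>\<close> then just replaces the successor \<open>s\<close> by
  \<open>s \<circ> \<phi>\<close>, and cutting deletes the glued points from this permutation one at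
  a time, each deleted fixed point leaving a trivial path. Gluing in stages becomes a statement
  about deleting points. The factor 1/2 is forced: exchanging the heights of a pair flips the sign
  of its weight, so the difference is twice the weight, and twice \<open>[x, y] / 2\<close> is the
  coefficient in the relation. Associativity, the unit laws and even closure of the star product are
  not checked on glued collections; they come from the quotient through the bijection with it, since
  stacking is evidently associative.\<close>

lemma filter_rotate: "\<exists>m. filter P (rotate k w) = rotate m (filter P w)"
proof (induction k)
  case 0
  show ?case by (metis id_apply rotate0)
next
  case (Suc k)
  have *: "\<exists>m. filter P (rotate1 u) = rotate m (filter P u)" for u :: "'a list"
  proof (cases u)
    case (Cons x v)
    show ?thesis
    proof (cases "P x")
      case True
      then show ?thesis using Cons by (intro exI[of _ 1]) simp
    next
      case False
      then show ?thesis using Cons by (intro exI[of _ 0]) simp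
    qed
  qed simp
  then show ?case
    using Suc by (metis rotate_Suc rotate_rotate)
qed

lemma abs_necklace_rotate: "abs_necklace (rotate n w) = abs_necklace w"
  by (rule sym) (auto simp: necklace.abs_eq_iff)

text \<open>\<open>map f w = rotate1 w\<close> says that \<open>f\<close> moves each letter of
  \<open>w\<close> to its cyclic successor; with all letters distinct, the words list the orbits of
  \<open>f\<close> on \<open>E\<close>, each with a starting point.\<close>

definition cycles :: "('z \<Rightarrow> 'z) \<Rightarrow> 'z set \<Rightarrow> 'z list list \<Rightarrow> bool" where
  "cycles f E ws \<longleftrightarrow> (\<forall>w\<in>set ws. w \<noteq> [] \<and> map f w = rotate1 w) \<and> distinct (concat ws) \<and>
     set (concat ws) = E"

text \<open>
  The glued collections for an arbitrary index set \<open>E\<close> and permutation \<open>f\<close>, so that reindexing,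
  disjoint unions and repeated cutting stay within one notion. The choices in the definition
  disappear once the collection is computed from a cycle decomposition.
\<close>

definition orbit_coll ::
  "'z set \<Rightarrow> ('z \<Rightarrow> 'z) \<Rightarrow> 'z set \<Rightarrow> ('z \<Rightarrow> 'v) \<Rightarrow> ('z \<Rightarrow> 'b) \<Rightarrow> ('v, 'b) collection" where
  "orbit_coll E f J t lab = image_mset
     (\<lambda>S. if S \<subseteq> J then Trivial (t (SOME z. z \<in> S))
       else Cyclic (abs_necklace (map lab (filter (\<lambda>z. z \<notin> J) (orbit_word f S)))))
     (mset_set (Orbits.orbit f ` E))"

text \<open>The member contributed by one cycle; the head of the word replaces the chosen element of
  the orbit.\<close>

definition word_member ::
  "'z set \<Rightarrow> ('z \<Rightarrow> 'v) \<Rightarrow> ('z \<Rightarrow> 'b) \<Rightarrow> 'z list \<Rightarrow> ('v, 'b) member" where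
  "word_member J t lab w = (if set w \<subseteq> J then Trivial (t (hd w))
     else Cyclic (abs_necklace (map lab (filter (\<lambda>z. z \<notin> J) w))))"

lemma funpow_cycle:
  assumes "map f w = rotate1 w" "i < length w"
  shows "(f ^^ n) (w ! i) = w ! ((i + n) mod length w)"
proof (induction n)
  case (Suc n)
  have *: "f (w ! j) = w ! (Suc j mod length w)" if "j < length w" for j
    using assms(1) that by (metis nth_map nth_rotate1)
  have "(i + n) mod length w < length w"
    using assms(2) by (intro mod_less_divisor) auto
  from *[OF this] show ?case
    by (simp add: Suc mod_Suc_eq)
qed (use assms in simp)

lemma orbit_cycle:
  assumes "map f w = rotate1 w" "z \<in> set w"
  shows "Orbits.orbit f z = set w"
proof -
  obtain i where i: "i < length w" "z = w ! i"
    using assms(2) by (auto simp: in_set_conv_nth)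
  have pos: "0 < length w" using i by auto
  show ?thesis
  proof
    show "Orbits.orbit f z \<subseteq> set w"
      using funpow_cycle[OF assms(1) i(1)] i pos by (auto simp: orbit_altdef)
    show "set w \<subseteq> Orbits.orbit f z"
    proof
      fix y assume "y \<in> set w"
      then obtain j where j: "j < length w" "y = w ! j" by (auto simp: in_set_conv_nth)
      \<comment> \<open>Adding \<open>length w\<close> keeps the exponent positive, as
        \<open>Orbits.orbit\<close> consists of positive iterates only, and avoids truncation of
        \<open>j - i\<close>.\<close>
      have "y = (f ^^ (length w + j - i)) z"
        using funpow_cycle[OF assms(1) i(1), of "length w + j - i"] i j by simp
      moreover have "0 < length w + j - i" using i by simp
      ultimately show "y \<in> Orbits.orbit f z"
        unfolding orbit_altdef by blast
    qed
  qed
qed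

text \<open>The starting point chosen by \<open>orbit_word\<close> affects only the rotation of the
  word, which a necklace forgets.\<close>

lemma orbit_word_cycle:
  assumes "map f w = rotate1 w" "w \<noteq> []" "distinct w"
  shows "\<exists>k. orbit_word f (set w) = rotate k w"
proof -
  have "(SOME z. z \<in> set w) \<in> set w"
    using hd_in_set[OF assms(2)] by (rule someI)
  then obtain k where k: "k < length w" "(SOME z. z \<in> set w) = w ! k"
    using in_set_conv_nth[of "SOME z. z \<in> set w" w] by metis
  have "orbit_word f (set w) = rotate k w"
    unfolding orbit_word_def k(2)
  proof (rule nth_equalityI)
    fix i assume "i < length (map (\<lambda>n. (f ^^ n) (w ! k)) [0..<card (set w)])"
    then have i: "i < length w" using assms(3) by (simp add: distinct_card)
    then show "map (\<lambda>n. (f ^^ n) (w ! k)) [0..<card (set w)] ! i = rotate k w ! i"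
      using assms(3) by (simp add: distinct_card funpow_cycle[OF assms(1) k(1)] nth_rotate)
  qed (use assms(3) in \<open>simp add: distinct_card\<close>)
  then show ?thesis ..
qed

text \<open>Nonempty words with disjoint letters have different sets. Hence the set of orbits in
  \<open>orbit_coll\<close> loses no multiplicity against the list of words.\<close>

lemma cycles_distinct_sets:
  assumes "cycles f E ws"
  shows "distinct (map set ws)"
  using assms unfolding cycles_def
proof (induction ws arbitrary: E)
  case (Cons w ws)
  have "set w \<notin> set (map set ws)"
  proof
    assume "set w \<in> set (map set ws)"
    then have "set w \<subseteq> set (concat ws)" by auto
    moreover have "set w \<inter> set (concat ws) = {}" "w \<noteq> []" using Cons.prems by auto
    ultimately show False by (metis inf.absorb1 set_empty)
  qed
  then show ?case using Cons by auto
qed simp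

text \<open>Along a cycle inside \<open>J\<close> the map \<open>t\<close> is invariant under
  \<open>f\<close>, so the start vertex of a trivial path does not depend on the edge that is
  chosen.\<close>

lemma tail_const_on_cycle:
  assumes "map f w = rotate1 w" "set w \<subseteq> J" "\<forall>z\<in>set w. t (f z) = t z" "z \<in> set w"
  shows "t z = t (hd w)"
proof -
  have "z \<in> Orbits.orbit f (hd w)"
    using assms orbit_cycle[OF assms(1), of "hd w"] by (metis hd_in_set list.set_cases neq_Nil_conv)
  then show ?thesis
  proof (induction rule: orbit.induct)
    case base
    then show ?case using assms by (metis hd_in_set length_pos_if_in_set length_greater_0_conv)
  next
    case (step y)
    then have "y \<in> set w"
      using assms orbit_cycle[OF assms(1), of "hd w"] by (metis hd_in_set length_pos_if_in_set length_greater_0_conv)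
    then show ?case using step assms by simp
  qed
qed

text \<open>The way out of all choices: any cycle decomposition computes the collection, since
  another starting edge rotates the word and, inside \<open>J\<close>, leaves the start vertex
  unchanged.\<close>

lemma orbit_coll_cycles:
  assumes c: "cycles f E ws" and t: "\<forall>z\<in>E \<inter> J. t (f z) = t z"
  shows "orbit_coll E f J t lab = mset (map (word_member J t lab) ws)"
proof -
  have w: "w \<noteq> []" "map f w = rotate1 w" "distinct w" "set w \<subseteq> E" if "w \<in> set ws" for w
    using c that by (auto simp: cycles_def distinct_concat_iff)
  have E: "E = \<Union> (set ` set ws)"
    using c by (auto simp: cycles_def)
  have "Orbits.orbit f ` E = set (map set ws)"
  proof
    show "Orbits.orbit f ` E \<subseteq> set (map set ws)"
      using orbit_cycle[OF w(2)] unfolding E by auto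
    show "set (map set ws) \<subseteq> Orbits.orbit f ` E"
    proof
      fix S assume "S \<in> set (map set ws)"
      then obtain v where v: "v \<in> set ws" "S = set v" by auto
      have "hd v \<in> set v" "hd v \<in> E" using w[OF v(1)] by auto
      then show "S \<in> Orbits.orbit f ` E"
        using orbit_cycle[OF w(2)[OF v(1)]] v by blast
    qed
  qed
  then have m: "mset_set (Orbits.orbit f ` E) = mset (map set ws)"
    using cycles_distinct_sets[OF c] by (metis mset_set_set)
  have "(if set w \<subseteq> J then Trivial (t (SOME z. z \<in> set w))
       else Cyclic (abs_necklace (map lab (filter (\<lambda>z. z \<notin> J) (orbit_word f (set w)))))) =
       word_member J t lab w" if "w \<in> set ws" for w
  proof (cases "set w \<subseteq> J")
    case True
    have "(SOME z. z \<in> set w) \<in> set w"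
      using hd_in_set[OF w(1)[OF that]] by (rule someI)
    then have "t (SOME z. z \<in> set w) = t (hd w)"
      by (intro tail_const_on_cycle[OF w(2)[OF that] True]) (use t w(4)[OF that] True in blast)+
    then show ?thesis using True by (simp add: word_member_def)
  next
    case False
    note k_ex = orbit_word_cycle[OF w(2)[OF that] w(1)[OF that] w(3)[OF that]]
    obtain k where k: "orbit_word f (set w) = rotate k w"
      using k_ex ..
    obtain m where m: "filter (\<lambda>z. z \<notin> J) (rotate k w) = rotate m (filter (\<lambda>z. z \<notin> J) w)"
      using filter_rotate[of "\<lambda>z. z \<notin> J" k w] ..
    have "map lab (filter (\<lambda>z. z \<notin> J) (orbit_word f (set w))) =
        rotate m (map lab (filter (\<lambda>z. z \<notin> J) w))"
      unfolding k m by (rule rotate_map[symmetric])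
    then show ?thesis using False by (simp add: word_member_def abs_necklace_rotate)
  qed
  then have "map (\<lambda>w. if set w \<subseteq> J then Trivial (t (SOME z. z \<in> set w))
       else Cyclic (abs_necklace (map lab (filter (\<lambda>z. z \<notin> J) (orbit_word f (set w)))))) ws =
       map (word_member J t lab) ws" by simp
  then show ?thesis unfolding orbit_coll_def m
    by (simp only: mset_map[symmetric] map_map comp_def)
qed

text \<open>The first return map of \<open>f\<close> to the complement of \<open>x\<close>: the
  point before \<open>x\<close> is sent to the point after it.\<close>

definition remove_point :: "('z \<Rightarrow> 'z) \<Rightarrow> 'z \<Rightarrow> 'z \<Rightarrow> 'z" where
  "remove_point f x z = (if f z = x then f x else f z)"

lemma bij_remove_point:
  assumes f: "bij_betw f E E" and x: "x \<in> E"
  shows "bij_betw (remove_point f x) (E - {x}) (E - {x})"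
proof (rule bij_betw_imageI)
  note inj = bij_betw_imp_inj_on[OF f] and im = bij_betw_imp_surj_on[OF f]
  show "inj_on (remove_point f x) (E - {x})"
    using inj x by (auto simp: inj_on_def remove_point_def split: if_splits)
  show "remove_point f x ` (E - {x}) = E - {x}"
  proof
    show "remove_point f x ` (E - {x}) \<subseteq> E - {x}"
    proof
      fix y assume "y \<in> remove_point f x ` (E - {x})"
      then obtain z where z: "z \<in> E" "z \<noteq> x" "y = remove_point f x z" by blast
      have "f z \<in> E" "f x \<in> E" using im z(1) x by blast+
      moreover have "f z \<noteq> f x" using inj z x by (meson inj_onD)
      ultimately show "y \<in> E - {x}" using z by (auto simp: remove_point_def)
    qed
    show "E - {x} \<subseteq> remove_point f x ` (E - {x})"
    proof
      fix y assume y: "y \<in> E - {x}"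
      then obtain z where z: "z \<in> E" "f z = y" using im by (metis DiffD1 imageE)
      obtain u where u: "u \<in> E" "f u = x" using im x by (metis imageE)
      show "y \<in> remove_point f x ` (E - {x})"
      proof (cases "z = x")
        case True
        then have "u \<noteq> x" "remove_point f x u = y" using y z u by (auto simp: remove_point_def)
        then show ?thesis using u by blast
      next
        case False
        then have "remove_point f x z = y" using y z by (auto simp: remove_point_def)
        then show ?thesis using z False by blast
      qed
    qed
  qed
qed

lemma cycles_rotate_word:
  assumes "cycles f E (us @ w # vs)"
  shows "cycles f E (us @ rotate k w # vs)"
proof -
  have "map f w = rotate1 w" using assms by (auto simp: cycles_def)
  then have "map f (rotate k w) = rotate1 (rotate k w)"
    by (metis rotate1_rotate_swap rotate_map)
  then show ?thesis using assms by (simp add: cycles_def)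
qed

lemma cycles_perm:
  assumes "cycles f E ws" "mset ws = mset us" shows "cycles f E us"
proof -
  have "mset (concat ws) = mset (concat us)"
    using assms(2) by (metis mset_concat mset_map sum_mset_sum_list)
  moreover have "set ws = set us" using assms(2) mset_eq_setD by blast
  ultimately show ?thesis using assms(1) unfolding cycles_def
    by (metis mset_eq_imp_distinct_iff mset_eq_setD)
qed

lemma cycles_with_head:
  assumes "cycles f E ws" "x \<in> E"
  shows "\<exists>u us. cycles f E ((x # u) # us)"
proof -
  obtain w where w: "w \<in> set ws" "x \<in> set w" using assms by (auto simp: cycles_def)
  obtain as bs where ab: "ws = as @ w # bs" using w(1) by (meson split_list)
  obtain p q where pq: "w = p @ x # q" using w(2) by (meson split_list)
  have "rotate (length p) w = x # q @ p" using pq by (simp add: rotate_append)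
  then have "cycles f E (as @ (x # q @ p) # bs)"
    using cycles_rotate_word assms(1) ab by metis
  then have "cycles f E ((x # q @ p) # as @ bs)"
    by (rule cycles_perm) simp
  then show ?thesis by blast
qed

text \<open>In a decomposition that starts with \<open>x\<close>, passing to the first return map
  just drops this letter; the word disappears exactly when \<open>x\<close> is a fixed
  point.\<close>

lemma cycles_remove_point:
  assumes c: "cycles f E ((x # u) # us)"
  shows "cycles (remove_point f x) (E - {x}) (if u = [] then us else u # us)"
proof -
  have us: "map (remove_point f x) w = rotate1 w" if "w \<in> set us" for w
  proof -
    have "map f w = rotate1 w" "x \<notin> set w" using c that by (auto simp: cycles_def)
    moreover have "remove_point f x z = f z" if "z \<in> set w" for z
      using that calculation by (metis image_eqI list.set_map remove_point_def set_rotate1)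
    ultimately show ?thesis by (metis map_cong)
  qed
  have u: "map (remove_point f x) u = rotate1 u" if "u \<noteq> []"
  proof -
    obtain y v where yv: "u = y # v" using \<open>u \<noteq> []\<close> by (meson neq_Nil_conv)
    have fx: "f x = y" and fu: "map f u = v @ [x]" and nx: "x \<notin> set v"
      using c yv by (auto simp: cycles_def)
    have "map (remove_point f x) u = map (\<lambda>a. if a = x then y else a) (map f u)"
      by (simp add: remove_point_def fx)
    also have "\<dots> = v @ [y]" unfolding fu using nx by (induction v) auto
    finally show ?thesis using yv by simp
  qed
  show ?thesis using c us u by (auto simp: cycles_def)
qed

text \<open>Reverses the deletion: \<open>x\<close> is put back in front of \<open>f x\<close>. This
  is the induction step for the existence of cycle decompositions.\<close>

lemma cycles_insert_point:
  assumes f: "bij_betw f E E" and x: "x \<in> E"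
    and c: "cycles (remove_point f x) (E - {x}) ws"
  shows "\<exists>ws. cycles f E ws"
proof -
  note inj = bij_betw_imp_inj_on[OF f] and im = bij_betw_imp_surj_on[OF f]
  have same: "map f w = rotate1 w"
    if "map (remove_point f x) w = rotate1 w" "set w \<subseteq> E - {x}" "f x \<notin> set w" for w
  proof -
    have "remove_point f x z = f z" if "z \<in> set w" for z
      using that \<open>map (remove_point f x) w = rotate1 w\<close> \<open>f x \<notin> set w\<close>
      by (metis image_eqI list.set_map remove_point_def set_rotate1)
    then show ?thesis using that by (metis map_cong)
  qed
  show ?thesis
  proof (cases "f x = x")
    case True
    have "map f w = rotate1 w" if "w \<in> set ws" for w
      using c that True by (intro same) (auto simp: cycles_def)
    then have "cycles f E ([x] # ws)"
      using c True x unfolding cycles_def by auto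
    then show ?thesis ..
  next
    case False
    then have "f x \<in> E - {x}" using im x by blast
    then obtain v us where v: "cycles (remove_point f x) (E - {x}) ((f x # v) # us)"
      using cycles_with_head[OF c] by blast
    have rem: "map (remove_point f x) (f x # v) = v @ [f x]" using v by (auto simp: cycles_def)
    have sub: "set (f x # v) \<subseteq> E - {x}" and nv: "f x \<notin> set v" using v by (auto simp: cycles_def)
    obtain q where q: "q \<in> E" "f q = x" using im x by (metis imageE)
    have "q \<noteq> x" using q False by auto
    \<comment> \<open>Only the last letter of the word is affected: \<open>remove_point f x\<close>
      sends it to \<open>f x\<close>, hence \<open>f\<close> sends it to \<open>x\<close>.\<close>
    have "map f (f x # v) = v @ [x]"
    proof (rule nth_equalityI)
      show "length (map f (f x # v)) = length (v @ [x])" by simp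
      fix i assume i: "i < length (map f (f x # v))"
      let ?z = "(f x # v) ! i"
      have z: "?z \<in> E" "?z \<noteq> x" using sub i nth_mem[of i "f x # v"] by (auto simp del: nth_mem)
      have r: "remove_point f x ?z = (v @ [f x]) ! i"
        using i rem by (metis length_map nth_map)
      show "map f (f x # v) ! i = (v @ [x]) ! i"
      proof (cases "i < length v")
        case True
        then have "remove_point f x ?z \<noteq> f x" using r nv by (metis True nth_append nth_mem)
        then have "f ?z = remove_point f x ?z" by (metis remove_point_def)
        moreover have "map f (f x # v) ! i = f ?z" using i by (metis length_map nth_map)
        ultimately show ?thesis using r True by (simp add: nth_append)
      next
        case False
        then have "remove_point f x ?z = f x" using r i by (simp add: nth_append)
        then have "f ?z = x" using inj z x by (auto simp: remove_point_def inj_on_def split: if_splits)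
        moreover have "map f (f x # v) ! i = f ?z" using i by (metis length_map nth_map)
        ultimately show ?thesis using False i by (simp add: nth_append)
      qed
    qed
    then have "map f (x # f x # v) = rotate1 (x # f x # v)" by simp
    moreover have "map f w = rotate1 w" if "w \<in> set us" for w
      using v that by (intro same) (auto simp: cycles_def)
    ultimately have "cycles f E ((x # f x # v) # us)"
      using v x unfolding cycles_def by auto
    then show ?thesis ..
  qed
qed

lemma cycles_exist:
  assumes "finite E" "bij_betw f E E"
  shows "\<exists>ws. cycles f E ws"
  using assms
proof (induction "card E" arbitrary: E f)
  case 0
  then have "cycles f E []" by (auto simp: cycles_def)
  then show ?case ..
next
  case (Suc n)
  then obtain x where x: "x \<in> E" by (metis card.empty ex_in_conv nat.simps(3))
  have "\<exists>ws. cycles (remove_point f x) (E - {x}) ws"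
    using Suc x by (intro Suc.hyps(1) bij_remove_point) auto
  then show ?case using cycles_insert_point Suc x by metis
qed

lemma cycles_map:
  assumes "cycles f E ws" "bij_betw p E Y" "\<And>z. z \<in> E \<Longrightarrow> g (p z) = p (f z)"
  shows "cycles g Y (map (map p) ws)"
proof -
  have inj: "inj_on p E" and im: "p ` E = Y" using assms(2) by (auto simp: bij_betw_def)
  have E: "set (concat ws) = E" using assms(1) by (auto simp: cycles_def)
  have "map g (map p w) = rotate1 (map p w)" if "w \<in> set ws" for w
  proof -
    have "map f w = rotate1 w" and "set w \<subseteq> E" using assms(1) that by (auto simp: cycles_def)
    then have "map g (map p w) = map p (map f w)" unfolding map_map
      by (intro map_cong refl) (auto simp: assms(3))
    then show ?thesis using \<open>map f w = rotate1 w\<close> by (simp add: rotate1_map)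
  qed
  moreover have "concat (map (map p) ws) = map p (concat ws)" by (simp add: map_concat)
  ultimately show ?thesis using assms(1) inj E im
    unfolding cycles_def by (auto simp: distinct_map)
qed

text \<open>Reindexing along a bijection carries cycles to cycles. Labels need to agree outside
  \<open>J\<close> only, as the letters in \<open>J\<close> are cut away.\<close>

lemma orbit_coll_iso:
  assumes fin: "finite E" and f: "bij_betw f E E" and t: "\<forall>z\<in>E \<inter> J. t (f z) = t z"
    and p: "bij_betw p E Y" and g: "\<And>z. z \<in> E \<Longrightarrow> g (p z) = p (f z)"
    and J: "\<And>z. z \<in> E \<Longrightarrow> p z \<in> J' \<longleftrightarrow> z \<in> J"
    and t': "\<And>z. z \<in> E \<Longrightarrow> t' (p z) = t z"
    and lab: "\<And>z. z \<in> E - J \<Longrightarrow> lab' (p z) = lab z"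
  shows "orbit_coll Y g J' t' lab' = orbit_coll E f J t lab"
proof -
  obtain ws where ws: "cycles f E ws" using cycles_exist[OF fin f] ..
  have fX: "f z \<in> E" if "z \<in> E" for z using f that by (metis bij_betw_apply)
  have t'': "\<forall>z\<in>Y \<inter> J'. t' (g z) = t' z"
    using p J t t' g fX by (auto simp: bij_betw_def)
  have "word_member J' t' lab' (map p w) = word_member J t lab w" if "w \<in> set ws" for w
  proof -
    have w: "set w \<subseteq> E" "w \<noteq> []" using ws that by (auto simp: cycles_def)
    have "map lab' (filter (\<lambda>z. z \<notin> J') (map p w)) = map lab (filter (\<lambda>z. z \<notin> J) w)"
      using w(1) by (induction w) (auto simp: J lab)
    moreover have "set (map p w) \<subseteq> J' \<longleftrightarrow> set w \<subseteq> J" using w J by auto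
    moreover have "t' (hd (map p w)) = t (hd w)" using w t' by (simp add: hd_map subset_iff)
    ultimately show ?thesis unfolding word_member_def by simp
  qed
  then have "map (word_member J' t' lab') (map (map p) ws) = map (word_member J t lab) ws"
    by simp
  moreover have "orbit_coll Y g J' t' lab' = mset (map (word_member J' t' lab') (map (map p) ws))"
    by (rule orbit_coll_cycles[OF cycles_map[OF ws p g] t''])
  ultimately show ?thesis
    using orbit_coll_cycles[OF ws t, of lab] by (simp only:)
qed

lemma orbit_coll_cong:
  assumes "finite E" "bij_betw f E E" "\<forall>z\<in>E \<inter> J. t (f z) = t z"
    and "\<And>z. z \<in> E \<Longrightarrow> g z = f z" "\<And>z. z \<in> E \<Longrightarrow> z \<in> J' \<longleftrightarrow> z \<in> J"
    and "\<And>z. z \<in> E \<Longrightarrow> t' z = t z" "\<And>z. z \<in> E - J \<Longrightarrow> lab' z = lab z"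
  shows "orbit_coll E g J' t' lab' = orbit_coll E f J t lab"
proof -
  have "bij_betw (\<lambda>z. z) E E" by (simp add: bij_betw_def)
  from orbit_coll_iso[OF assms(1-3) this assms(4-7)] show ?thesis .
qed

lemma orbit_coll_union:
  assumes "finite E" "bij_betw f E E" "finite Y" "bij_betw f Y Y" "E \<inter> Y = {}"
    and "\<forall>z\<in>(E \<union> Y) \<inter> J. t (f z) = t z"
  shows "orbit_coll (E \<union> Y) f J t lab = orbit_coll E f J t lab + orbit_coll Y f J t lab"
proof -
  obtain us where us: "cycles f E us" using cycles_exist[OF assms(1,2)] ..
  obtain vs where vs: "cycles f Y vs" using cycles_exist[OF assms(3,4)] ..
  have "cycles f (E \<union> Y) (us @ vs)" using us vs assms(5) by (auto simp: cycles_def)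
  from orbit_coll_cycles[OF this assms(6)] show ?thesis
    using orbit_coll_cycles[OF us, of J t lab] orbit_coll_cycles[OF vs, of J t lab] assms(6)
    by simp
qed

text \<open>A point of \<open>J\<close> contributes no letter, so it can be skipped in its cycle.
  Only a fixed point takes its whole cycle with it, and that cycle is a trivial path.\<close>

lemma orbit_coll_remove_point:
  assumes fin: "finite E" and f: "bij_betw f E E" and t: "\<forall>z\<in>E \<inter> J. t (f z) = t z"
    and x: "x \<in> E" "x \<in> J"
  shows "orbit_coll E f J t lab = orbit_coll (E - {x}) (remove_point f x) J t lab +
    (if f x = x then {#Trivial (t x)#} else {#})"
proof -
  obtain u us where c: "cycles f E ((x # u) # us)"
    using cycles_exist[OF fin f] cycles_with_head x(1) by metis
  have t': "\<forall>z\<in>(E - {x}) \<inter> J. t (remove_point f x z) = t z"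
  proof
    fix z assume z: "z \<in> (E - {x}) \<inter> J"
    show "t (remove_point f x z) = t z"
      using bspec[OF t, of z] bspec[OF t, of x] z x by (cases "f z = x") (auto simp: remove_point_def)
  qed
  have fx: "f x = x \<longleftrightarrow> u = []"
    using c by (cases u) (auto simp: cycles_def)
  \<comment> \<open>When the head of a cycle inside \<open>J\<close> is deleted, the next letter
    becomes the head; the trivial path must keep its vertex.\<close>
  have hd: "t (hd u) = t x" if "u \<noteq> []"
  proof -
    obtain y v where "u = y # v" using \<open>u \<noteq> []\<close> by (meson neq_Nil_conv)
    then have "f x = hd u" using c by (auto simp: cycles_def)
    then show ?thesis using bspec[OF t, of x] x by simp
  qed
  show ?thesis
    unfolding orbit_coll_cycles[OF c t] orbit_coll_cycles[OF cycles_remove_point[OF c] t'] fx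
    using x hd by (auto simp: word_member_def)
qed

section \<open>Presentations as permutations with labels\<close>

definition edge_lists :: "'a list list \<Rightarrow> (nat \<times> nat) list list" where
  "edge_lists ws = map (\<lambda>i. map (Pair i) [0..<length (ws ! i)]) [0..<length ws]"

lemma set_edge_lists: "set (concat (edge_lists ws)) = abs_edges ws"
  by (auto simp: edge_lists_def abs_edges_def)

lemma finite_abs_edges: "finite (abs_edges ws)"
  unfolding set_edge_lists[symmetric] by simp

lemma card_abs_edges: "card (abs_edges ws) = sum_list (map length ws)"
proof -
  have "abs_edges ws = Sigma {..<length ws} (\<lambda>i. {..<length (ws ! i)})"
    by (auto simp: abs_edges_def)
  then show ?thesis by (simp add: sum_list_sum_nth atLeast0LessThan)
qed

lemma map_edge_at: "map (map (edge_at ws)) (edge_lists ws) = ws"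
  by (rule nth_equalityI) (auto simp: edge_lists_def edge_at_def comp_def map_nth)

lemma distinct_concat_Pair:
  "distinct is \<Longrightarrow> (\<And>i. distinct (g i)) \<Longrightarrow> distinct (concat (map (\<lambda>i. map (Pair i) (g i)) is))"
  by (induction "is") (auto simp: distinct_map inj_on_def)

lemma cycles_edge_lists:
  assumes "\<forall>w\<in>set ws. w \<noteq> []"
  shows "cycles (next_edge ws) (abs_edges ws) (edge_lists ws)"
proof -
  have "map (next_edge ws) (map (Pair i) [0..<length (ws ! i)]) = rotate1 (map (Pair i) [0..<length (ws ! i)])"
    if "i < length ws" for i
  proof (rule nth_equalityI)
    fix j assume "j < length (map (next_edge ws) (map (Pair i) [0..<length (ws ! i)]))"
    then have j: "j < length (ws ! i)" by simp
    then have "Suc j mod length (ws ! i) < length (ws ! i)" by (intro mod_less_divisor) auto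
    then show "map (next_edge ws) (map (Pair i) [0..<length (ws ! i)]) ! j =
        rotate1 (map (Pair i) [0..<length (ws ! i)]) ! j"
      using j by (simp add: next_edge_def nth_rotate1)
  qed simp
  moreover have "ws ! i \<noteq> []" if "i < length ws" for i using assms that by auto
  moreover have "distinct (concat (edge_lists ws))"
    unfolding edge_lists_def by (intro distinct_concat_Pair) auto
  ultimately show ?thesis
    unfolding cycles_def set_edge_lists by (auto simp: edge_lists_def)
qed

lemma coll_of_map_edge_lists:
  assumes "\<forall>w\<in>set ws. w \<noteq> []"
  shows "coll_of (map (map lab) (edge_lists ws), vs) =
    orbit_coll (abs_edges ws) (next_edge ws) {} t lab + image_mset Trivial (mset vs)"
proof -
  have c: "cycles (next_edge ws) (abs_edges ws) (edge_lists ws)"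
    using assms by (rule cycles_edge_lists)
  have "map (word_member {} t lab) (edge_lists ws) =
      map (\<lambda>w. Cyclic (abs_necklace (map lab w))) (edge_lists ws)"
    using c by (auto simp: word_member_def cycles_def)
  moreover have "orbit_coll (abs_edges ws) (next_edge ws) {} t lab =
      mset (map (word_member {} t lab) (edge_lists ws))"
    using c by (rule orbit_coll_cycles) simp
  moreover have "coll_of (map (map lab) (edge_lists ws), vs) =
      mset (map (\<lambda>w. Cyclic (abs_necklace (map lab w))) (edge_lists ws)) + image_mset Trivial (mset vs)"
    by (simp add: coll_of_def image_mset.compositionality comp_def)
  ultimately show ?thesis by (simp only:)
qed

lemma with_heights_edge_lists:
  "with_heights (ws, vs) H = coll_of (map (map (\<lambda>z. (edge_at ws z, H z))) (edge_lists ws), vs)"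
  by (simp add: with_heights_def edge_lists_def comp_def)

lemma cycles_bij:
  assumes "cycles f E ws" shows "finite E" "bij_betw f E E"
proof -
  have E: "E = \<Union> (set ` set ws)" using assms by (auto simp: cycles_def)
  then show fin: "finite E" by simp
  have "f ` set w = set w" if "w \<in> set ws" for w
    using assms that by (metis cycles_def list.set_map set_rotate1)
  then have "f ` E = E" unfolding E by (auto simp: image_UN)
  then show "bij_betw f E E" using fin by (metis bij_betw_def eq_card_imp_inj_on)
qed

lemma bij_betw_edge_at:
  assumes "distinct (concat us)"
  shows "bij_betw (edge_at us) (abs_edges us) (set (concat us))"
proof -
  have s: "concat us = map (edge_at us) (concat (edge_lists us))"
    by (metis map_concat map_edge_at)
  then have "inj_on (edge_at us) (set (concat (edge_lists us)))"
    using assms by (metis distinct_map)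
  moreover have "edge_at us ` set (concat (edge_lists us)) = set (concat us)"
    using s by (metis list.set_map)
  ultimately show ?thesis unfolding bij_betw_def set_edge_lists ..
qed

lemma edge_at_next_edge:
  assumes "cycles f E us" "z \<in> abs_edges us"
  shows "edge_at us (next_edge us z) = f (edge_at us z)"
proof -
  obtain i j where z: "z = (i, j)" "i < length us" "j < length (us ! i)"
    using assms(2) by (auto simp: abs_edges_def)
  have "map f (us ! i) = rotate1 (us ! i)" using assms(1) z(2) by (auto simp: cycles_def)
  then have "f (us ! i ! j) = us ! i ! (Suc j mod length (us ! i))"
    using z(3) by (metis nth_map nth_rotate1)
  then show ?thesis using z by (simp add: edge_at_def next_edge_def)
qed

text \<open>Composability during gluing. Outside \<open>J\<close> an edge is followed by one that
  starts at its head. A glued edge \<open>z\<close> is followed by the successor of its partner, a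
  reversed edge, and that successor starts where \<open>z\<close> starts. For \<open>J = {}\<close>
  these are ordinary cyclic paths.\<close>

definition gluing_data ::
  "('v, 'e) pre_digraph \<Rightarrow> 'z set \<Rightarrow> ('z \<Rightarrow> 'z) \<Rightarrow> 'z set \<Rightarrow> ('z \<Rightarrow> 'e dedge) \<Rightarrow> bool" where
  "gluing_data Q E f J e \<longleftrightarrow> finite E \<and> bij_betw f E E \<and> e ` E \<subseteq> dedges Q \<and>
     (\<forall>z\<in>E. dtail Q (e (f z)) = (if z \<in> J then dtail Q (e z) else dhead Q (e z)))"

lemma rev_edge_rev_edge [simp]: "rev_edge (rev_edge a) = a"
  by (cases a) auto

lemma dhead_rev_edge [simp]: "dhead Q (rev_edge a) = dtail Q a"
  by (simp add: dhead_def)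

lemma dtail_in_verts: "wf_digraph Q \<Longrightarrow> a \<in> dedges Q \<Longrightarrow> dtail Q a \<in> verts Q"
  by (auto simp: dedges_def wf_digraph.tail_in_verts wf_digraph.head_in_verts)

lemma gluing_data_presentation:
  assumes "(ws, vs) \<in> presentations Q"
  shows "gluing_data Q (abs_edges ws) (next_edge ws) {} (edge_at ws)"
proof -
  have w: "cyclic_path Q w" if "w \<in> set ws" for w
    using assms that by (auto simp: presentations_def)
  have "\<forall>w\<in>set ws. w \<noteq> []" using w by (auto simp: cyclic_path_def)
  then have "bij_betw (next_edge ws) (abs_edges ws) (abs_edges ws)"
    using cycles_edge_lists cycles_bij by blast
  moreover have "edge_at ws z \<in> dedges Q \<and> dtail Q (edge_at ws (next_edge ws z)) = dhead Q (edge_at ws z)"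
    if "z \<in> abs_edges ws" for z
  proof -
    obtain i j where z: "z = (i, j)" "i < length ws" "j < length (ws ! i)"
      using \<open>z \<in> abs_edges ws\<close> by (auto simp: abs_edges_def)
    have "cyclic_path Q (ws ! i)" using z w by auto
    then show ?thesis using z unfolding cyclic_path_def edge_at_def next_edge_def
      by (auto simp: subset_iff)
  qed
  ultimately show ?thesis by (auto simp: gluing_data_def finite_abs_edges)
qed

text \<open>Splitting the index set into cycles turns abstract data into words. Thus constructions
  on arbitrary index sets stay within the collections of \<open>Q\<close>.\<close>

lemma gluing_data_realize:
  assumes "gluing_data Q E s {} e"
  shows "\<exists>ws p. (\<forall>w\<in>set ws. cyclic_path Q w) \<and> bij_betw p (abs_edges ws) E \<and>
    (\<forall>z\<in>abs_edges ws. p (next_edge ws z) = s (p z) \<and> edge_at ws z = e (p z))"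
proof -
  obtain us where us: "cycles s E us"
    using cycles_exist[of E s] assms by (auto simp: gluing_data_def)
  let ?ws = "map (map e) us"
  have ae: "abs_edges ?ws = abs_edges us" by (auto simp: abs_edges_def)
  have ne: "next_edge ?ws z = next_edge us z" if "z \<in> abs_edges us" for z
    using that by (auto simp: abs_edges_def next_edge_def)
  have ea: "edge_at ?ws z = e (edge_at us z)" if "z \<in> abs_edges us" for z
    using that by (auto simp: abs_edges_def edge_at_def)
  have "cyclic_path Q (map e u)" if u: "u \<in> set us" for u
  proof -
    have u': "u \<noteq> []" "map s u = rotate1 u" "set u \<subseteq> E" using us u by (auto simp: cycles_def)
    have "dhead Q (map e u ! j) = dtail Q (map e u ! (Suc j mod length (map e u)))"
      if j: "j < length (map e u)" for j
    proof -
      have "u ! j \<in> E" using u' j by auto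
      moreover have "s (u ! j) = u ! (Suc j mod length u)"
        using u' j by (metis length_map nth_map nth_rotate1)
      moreover have "Suc j mod length u < length u" using u' by simp
      ultimately show ?thesis using assms j by (auto simp: gluing_data_def)
    qed
    then show ?thesis using u' assms unfolding cyclic_path_def gluing_data_def by auto
  qed
  moreover have "bij_betw (edge_at us) (abs_edges us) E"
    using bij_betw_edge_at us by (auto simp: cycles_def)
  ultimately show ?thesis
    using edge_at_next_edge[OF us] ae ne ea
    by (intro exI[of _ ?ws] exI[of _ "edge_at us"]) auto
qed

text \<open>The empty set contains no orbit, so the default \<open>undefined\<close> for the vertex
  function is never evaluated; trivial paths enter through \<open>V\<close>.\<close>

definition height_coll ::
  "'z set \<Rightarrow> ('z \<Rightarrow> 'z) \<Rightarrow> ('z \<Rightarrow> 'e dedge) \<Rightarrow> ('z \<Rightarrow> nat) \<Rightarrow> 'v multiset \<Rightarrow> ('v, 'e dedge \<times> nat) collection"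
  where "height_coll E s e h V =
    orbit_coll E s {} (\<lambda>_. undefined) (\<lambda>z. (e z, h z)) + image_mset Trivial V"

lemma with_heights_eq_height_coll:
  assumes "\<forall>w\<in>set ws. w \<noteq> []"
  shows "with_heights (ws, vs) H = height_coll (abs_edges ws) (next_edge ws) (edge_at ws) H (mset vs)"
  unfolding with_heights_edge_lists height_coll_def using assms by (rule coll_of_map_edge_lists)

lemma presentations_nonempty: "(ws, vs) \<in> presentations Q \<Longrightarrow> \<forall>w\<in>set ws. w \<noteq> []"
  by (auto simp: presentations_def cyclic_path_def)

lemma coll_of_eq_orbit_coll:
  assumes "\<forall>w\<in>set ws. w \<noteq> []"
  shows "coll_of (ws, vs) =
    orbit_coll (abs_edges ws) (next_edge ws) {} t (edge_at ws) + image_mset Trivial (mset vs)"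
  using coll_of_map_edge_lists[OF assms, of "edge_at ws" vs t] by (simp only: map_edge_at)

lemma height_coll_iso:
  assumes "finite E" "bij_betw s E E" "bij_betw p E E'" "\<And>z. z \<in> E \<Longrightarrow> s' (p z) = p (s z)"
    and "\<And>z. z \<in> E \<Longrightarrow> e' (p z) = e z" "\<And>z. z \<in> E \<Longrightarrow> h' (p z) = h z"
  shows "height_coll E' s' e' h' V = height_coll E s e h V"
  unfolding height_coll_def
  by (subst orbit_coll_iso[OF assms(1,2) _ assms(3,4)]) (auto simp: assms(5,6))

lemma height_coll_cong:
  assumes "finite E" "bij_betw s E E" "\<And>z. z \<in> E \<Longrightarrow> s' z = s z"
    and "\<And>z. z \<in> E \<Longrightarrow> e' z = e z" "\<And>z. z \<in> E \<Longrightarrow> h' z = h z"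
  shows "height_coll E s' e' h' V = height_coll E s e h V"
proof -
  have "bij_betw (\<lambda>z. z) E E" by (simp add: bij_betw_def)
  from height_coll_iso[OF assms(1,2) this assms(3-5)] show ?thesis .
qed

lemma height_coll_in:
  assumes d: "gluing_data Q E s {} e" and V: "set_mset V \<subseteq> verts Q" and h: "bij_betw h E {1..card E}"
  shows "height_coll E s e h V \<in> height_collections Q"
proof -
  obtain ws p where ws: "\<forall>w\<in>set ws. cyclic_path Q w" "bij_betw p (abs_edges ws) E"
      "\<forall>z\<in>abs_edges ws. p (next_edge ws z) = s (p z) \<and> edge_at ws z = e (p z)"
    using gluing_data_realize[OF d] by blast
  obtain vs where vs: "mset vs = V" using ex_mset by blast
  have pr: "(ws, vs) \<in> presentations Q" using ws V vs by (auto simp: presentations_def)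
  have ne: "\<forall>w\<in>set ws. w \<noteq> []" using presentations_nonempty[OF pr] .
  define H where "H = restrict (h \<circ> p) (abs_edges ws)"
  have c: "card (abs_edges ws) = card E" using bij_betw_same_card[OF ws(2)] .
  have "bij_betw (h \<circ> p) (abs_edges ws) {1..card E}" using ws(2) h by (rule bij_betw_trans)
  then have H: "H \<in> height_assignments (abs_edges ws)"
    unfolding height_assignments_def H_def c by (auto cong: bij_betw_cong)
  have bn: "bij_betw (next_edge ws) (abs_edges ws) (abs_edges ws)"
    using cycles_bij cycles_edge_lists[OF ne] by blast
  have "height_coll E s e h V = height_coll (abs_edges ws) (next_edge ws) (edge_at ws) H V"
    by (rule height_coll_iso[OF finite_abs_edges bn ws(2)]) (use ws(3) in \<open>auto simp: H_def\<close>)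
  also have "\<dots> = with_heights (ws, vs) H"
    using with_heights_eq_height_coll[OF ne, of vs H] vs by simp
  finally show ?thesis unfolding height_collections_def using pr H by force
qed

lemma height_collectionsE:
  assumes "C \<in> height_collections Q"
  obtains ws vs H where "(ws, vs) \<in> presentations Q" "H \<in> height_assignments (abs_edges ws)"
    "C = with_heights (ws, vs) H"
    "C = height_coll (abs_edges ws) (next_edge ws) (edge_at ws) H (mset vs)"
    "gluing_data Q (abs_edges ws) (next_edge ws) {} (edge_at ws)"
proof -
  obtain p H where p: "p \<in> presentations Q" "H \<in> height_assignments (abs_edges (fst p))"
      "C = with_heights p H"
    using assms unfolding height_collections_def by blast
  obtain ws vs where wv: "p = (ws, vs)" by (cases p)
  show ?thesis
    using p unfolding wv fst_conv
    by (intro that[of ws vs H])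
       (auto intro: gluing_data_presentation simp: with_heights_eq_height_coll[OF presentations_nonempty])
qed

text \<open>The predecessor of \<open>x\<close> now precedes \<open>f x\<close>, and
  \<open>x \<in> J\<close> means that \<open>f x\<close> starts where \<open>x\<close>
  starts.\<close>

lemma gluing_data_remove_point:
  assumes d: "gluing_data Q E f J e" and x: "x \<in> E" "x \<in> J"
  shows "gluing_data Q (E - {x}) (remove_point f x) J e"
proof -
  have "dtail Q (e (remove_point f x z)) = (if z \<in> J then dtail Q (e z) else dhead Q (e z))"
    if "z \<in> E - {x}" for z
  proof -
    have "dtail Q (e (f z)) = (if z \<in> J then dtail Q (e z) else dhead Q (e z))"
      and "dtail Q (e (f x)) = dtail Q (e x)"
      using d that x by (auto simp: gluing_data_def)
    then show ?thesis by (auto simp: remove_point_def)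
  qed
  then show ?thesis
    using d x bij_remove_point[of f E x] unfolding gluing_data_def by auto
qed

lemma gluing_data_tail:
  assumes "gluing_data Q E f J e"
  shows "finite E" "bij_betw f E E" "\<forall>z\<in>E \<inter> J. (dtail Q \<circ> e) (f z) = (dtail Q \<circ> e) z"
  using assms by (auto simp: gluing_data_def)

lemma gluing_data_disjoint:
  assumes "gluing_data Q E f J e" "E \<inter> J = {}"
  shows "gluing_data Q E f {} e"
  using assms by (auto simp: gluing_data_def)

section \<open>Wick expansion\<close>

text \<open>A partial matching of mutually reverse edges, encoded as an involution of the whole type
  with the unmatched points fixed; being the identity outside \<open>E\<close> makes the encoding
  unique.\<close>

definition pairings :: "'z set \<Rightarrow> ('z \<Rightarrow> 'e dedge) \<Rightarrow> ('z \<Rightarrow> 'z) set" where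
  "pairings E e = {\<phi>. (\<forall>z. z \<notin> E \<longrightarrow> \<phi> z = z) \<and> (\<forall>z. \<phi> (\<phi> z) = z) \<and>
     (\<forall>z\<in>E. \<phi> z \<noteq> z \<longrightarrow> e (\<phi> z) = rev_edge (e z))}"

lemma pairingsD:
  assumes "\<phi> \<in> pairings E e"
  shows "z \<notin> E \<Longrightarrow> \<phi> z = z" "\<phi> (\<phi> z) = z"
    "z \<in> E \<Longrightarrow> \<phi> z \<noteq> z \<Longrightarrow> e (\<phi> z) = rev_edge (e z)" "z \<in> E \<Longrightarrow> \<phi> z \<in> E"
proof -
  show 1: "\<And>z. z \<notin> E \<Longrightarrow> \<phi> z = z" and 2: "\<And>z. \<phi> (\<phi> z) = z"
    and "z \<in> E \<Longrightarrow> \<phi> z \<noteq> z \<Longrightarrow> e (\<phi> z) = rev_edge (e z)"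
    using assms by (auto simp: pairings_def)
  show "\<phi> z \<in> E" if "z \<in> E" using 1[of "\<phi> z"] 2[of z] that by metis
qed

lemma pairings_permutes: "\<phi> \<in> pairings E e \<Longrightarrow> \<phi> permutes E"
  unfolding permutes_def by (metis pairingsD(1,2))

lemma finite_pairings: "finite E \<Longrightarrow> finite (pairings E e)"
  by (rule finite_subset[OF _ finite_permutations[of E]]) (auto intro: pairings_permutes)

text \<open>Unpaired edges are fixed by \<open>\<phi>\<close>, so \<open>s \<circ> \<phi>\<close> is
  the successor of the cutting rule for both kinds of edges.\<close>

definition glued ::
  "('v, 'e) pre_digraph \<Rightarrow> 'z set \<Rightarrow> ('z \<Rightarrow> 'z) \<Rightarrow> ('z \<Rightarrow> 'e dedge) \<Rightarrow> 'v multiset \<Rightarrow> ('z \<Rightarrow> 'z) \<Rightarrow>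
   ('v, 'e dedge) collection" where
  "glued Q E s e V \<phi> =
     orbit_coll E (s \<circ> \<phi>) {z. \<phi> z \<noteq> z} (dtail Q \<circ> e) e + image_mset Trivial V"

text \<open>This is \<open>bracket a (rev_edge a) / 2\<close>, the coefficient of a pair whose lower
  edge is \<open>a\<close>.\<close>

definition half_sign :: "'e dedge \<Rightarrow> 'k::field_char_0" where
  "half_sign a = (if is_orig a then 1 / 2 else - 1 / 2)"

lemma half_sign_rev_edge: "half_sign (rev_edge a) = - half_sign a"
  by (cases a) (auto simp: half_sign_def)

lemma bracket_eq_half_sign: "bracket a b = (if b = rev_edge a then 2 * half_sign a else 0)"
  by (cases a; cases b) (auto simp: bracket_def half_sign_def)

text \<open>Each pair is counted once, at its lower edge, which fixes the order of the arguments of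
  the bracket.\<close>

definition pair_weight ::
  "'z set \<Rightarrow> ('z \<Rightarrow> 'e dedge) \<Rightarrow> ('z \<Rightarrow> nat) \<Rightarrow> ('z \<Rightarrow> 'z) \<Rightarrow> 'k::field_char_0 poly" where
  "pair_weight E e h \<phi> = (\<Prod>z | z \<in> E \<and> h z < h (\<phi> z). Polynomial.monom (half_sign (e z)) 1)"

definition wick ::
  "('v, 'e) pre_digraph \<Rightarrow> 'z set \<Rightarrow> ('z \<Rightarrow> 'z) \<Rightarrow> ('z \<Rightarrow> 'e dedge) \<Rightarrow> ('z \<Rightarrow> nat) \<Rightarrow> 'v multiset \<Rightarrow>
   ('v, 'e dedge) collection \<Rightarrow>\<^sub>0 'k::field_char_0 poly" where
  "wick Q E s e h V =
     (\<Sum>\<phi>\<in>pairings E e. Poly_Mapping.single (glued Q E s e V \<phi>) (pair_weight E e h \<phi>))"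

text \<open>The edge after a paired \<open>z\<close> starts at the head of the partner of
  \<open>z\<close>, which is the tail of \<open>z\<close> because the partner is its
  reverse.\<close>

lemma gluing_data_pairing:
  assumes d: "gluing_data Q E s {} e" and p: "\<phi> \<in> pairings E e"
  shows "gluing_data Q E (s \<circ> \<phi>) {z. \<phi> z \<noteq> z} e"
proof -
  have "bij_betw (s \<circ> \<phi>) E E"
    using d permutes_imp_bij[OF pairings_permutes[OF p]] bij_betw_trans
    unfolding gluing_data_def by blast
  moreover have "dtail Q (e (s (\<phi> z))) = (if \<phi> z \<noteq> z then dtail Q (e z) else dhead Q (e z))"
    if "z \<in> E" for z
    using d pairingsD(3,4)[OF p that] that by (auto simp: gluing_data_def)
  ultimately show ?thesis using d by (auto simp: gluing_data_def)
qed

text \<open>Conjugation of a pairing by a bijection \<open>p\<close> with inverse \<open>q\<close>,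
  made the identity outside \<open>F\<close> as \<open>pairings\<close> demands.\<close>

definition transport :: "('z \<Rightarrow> 'y) \<Rightarrow> ('y \<Rightarrow> 'z) \<Rightarrow> 'y set \<Rightarrow> ('z \<Rightarrow> 'z) \<Rightarrow> 'y \<Rightarrow> 'y" where
  "transport p q F \<phi> y = (if y \<in> F then p (\<phi> (q y)) else y)"

lemma transport_pairings:
  assumes q: "\<And>y. y \<in> F \<Longrightarrow> q y \<in> E \<and> p (q y) = y" and p: "\<And>z. z \<in> E \<Longrightarrow> p z \<in> F \<and> q (p z) = z"
    and e: "\<And>z. z \<in> E \<Longrightarrow> e' (p z) = e z" and \<phi>: "\<phi> \<in> pairings E e"
  shows "transport p q F \<phi> \<in> pairings F e'"
proof -
  note D = pairingsD[OF \<phi>]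
  have "e' (p (\<phi> (q y))) = rev_edge (e' y)" if "y \<in> F" "p (\<phi> (q y)) \<noteq> y" for y
  proof -
    have "\<phi> (q y) \<noteq> q y" using that q by metis
    then show ?thesis using that q[of y] e[of "\<phi> (q y)"] e[of "q y"] D(3,4)[of "q y"] by simp
  qed
  moreover have "transport p q F \<phi> (transport p q F \<phi> y) = y" for y
  proof (cases "y \<in> F")
    case True
    then have "q y \<in> E" "p (q y) = y" using q by auto
    then show ?thesis using True D(2,4)[of "q y"] p[of "\<phi> (q y)"] by (simp add: transport_def)
  qed (simp add: transport_def)
  ultimately show ?thesis
    unfolding pairings_def by (auto simp: transport_def)
qed

lemma transport_transport:
  assumes q: "\<And>y. y \<in> F \<Longrightarrow> q y \<in> E \<and> p (q y) = y" and p: "\<And>z. z \<in> E \<Longrightarrow> p z \<in> F \<and> q (p z) = z"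
    and \<phi>: "\<phi> \<in> pairings E e"
  shows "transport q p E (transport p q F \<phi>) = \<phi>"
  using p q pairingsD[OF \<phi>] by (auto simp: transport_def fun_eq_iff)

text \<open>The Wick sum sees heights only through their order. So they may have gaps or be shifted,
  without renumbering.\<close>

lemma wick_iso:
  assumes d: "gluing_data Q E s {} e" and p: "bij_betw p E F"
    and s: "\<And>z. z \<in> E \<Longrightarrow> s' (p z) = p (s z)" and e: "\<And>z. z \<in> E \<Longrightarrow> e' (p z) = e z"
    and h: "\<And>y z. y \<in> E \<Longrightarrow> z \<in> E \<Longrightarrow> h' (p y) < h' (p z) \<longleftrightarrow> h y < h z"
  shows "wick Q F s' e' h' V = (wick Q E s e h V :: _ \<Rightarrow>\<^sub>0 'k::field_char_0 poly)"
proof -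
  define q where "q = inv_into E p"
  have P: "p z \<in> F \<and> q (p z) = z" if "z \<in> E" for z
    using p that by (auto simp: q_def bij_betw_def)
  have R: "q y \<in> E \<and> p (q y) = y" if "y \<in> F" for y
    using p that by (auto simp: q_def bij_betw_def inv_into_into f_inv_into_f)
  have inj: "inj_on p E" using p by (simp add: bij_betw_def)
  have e': "e (q y) = e' y" if "y \<in> F" for y using R[OF that] e by metis
  have gl: "glued Q F s' e' V (transport p q F \<phi>) = glued Q E s e V \<phi>"
    and wt: "pair_weight F e' h' (transport p q F \<phi>) = (pair_weight E e h \<phi> :: 'k poly)"
    if \<phi>: "\<phi> \<in> pairings E e" for \<phi>
  proof -
    note D = pairingsD[OF \<phi>]
    have t: "transport p q F \<phi> (p z) = p (\<phi> z)" if "z \<in> E" for z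
      using P[OF that] by (simp add: transport_def)
    have "orbit_coll F (s' \<circ> transport p q F \<phi>) {y. transport p q F \<phi> y \<noteq> y} (dtail Q \<circ> e') e' =
        orbit_coll E (s \<circ> \<phi>) {z. \<phi> z \<noteq> z} (dtail Q \<circ> e) e"
    proof (rule orbit_coll_iso[OF gluing_data_tail[OF gluing_data_pairing[OF d \<phi>]] p])
      fix z assume z: "z \<in> E"
      then show "(s' \<circ> transport p q F \<phi>) (p z) = p ((s \<circ> \<phi>) z)"
        using t s D(4) by simp
      show "p z \<in> {y. transport p q F \<phi> y \<noteq> y} \<longleftrightarrow> z \<in> {z. \<phi> z \<noteq> z}"
        using t[OF z] inj_on_eq_iff[OF inj D(4)[OF z] z] by simp
      show "(dtail Q \<circ> e') (p z) = (dtail Q \<circ> e) z" using e z by simp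
    next
      fix z assume "z \<in> E - {z. \<phi> z \<noteq> z}"
      then show "e' (p z) = e z" using e by simp
    qed
    then show "glued Q F s' e' V (transport p q F \<phi>) = glued Q E s e V \<phi>"
      by (simp add: glued_def)
    have "{y. y \<in> F \<and> h' y < h' (transport p q F \<phi> y)} = p ` {z. z \<in> E \<and> h z < h (\<phi> z)}"
    proof (intro equalityI subsetI)
      fix y assume y: "y \<in> {y. y \<in> F \<and> h' y < h' (transport p q F \<phi> y)}"
      then have qy: "q y \<in> E" "p (q y) = y" using R by auto
      then have "h (q y) < h (\<phi> (q y))"
        using y t[OF qy(1)] h[OF qy(1) D(4)[OF qy(1)]] by simp
      then show "y \<in> p ` {z. z \<in> E \<and> h z < h (\<phi> z)}" using qy by force
    next
      fix y assume "y \<in> p ` {z. z \<in> E \<and> h z < h (\<phi> z)}"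
      then obtain z where z: "z \<in> E" "h z < h (\<phi> z)" "y = p z" by blast
      then show "y \<in> {y. y \<in> F \<and> h' y < h' (transport p q F \<phi> y)}"
        using t[OF z(1)] h[OF z(1) D(4)[OF z(1)]] P by simp
    qed
    moreover have "inj_on p {z. z \<in> E \<and> h z < h (\<phi> z)}" using inj by (rule inj_on_subset) auto
    ultimately show "pair_weight F e' h' (transport p q F \<phi>) = (pair_weight E e h \<phi> :: 'k poly)"
      unfolding pair_weight_def by (simp add: prod.reindex e)
  qed
  have "(wick Q E s e h V :: _ \<Rightarrow>\<^sub>0 'k poly) = wick Q F s' e' h' V"
    unfolding wick_def
  proof (rule sum.reindex_bij_witness[where i = "transport q p E" and j = "transport p q F"])
    fix \<phi> assume \<phi>: "\<phi> \<in> pairings E e"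
    show "transport q p E (transport p q F \<phi>) = \<phi>" using transport_transport[OF R P \<phi>] .
    show "transport p q F \<phi> \<in> pairings F e'" using transport_pairings[OF R P e \<phi>] .
    show "Poly_Mapping.single (glued Q F s' e' V (transport p q F \<phi>))
        (pair_weight F e' h' (transport p q F \<phi>) :: 'k poly) =
        Poly_Mapping.single (glued Q E s e V \<phi>) (pair_weight E e h \<phi>)"
      using gl wt \<phi> by simp
  next
    fix \<phi> assume \<phi>: "\<phi> \<in> pairings F e'"
    show "transport p q F (transport q p E \<phi>) = \<phi>" using transport_transport[OF P R \<phi>] .
    show "transport q p E \<phi> \<in> pairings E e" using transport_pairings[OF P R e' \<phi>] .
  qed
  then show ?thesis ..
qed

text \<open>The other edge of the pair becomes the lower one, and \<open>half_sign\<close> of the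
  reverse edge is the negative; the remaining factors are unchanged, whether or not the two heights
  are adjacent. This one sign serves both the relations and the averaging.\<close>

lemma pair_weight_swap:
  assumes fin: "finite E" and \<phi>: "\<phi> \<in> pairings E e" and inj: "inj_on h E"
    and x: "x \<in> E" "\<phi> x \<noteq> x"
    and h': "h' x = h (\<phi> x)" "h' (\<phi> x) = h x" "\<And>z. z \<in> E \<Longrightarrow> z \<noteq> x \<Longrightarrow> z \<noteq> \<phi> x \<Longrightarrow> h' z = h z"
  shows "pair_weight E e h' \<phi> = - (pair_weight E e h \<phi> :: 'k::field_char_0 poly)"
proof -
  have main: "pair_weight E e h' \<phi> = - (pair_weight E e h \<phi> :: 'k poly)"
    if x: "x \<in> E" "\<phi> x \<noteq> x" and lt: "h x < h (\<phi> x)"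
      and h': "h' x = h (\<phi> x)" "h' (\<phi> x) = h x" "\<And>z. z \<in> E \<Longrightarrow> z \<noteq> x \<Longrightarrow> z \<noteq> \<phi> x \<Longrightarrow> h' z = h z"
    for x h h'
  proof -
    note D = pairingsD[OF \<phi>]
    define L where "L = {z \<in> E - {x, \<phi> x}. h z < h (\<phi> z)}"
    have other: "\<phi> z \<in> E \<and> \<phi> z \<noteq> x \<and> \<phi> z \<noteq> \<phi> x" if "z \<in> E" "z \<noteq> x" "z \<noteq> \<phi> x" for z
      using that D(2,4) by metis
    have 1: "{z. z \<in> E \<and> h z < h (\<phi> z)} = insert x L"
      using x lt D(2)[of x] by (auto simp: L_def)
    have 2: "{z. z \<in> E \<and> h' z < h' (\<phi> z)} = insert (\<phi> x) L"
    proof (rule Set.set_eqI)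
      fix z
      consider "z = x" | "z = \<phi> x" | "z \<in> E" "z \<noteq> x" "z \<noteq> \<phi> x" | "z \<notin> E" by blast
      then show "z \<in> {z. z \<in> E \<and> h' z < h' (\<phi> z)} \<longleftrightarrow> z \<in> insert (\<phi> x) L"
      proof cases
        case 1
        then show ?thesis using x lt h' by (simp add: L_def)
      next
        case 2
        then show ?thesis using x lt h' D(2)[of x] D(4)[of x] by (simp add: L_def)
      next
        case 3
        then show ?thesis using h'(3)[of z] h'(3)[of "\<phi> z"] other[OF 3] by (simp add: L_def)
      next
        case 4
        then show ?thesis using D(4)[of x] x by (auto simp: L_def)
      qed
    qed
    have L: "finite L" "x \<notin> L" "\<phi> x \<notin> L" using fin by (auto simp: L_def)
    have "(half_sign (e (\<phi> x)) :: 'k) = - half_sign (e x)"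
      using D(3)[OF x] by (simp add: half_sign_rev_edge)
    then show ?thesis unfolding pair_weight_def 1 2
      using L by (simp add: minus_monom[symmetric])
  qed
  show ?thesis
  proof (cases "h x < h (\<phi> x)")
    case True
    then show ?thesis using main[of x h h'] x h' by blast
  next
    case False
    then have lt: "h (\<phi> x) < h x"
      using inj x pairingsD(4)[OF \<phi>, of x] by (metis inj_onD linorder_neqE_nat)
    note D = pairingsD[OF \<phi>]
    \<comment> \<open>If \<open>x\<close> is the upper edge, the same argument runs with
      \<open>\<phi> x\<close> as the lower one.\<close>
    have "pair_weight E e h' \<phi> = - (pair_weight E e h \<phi> :: 'k poly)"
    proof (rule main[of "\<phi> x"])
      show "\<phi> x \<in> E" using D(4) x by blast
    qed (use x D(2)[of x] lt h' in auto)
    then show ?thesis .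
  qed
qed


lemma lookup_scale: "Poly_Mapping.lookup (scale c f) k = c * Poly_Mapping.lookup f k"
  by (simp add: scale_def Poly_Mapping.map.rep_eq when_def)

lemma scale_sum: "scale c (sum f S) = (\<Sum>x\<in>S. scale c (f x))"
  by (rule poly_mapping_eqI) (simp add: lookup_scale lookup_sum sum_distrib_left)

lemma scale_single: "scale c (Poly_Mapping.single a d) = Poly_Mapping.single a (c * d)"
  by (rule poly_mapping_eqI) (simp add: lookup_scale lookup_single when_def)

section \<open>Cutting out one pair of edges\<close>

lemma orbit_coll_remove_two:
  assumes d: "gluing_data Q E f J e" and x: "x \<in> E" "x \<in> J" and y: "y \<in> E" "y \<in> J" "x \<noteq> y"
  shows "orbit_coll E f J (dtail Q \<circ> e) lab =
    orbit_coll (E - {x, y}) (remove_point (remove_point f x) y) J (dtail Q \<circ> e) lab +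
    (if remove_point f x y = y then {#Trivial (dtail Q (e y))#} else {#}) +
    (if f x = x then {#Trivial (dtail Q (e x))#} else {#})"
proof -
  note d' = gluing_data_remove_point[OF d x]
  have "E - {x} - {y} = E - {x, y}" by auto
  moreover have y': "y \<in> E - {x}" using y by simp
  ultimately show ?thesis
    unfolding orbit_coll_remove_point[OF gluing_data_tail[OF d] x, of lab]
      orbit_coll_remove_point[OF gluing_data_tail[OF d'] y' y(2), of lab] by simp
qed

text \<open>Gluing \<open>x\<close> to \<open>y\<close> composes the successor with their
  transposition; taking first return maps then deletes both.\<close>

definition cut_next :: "('z \<Rightarrow> 'z) \<Rightarrow> 'z \<Rightarrow> 'z \<Rightarrow> 'z \<Rightarrow> 'z" where
  "cut_next s x y = remove_point (remove_point (s \<circ> transpose x y) x) y"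

text \<open>The trivial paths born from the cut: \<open>s y = x\<close> makes \<open>x\<close> a
  fixed point of \<open>s \<circ> transpose x y\<close>, and the first condition says that
  \<open>y\<close> is fixed once \<open>x\<close> is deleted.\<close>

definition cut_vertices ::
  "('v, 'e) pre_digraph \<Rightarrow> ('z \<Rightarrow> 'z) \<Rightarrow> ('z \<Rightarrow> 'e dedge) \<Rightarrow> 'z \<Rightarrow> 'z \<Rightarrow> 'v multiset" where
  "cut_vertices Q s e x y =
     (if remove_point (s \<circ> transpose x y) x y = y then {#dtail Q (e y)#} else {#}) +
     (if s y = x then {#dtail Q (e x)#} else {#})"

lemma transpose_pairing:
  assumes "x \<in> E" "y \<in> E" "x \<noteq> y" "e y = rev_edge (e x)"
  shows "transpose x y \<in> pairings E e" "{z. transpose x y z \<noteq> z} = {x, y}"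
  using assms by (auto simp: pairings_def transpose_def)

lemma gluing_data_cut:
  assumes d: "gluing_data Q E s {} e" and "x \<in> E" "y \<in> E" "x \<noteq> y" "e y = rev_edge (e x)"
  shows "gluing_data Q (E - {x, y}) (cut_next s x y) {} e"
proof -
  have "gluing_data Q E (s \<circ> transpose x y) {x, y} e"
    using gluing_data_pairing[OF d transpose_pairing(1)[of x E y e]] transpose_pairing(2)[of x E y e] assms
    by simp
  from gluing_data_remove_point[OF gluing_data_remove_point[OF this \<open>x \<in> E\<close>], of y]
  have "gluing_data Q (E - {x} - {y}) (cut_next s x y) {x, y} e"
    using assms by (auto simp: cut_next_def)
  moreover have "E - {x} - {y} = E - {x, y}" by auto
  ultimately show ?thesis by (metis Diff_disjoint Int_commute gluing_data_disjoint)
qed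

text \<open>Gluing in stages. The involution \<open>\<phi>\<close> preserves the complement of
  \<open>{x, y}\<close>, so deleting these two points from \<open>s \<circ> \<phi>\<close> is the
  same as deleting them from \<open>s \<circ> transpose x y\<close> and composing with the rest of
  \<open>\<phi>\<close>.\<close>

lemma glued_cut:
  assumes d: "gluing_data Q E s {} e" and xy: "x \<in> E" "y \<in> E" "x \<noteq> y"
    and \<phi>: "\<phi> \<in> pairings E e" "\<phi> x = y"
  shows "glued Q E s e V \<phi> =
    glued Q (E - {x, y}) (cut_next s x y) e (V + cut_vertices Q s e x y) (\<phi>(x := x, y := y))"
proof -
  note D = pairingsD[OF \<phi>(1)]
  let ?J = "{z. \<phi> z \<noteq> z}"
  have py: "\<phi> y = x" using D(2) \<phi>(2) by metis
  have ey: "e y = rev_edge (e x)" using D(3)[OF xy(1)] \<phi>(2) xy(3) by simp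
  note dp = gluing_data_pairing[OF d \<phi>(1)]
  have xJ: "x \<in> ?J" "y \<in> ?J" using \<phi>(2) py xy by auto
  let ?g = "remove_point (remove_point (s \<circ> \<phi>) x) y"
  have other: "\<phi> z \<noteq> x \<and> \<phi> z \<noteq> y" if "z \<noteq> x" "z \<noteq> y" for z
    using D(2)[of z] \<phi>(2) py that by metis
  have r1: "remove_point (s \<circ> \<phi>) x y = remove_point (s \<circ> transpose x y) x y"
    by (simp add: remove_point_def py \<phi>(2))
  have g: "cut_next s x y ((\<phi>(x := x, y := y)) z) = ?g z" if "z \<in> E - {x, y}" for z
    using that other[of z] \<phi>(2) py by (simp add: cut_next_def remove_point_def transpose_def)
  have E2: "E - {x} - {y} = E - {x, y}" by auto
  note d1 = gluing_data_remove_point[OF dp xy(1) xJ(1)]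
  have y1: "y \<in> E - {x}" using xy by auto
  note d2 = gluing_data_remove_point[OF d1 y1 xJ(2), unfolded E2]
  have "orbit_coll (E - {x, y}) (cut_next s x y \<circ> \<phi>(x := x, y := y))
      {z. (\<phi>(x := x, y := y)) z \<noteq> z} (dtail Q \<circ> e) e =
      orbit_coll (E - {x, y}) ?g ?J (dtail Q \<circ> e) e"
    by (rule orbit_coll_cong[OF gluing_data_tail[OF d2]]) (use g in auto)
  then show ?thesis
    unfolding glued_def orbit_coll_remove_two[OF dp xy(1) xJ(1) xy(2) xJ(2) xy(3)] r1
    by (simp add: cut_vertices_def \<phi>(2))
qed

text \<open>The pair contributes one factor, at its lower edge \<open>x\<close>; the other pairs
  live on the remaining edges, whose new heights need only keep the old order.\<close>

lemma pair_weight_cut: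
  assumes fin: "finite E" and xy: "x \<in> E" "y \<in> E" "x \<noteq> y" "h x < h y"
    and \<phi>: "\<phi> \<in> pairings E e" "\<phi> x = y"
    and h'': "\<And>a b. a \<in> E - {x, y} \<Longrightarrow> b \<in> E - {x, y} \<Longrightarrow> h'' a < h'' b \<longleftrightarrow> h a < h b"
  shows "pair_weight E e h \<phi> =
    Polynomial.monom (half_sign (e x)) 1 * pair_weight (E - {x, y}) e h'' (\<phi>(x := x, y := y))"
proof -
  note D = pairingsD[OF \<phi>(1)]
  have py: "\<phi> y = x" using D(2) \<phi>(2) by metis
  have other: "\<phi> z \<in> E - {x, y}" if "z \<in> E - {x, y}" for z
    using D(2,4)[of z] \<phi>(2) py that by (metis DiffE DiffI insert_iff empty_iff)
  have "{z. z \<in> E \<and> h z < h (\<phi> z)} =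
      insert x {z. z \<in> E - {x, y} \<and> h'' z < h'' ((\<phi>(x := x, y := y)) z)}"
  proof (rule Set.set_eqI)
    fix z
    show "z \<in> {z. z \<in> E \<and> h z < h (\<phi> z)} \<longleftrightarrow>
      z \<in> insert x {z. z \<in> E - {x, y} \<and> h'' z < h'' ((\<phi>(x := x, y := y)) z)}"
      using xy \<phi>(2) py other[of z] h''[of z "\<phi> z"] by (cases "z = x \<or> z = y") auto
  qed
  then show ?thesis unfolding pair_weight_def using fin by simp
qed

text \<open>Pairings that do not match \<open>x\<close> with \<open>y\<close> weigh the same before
  and after, because no height lies strictly between the two; the others change sign, so their
  weights double in the difference.\<close>

lemma wick_relation:
  fixes h :: "'z \<Rightarrow> nat"
  assumes d: "gluing_data Q E s {} e" and inj: "inj_on h E"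
    and xy: "x \<in> E" "y \<in> E" "h y = h x + 1"
    and h': "h' x = h y" "h' y = h x" "\<And>z. z \<in> E \<Longrightarrow> z \<noteq> x \<Longrightarrow> z \<noteq> y \<Longrightarrow> h' z = h z"
    and h'': "\<And>a b. a \<in> E - {x, y} \<Longrightarrow> b \<in> E - {x, y} \<Longrightarrow> h'' a < h'' b \<longleftrightarrow> h a < h b"
  shows "wick Q E s e h V - wick Q E s e h' V =
    (if e y = rev_edge (e x)
     then scale (Polynomial.monom (bracket (e x) (e y)) 1)
       (wick Q (E - {x, y}) (cut_next s x y) e h'' (V + cut_vertices Q s e x y))
     else (0 :: _ \<Rightarrow>\<^sub>0 'k::field_char_0 poly))"
proof -
  have ne: "x \<noteq> y" using xy by auto
  have fin: "finite E" using d by (simp add: gluing_data_def)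
  let ?P = "pairings E e"
  let ?B = "{\<phi> \<in> ?P. \<phi> x = y}"
  let ?g = "\<lambda>\<phi>. glued Q E s e V \<phi>"
  let ?w = "\<lambda>h \<phi>. pair_weight E e h \<phi> :: 'k poly"
  have same: "?w h' \<phi> = ?w h \<phi>" if \<phi>: "\<phi> \<in> ?P" "\<phi> x \<noteq> y" for \<phi>
  proof -
    note D = pairingsD[OF \<phi>(1)]
    have py: "\<phi> y \<noteq> x" using D(2) \<phi>(2) by metis
    have "h' z < h' (\<phi> z) \<longleftrightarrow> h z < h (\<phi> z)" if z: "z \<in> E" for z
    proof -
      have hv: "h' u = (if u = x then h x + 1 else if u = y then h x else h u)" if "u \<in> E" for u
        using h' xy that by simp
      have out: "h u \<noteq> h x \<and> h u \<noteq> h x + 1" if "u \<in> E" "u \<noteq> x" "u \<noteq> y" for u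
        using that inj xy by (metis inj_onD)
      have pz: "\<phi> z \<in> E" using D(4) z .
      show ?thesis
        unfolding hv[OF z] hv[OF pz] using out[OF z] out[OF pz] xy(3) \<phi>(2) py ne D(2)[of z] 
        by (cases "z = x"; cases "z = y"; cases "\<phi> z = x"; cases "\<phi> z = y") auto
    qed
    then show ?thesis unfolding pair_weight_def by (intro prod.cong) auto
  qed
  have opp: "?w h' \<phi> = - ?w h \<phi>" if \<phi>: "\<phi> \<in> ?B" for \<phi>
    by (rule pair_weight_swap[of _ _ _ _ x]) (use fin \<phi> inj xy h' ne in auto)
  have "wick Q E s e h V - wick Q E s e h' V =
      (\<Sum>\<phi>\<in>?P. Poly_Mapping.single (?g \<phi>) (?w h \<phi> - ?w h' \<phi>))"
    by (simp add: wick_def sum_subtractf single_diff)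
  also have "\<dots> = (\<Sum>\<phi>\<in>?B. Poly_Mapping.single (?g \<phi>) (?w h \<phi> - ?w h' \<phi>))"
    by (rule sum.mono_neutral_right) (use finite_pairings[OF fin] same in auto)
  also have "\<dots> = (\<Sum>\<phi>\<in>?B. Poly_Mapping.single (?g \<phi>) (2 * ?w h \<phi>))"
    by (rule sum.cong) (auto simp: opp)
  finally have eq: "wick Q E s e h V - wick Q E s e h' V =
      (\<Sum>\<phi>\<in>?B. Poly_Mapping.single (?g \<phi>) (2 * ?w h \<phi>))" .
  show ?thesis
  proof (cases "e y = rev_edge (e x)")
    case False
    then have B: "?B = {}" using xy ne by (auto dest: pairingsD(3))
    show ?thesis unfolding eq B using False by simp
  next
    case True
    let ?E = "E - {x, y}"
    \<comment> \<open>Pairings with \<open>\<phi> x = y\<close> correspond to pairings of the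
      remaining edges, by resetting \<open>x\<close> and \<open>y\<close> to fixed points.\<close>
    have "(\<Sum>\<phi>\<in>?B. Poly_Mapping.single (?g \<phi>) (2 * ?w h \<phi>)) =
      (\<Sum>\<psi>\<in>pairings ?E e. scale (Polynomial.monom (bracket (e x) (e y)) 1) (Poly_Mapping.single
        (glued Q ?E (cut_next s x y) e (V + cut_vertices Q s e x y) \<psi>) (pair_weight ?E e h'' \<psi>)))"
    proof (rule sum.reindex_bij_witness[where i = "\<lambda>\<psi>. \<psi>(x := y, y := x)" and j = "\<lambda>\<phi>. \<phi>(x := x, y := y)"])
      fix \<phi> assume \<phi>: "\<phi> \<in> ?B"
      then have \<phi>': "\<phi> \<in> ?P" "\<phi> x = y" by auto
      note D = pairingsD[OF \<phi>'(1)]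
      have py: "\<phi> y = x" using D(2) \<phi>'(2) by metis
      show "(\<phi>(x := x, y := y))(x := y, y := x) = \<phi>" using \<phi>'(2) py by auto
      have other: "\<phi> z \<noteq> x \<and> \<phi> z \<noteq> y" if "z \<noteq> x" "z \<noteq> y" for z
        using D(2)[of z] \<phi>'(2) py that by metis
      show "\<phi>(x := x, y := y) \<in> pairings ?E e"
      proof -
        have "(\<phi>(x := x, y := y)) z = z" if "z \<notin> ?E" for z
          using that D(1)[of z] by (cases "z = x \<or> z = y") auto
        moreover have "(\<phi>(x := x, y := y)) ((\<phi>(x := x, y := y)) z) = z" for z
          using D(2)[of z] other[of z] by (cases "z = x \<or> z = y") auto
        moreover have "e ((\<phi>(x := x, y := y)) z) = rev_edge (e z)"
          if "z \<in> ?E" "(\<phi>(x := x, y := y)) z \<noteq> z" for z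
          using that D(3)[of z] by simp
        ultimately show ?thesis unfolding pairings_def by blast
      qed
      have w: "2 * ?w h \<phi> = Polynomial.monom (bracket (e x) (e y)) 1 * pair_weight ?E e h'' (\<phi>(x := x, y := y))"
      proof -
        have "?w h \<phi> = Polynomial.monom (half_sign (e x)) 1 * pair_weight ?E e h'' (\<phi>(x := x, y := y))"
          by (rule pair_weight_cut[OF fin xy(1,2) ne _ \<phi>']) (use xy(3) h'' in auto)
        \<comment> \<open>Here the factor 2 from the sign change meets the 1/2 in
          \<open>half_sign\<close> and gives the bracket of the relation.\<close>
        moreover have "2 * Polynomial.monom (half_sign (e x)) 1 =
            (Polynomial.monom (bracket (e x) (e y)) 1 :: 'k poly)"
          unfolding mult_2 add_monom using True by (simp add: bracket_eq_half_sign)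
        ultimately show ?thesis by (metis mult.assoc)
      qed
      show "scale (Polynomial.monom (bracket (e x) (e y)) 1) (Poly_Mapping.single
          (glued Q ?E (cut_next s x y) e (V + cut_vertices Q s e x y) (\<phi>(x := x, y := y)))
          (pair_weight ?E e h'' (\<phi>(x := x, y := y)))) = Poly_Mapping.single (?g \<phi>) (2 * ?w h \<phi>)"
        unfolding glued_cut[OF d xy(1,2) ne \<phi>'] w scale_single ..
    next
      fix \<psi> assume \<psi>: "\<psi> \<in> pairings ?E e"
      note D = pairingsD[OF \<psi>]
      have f: "\<psi> x = x" "\<psi> y = y" using D(1)[of x] D(1)[of y] by simp_all
      have other: "\<psi> z \<noteq> x \<and> \<psi> z \<noteq> y" if "z \<noteq> x" "z \<noteq> y" for z
        using D(2)[of z] f that by metis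
      show "(\<psi>(x := y, y := x))(x := x, y := y) = \<psi>" using f by auto
      show "\<psi>(x := y, y := x) \<in> ?B"
      proof -
        have "(\<psi>(x := y, y := x)) z = z" if "z \<notin> E" for z
          using that D(1)[of z] xy by auto
        moreover have "(\<psi>(x := y, y := x)) ((\<psi>(x := y, y := x)) z) = z" for z
          using D(2)[of z] other[of z] ne by (cases "z = x \<or> z = y") auto
        moreover have "e ((\<psi>(x := y, y := x)) z) = rev_edge (e z)"
          if "z \<in> E" "(\<psi>(x := y, y := x)) z \<noteq> z" for z
          using that D(3)[of z] True by auto
        ultimately show ?thesis unfolding pairings_def using ne by auto
      qed
    qed
    also have "\<dots> = scale (Polynomial.monom (bracket (e x) (e y)) 1)
        (wick Q ?E (cut_next s x y) e h'' (V + cut_vertices Q s e x y))"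
      unfolding wick_def scale_sum ..
    finally show ?thesis unfolding eq using True by simp
  qed
qed

section \<open>Stacking of height collections\<close>

lift_definition map_necklace :: "('a \<Rightarrow> 'b) \<Rightarrow> 'a necklace \<Rightarrow> 'b necklace" is map
  by (metis rotate_map)

lift_definition necklace_length :: "'a necklace \<Rightarrow> nat" is length
  by auto

fun map_letters :: "('a \<Rightarrow> 'b) \<Rightarrow> ('v, 'a) member \<Rightarrow> ('v, 'b) member" where
  "map_letters g (Trivial v) = Trivial v"
| "map_letters g (Cyclic n) = Cyclic (map_necklace g n)"

fun member_length :: "('v, 'a) member \<Rightarrow> nat" where
  "member_length (Trivial v) = 0"
| "member_length (Cyclic n) = necklace_length n"

abbreviation coll_length :: "('v, 'a) collection \<Rightarrow> nat" where
  "coll_length C \<equiv> sum_mset (image_mset member_length C)"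

definition raise :: "nat \<Rightarrow> ('v, 'a \<times> nat) member \<Rightarrow> ('v, 'a \<times> nat) member" where
  "raise N = map_letters (\<lambda>(a, h). (a, h + N))"

lemma map_letters_compose: "map_letters f (map_letters g m) = map_letters (f \<circ> g) m"
proof -
  have "map_necklace f (map_necklace g n) = map_necklace (f \<circ> g) n" for n
    by transfer (auto intro: exI[of _ 0])
  then show ?thesis by (cases m) auto
qed

lemma map_letters_id: "map_letters id (m :: ('v, 'a) member) = m"
proof -
  have "map_necklace id n = n" for n :: "'a necklace"
    by transfer (auto intro: exI[of _ 0])
  then show ?thesis by (cases m) auto
qed

lemma member_length_map_letters [simp]: "member_length (map_letters g m) = member_length m"
proof -
  have "necklace_length (map_necklace g n) = necklace_length n" for n by transfer simp
  then show ?thesis by (cases m) auto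
qed

lemma member_length_raise [simp]: "member_length (raise N m) = member_length m"
  by (simp add: raise_def)

lemma raise_raise: "raise M (raise N m) = raise (M + N) m"
  unfolding raise_def map_letters_compose
  by (rule arg_cong[where f = "\<lambda>g. map_letters g m"]) (auto simp: fun_eq_iff)

lemma raise_0: "raise 0 m = m"
  using map_letters_id[of m] by (simp add: raise_def id_def)

text \<open>The number of abstract edges is an invariant of the collection, so the shift of heights
  in \<open>stack\<close> does not depend on the presentation chosen.\<close>

lemma coll_length_coll_of: "coll_length (coll_of p) = card (abs_edges (fst p))"
  by (cases p)
     (simp add: coll_of_def card_abs_edges image_mset.compositionality comp_def necklace_length.abs_eq
       sum_mset_sum_list[symmetric] flip: mset_map)

lemma coll_of_some_pres: "coll_of (some_pres C) = C"
proof -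
  have "\<exists>p. coll_of p = C"
  proof (induction C)
    case empty
    have "coll_of ([], []) = {#}" by (simp add: coll_of_def)
    then show ?case ..
  next
    case (add m C)
    then obtain ws vs where p: "coll_of (ws, vs) = C" by force
    show ?case
    proof (cases m)
      case (Trivial v)
      then have "coll_of (ws, v # vs) = add_mset m C" using p by (auto simp: coll_of_def)
      then show ?thesis ..
    next
      case (Cyclic n)
      obtain w where "n = abs_necklace w"
        using Quotient_abs_rep[OF Quotient_necklace] by metis
      then have "coll_of (w # ws, vs) = add_mset m C" using p Cyclic by (auto simp: coll_of_def)
      then show ?thesis ..
    qed
  qed
  then show ?thesis unfolding some_pres_def by (rule someI_ex)
qed

lemma coll_of_raise_heights: "coll_of (raise_heights N p) = image_mset (raise N) (coll_of p)"
  by (cases p)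
     (simp add: coll_of_def raise_heights_def raise_def image_mset.compositionality comp_def
       map_necklace.abs_eq)

lemma coll_of_juxtapose: "coll_of (juxtapose p r) = coll_of p + coll_of r"
  by (cases p; cases r) (simp add: coll_of_def juxtapose_def)

text \<open>Stacking freed from chosen presentations; associativity and units then follow from the
  additivity of length and of \<open>raise\<close>.\<close>

lemma stack_eq: "stack C D = C + image_mset (raise (coll_length C)) D"
  using coll_length_coll_of[of "some_pres C"]
  by (simp add: stack_def Let_def coll_of_juxtapose coll_of_raise_heights coll_of_some_pres)

lemma coll_length_stack: "coll_length (stack C D) = coll_length C + coll_length D"
  by (simp add: stack_eq image_mset.compositionality comp_def)

lemma stack_assoc: "stack (stack C D) B = stack C (stack D B)"
  unfolding stack_eq[of "stack C D"] coll_length_stack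
  by (simp add: stack_eq image_mset.compositionality comp_def raise_raise)

lemma stack_empty [simp]: "stack {#} C = C" "stack C {#} = C"
proof -
  have "image_mset (raise 0) C = image_mset (\<lambda>m. m) C"
    by (rule image_mset_cong) (simp add: raise_0)
  then show "stack {#} C = C" "stack C {#} = C" by (simp_all add: stack_eq)
qed

lemma image_orbit_coll:
  "image_mset (map_letters g) (orbit_coll E f J t lab) = orbit_coll E f J t (g \<circ> lab)"
  unfolding orbit_coll_def image_mset.compositionality
  by (rule image_mset_cong) (simp add: map_necklace.abs_eq)

lemma raise_height_coll:
  "image_mset (raise N) (height_coll E s e h V) = height_coll E s e (\<lambda>z. h z + N) V"
proof -
  have "image_mset (raise N) (image_mset Trivial V) = image_mset Trivial V"
    by (simp add: image_mset.compositionality comp_def raise_def)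
  moreover have "(\<lambda>(a, h). (a, h + N)) \<circ> (\<lambda>z. (e z, h z)) = (\<lambda>z. (e z, h z + N))" by auto
  ultimately show ?thesis
    unfolding height_coll_def raise_def by (simp add: image_orbit_coll)
qed

lemma coll_length_height_coll:
  fixes V :: "'v multiset"
  assumes "finite E" "bij_betw s E E"
  shows "coll_length (height_coll E s e h V) = card E"
proof -
  obtain ws where ws: "cycles s E ws" using cycles_exist[OF assms] ..
  have ne: "w \<noteq> []" if "w \<in> set ws" for w using ws that by (auto simp: cycles_def)
  have 1: "member_length (word_member {} (\<lambda>_. undefined :: 'v) (\<lambda>z. (e z, h z)) w) = length w"
    if "w \<in> set ws" for w
    using ne[OF that] by (simp add: word_member_def necklace_length.abs_eq)
  have "coll_length (orbit_coll E s {} (\<lambda>_. undefined) (\<lambda>z. (e z, h z)) :: ('v, _) collection) =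
      sum_list (map length ws)"
    unfolding orbit_coll_cycles[OF ws, of "{}" "\<lambda>_. undefined", simplified]
    using 1 by (simp add: image_mset.compositionality comp_def sum_mset_sum_list cong: map_cong flip: mset_map)
  also have "\<dots> = card E"
    using ws by (metis cycles_def distinct_card length_concat)
  finally show ?thesis
    by (simp add: height_coll_def image_mset.compositionality comp_def)
qed

lemma bij_betw_map_sum:
  assumes "bij_betw s E E" "bij_betw r F F"
  shows "bij_betw (map_sum s r) (Inl ` E) (Inl ` E)" "bij_betw (map_sum s r) (Inr ` F) (Inr ` F)"
    "bij_betw (map_sum s r) (E <+> F) (E <+> F)"
proof -
  have "map_sum s r ` Inl ` E = Inl ` s ` E" "map_sum s r ` Inr ` F = Inr ` r ` F"
    by (simp_all add: image_image)
  then show 1: "bij_betw (map_sum s r) (Inl ` E) (Inl ` E)"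
    and 2: "bij_betw (map_sum s r) (Inr ` F) (Inr ` F)"
    using assms by (simp_all add: bij_betw_def inj_on_def)
  show "bij_betw (map_sum s r) (E <+> F) (E <+> F)"
    unfolding Plus_def by (rule bij_betw_combine[OF 1 2]) auto
qed

text \<open>The disjoint sum is the natural index set of a stacked collection: heights are shifted,
  but no index is.\<close>

lemma height_coll_sum:
  fixes V W :: "'v multiset"
  assumes E: "finite E" "bij_betw s E E" and F: "finite F" "bij_betw r F F"
  shows "height_coll (E <+> F) (map_sum s r) (case_sum e d) (case_sum h (\<lambda>z. k z + card E)) (V + W) =
    stack (height_coll E s e h V) (height_coll F r d k W)"
proof -
  let ?lab = "\<lambda>z. (case_sum e d z, case_sum h (\<lambda>z. k z + card E) z)"
  have bl: "bij_betw Inl E (Inl ` E)" and br: "bij_betw Inr F (Inr ` F)" by (auto simp: bij_betw_def)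
  note bm = bij_betw_map_sum[OF E(2) F(2)]
  have "orbit_coll (E <+> F) (map_sum s r) {} (\<lambda>_. undefined :: 'v) ?lab =
      orbit_coll (Inl ` E) (map_sum s r) {} (\<lambda>_. undefined :: 'v) ?lab +
      orbit_coll (Inr ` F) (map_sum s r) {} (\<lambda>_. undefined :: 'v) ?lab"
    unfolding Plus_def using E F by (intro orbit_coll_union bm) auto
  moreover have "orbit_coll (Inl ` E) (map_sum s r) {} (\<lambda>_. undefined :: 'v) ?lab =
      orbit_coll E s {} (\<lambda>_. undefined :: 'v) (\<lambda>z. (e z, h z))"
    by (rule orbit_coll_iso[OF E _ bl]) auto
  moreover have "orbit_coll (Inr ` F) (map_sum s r) {} (\<lambda>_. undefined :: 'v) ?lab =
      orbit_coll F r {} (\<lambda>_. undefined :: 'v) (\<lambda>z. (d z, k z + card E))"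
    by (rule orbit_coll_iso[OF F _ br]) auto
  ultimately have eq: "orbit_coll (E <+> F) (map_sum s r) {} (\<lambda>_. undefined :: 'v) ?lab =
      orbit_coll E s {} (\<lambda>_. undefined :: 'v) (\<lambda>z. (e z, h z)) +
      orbit_coll F r {} (\<lambda>_. undefined :: 'v) (\<lambda>z. (d z, k z + card E))" by (simp only:)
  have st: "stack (height_coll E s e h V) (height_coll F r d k W) =
      height_coll E s e h V + height_coll F r d (\<lambda>z. k z + card E) W"
    unfolding stack_eq coll_length_height_coll[OF E] raise_height_coll ..
  show ?thesis unfolding st unfolding height_coll_def eq by simp
qed

text \<open>The successor relation on letters. It survives the passage to necklaces, as rotating a
  word only rotates its list of consecutive pairs.\<close>

definition adjacent_letters :: "('v, 'a) collection \<Rightarrow> ('a \<times> 'a) set" where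
  "adjacent_letters C =
     {(a, b). \<exists>w. Cyclic (abs_necklace w) \<in># C \<and> (a, b) \<in> set (zip w (rotate1 w))}"

definition trivial_part :: "('v, 'a) collection \<Rightarrow> 'v multiset" where
  "trivial_part C = image_mset (\<lambda>m. THE v. m = Trivial v) (filter_mset (\<lambda>m. \<exists>v. m = Trivial v) C)"

lemma zip_rotate: "length xs = length ys \<Longrightarrow> zip (rotate n xs) (rotate n ys) = rotate n (zip xs ys)"
proof (rule nth_equalityI)
  fix i assume l: "length xs = length ys" and i: "i < length (zip (rotate n xs) (rotate n ys))"
  then have "(n + i) mod length ys < length ys" by (intro mod_less_divisor) auto
  then show "zip (rotate n xs) (rotate n ys) ! i = rotate n (zip xs ys) ! i"
    using l i by (simp add: nth_rotate)
qed simp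

lemma adjacent_letters_height_coll:
  fixes e :: "'z \<Rightarrow> 'e dedge" and V :: "'v multiset"
  assumes "finite E" "bij_betw s E E"
  shows "adjacent_letters (height_coll E s e h V) = (\<lambda>z. ((e z, h z), (e (s z), h (s z)))) ` E"
proof -
  let ?l = "\<lambda>z. (e z, h z)"
  let ?C = "height_coll E s e h V"
  obtain ws where ws: "cycles s E ws" using cycles_exist[OF assms] ..
  have C: "Cyclic n \<in># ?C \<longleftrightarrow> (\<exists>u\<in>set ws. n = abs_necklace (map ?l u))" for n
  proof -
    have "Cyclic n \<in># ?C \<longleftrightarrow> (\<exists>u\<in>set ws. Cyclic n = word_member {} (\<lambda>_. undefined :: 'v) ?l u)"
      unfolding height_coll_def
      by (subst orbit_coll_cycles[OF ws]) auto
    also have "\<dots> \<longleftrightarrow> (\<exists>u\<in>set ws. n = abs_necklace (map ?l u))"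
      using ws by (auto simp: word_member_def cycles_def)
    finally show ?thesis .
  qed
  have z: "set (zip (map ?l u) (rotate1 (map ?l u))) = (\<lambda>z. (?l z, ?l (s z))) ` set u" if "u \<in> set ws" for u
  proof -
    have "map s u = rotate1 u" using ws that by (auto simp: cycles_def)
    then have "rotate1 (map ?l u) = map ?l (map s u)" by (simp only: rotate1_map)
    then have "rotate1 (map ?l u) = map (\<lambda>z. ?l (s z)) u" by (simp add: comp_def)
    then show ?thesis by (simp add: zip_map_map zip_same_conv_map image_image)
  qed
  have r: "set (zip w (rotate1 w)) = set (zip v (rotate1 v))" if "abs_necklace w = abs_necklace v"
    for w v :: "('e dedge \<times> nat) list"
  proof -
    obtain n where "v = rotate n w" using \<open>abs_necklace w = abs_necklace v\<close> by (auto simp: necklace.abs_eq_iff)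
    then show ?thesis
      using zip_rotate[of w "rotate1 w" n] by (simp add: rotate1_rotate_swap)
  qed
  have "(a, b) \<in> adjacent_letters ?C \<longleftrightarrow> (\<exists>u\<in>set ws. (a, b) \<in> (\<lambda>z. (?l z, ?l (s z))) ` set u)" for a b
  proof
    assume "(a, b) \<in> adjacent_letters ?C"
    then obtain w u where "u \<in> set ws" "(a, b) \<in> set (zip w (rotate1 w))"
        "abs_necklace w = abs_necklace (map ?l u)"
      unfolding adjacent_letters_def C by auto
    then show "\<exists>u\<in>set ws. (a, b) \<in> (\<lambda>z. (?l z, ?l (s z))) ` set u"
      using r z by blast
  next
    assume "\<exists>u\<in>set ws. (a, b) \<in> (\<lambda>z. (?l z, ?l (s z))) ` set u"
    then obtain u where u: "u \<in> set ws" "(a, b) \<in> set (zip (map ?l u) (rotate1 (map ?l u)))"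
      using z by blast
    then show "(a, b) \<in> adjacent_letters ?C"
      unfolding adjacent_letters_def C by blast
  qed
  then have "x \<in> adjacent_letters ?C \<longleftrightarrow> x \<in> (\<Union>u\<in>set ws. (\<lambda>z. (?l z, ?l (s z))) ` set u)" for x
    by (cases x) (simp only: UN_iff)
  then have "adjacent_letters ?C = (\<Union>u\<in>set ws. (\<lambda>z. (?l z, ?l (s z))) ` set u)"
    by (rule Set.set_eqI)
  moreover have "E = (\<Union>u\<in>set ws. set u)" using ws by (auto simp: cycles_def)
  ultimately show ?thesis by (simp only: image_UN)
qed

lemma trivial_part_height_coll:
  fixes e :: "'z \<Rightarrow> 'a dedge" and V :: "'v multiset"
  assumes "finite E" "bij_betw s E E"
  shows "trivial_part (height_coll E s e h V) = V"
proof -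
  obtain ws where ws: "cycles s E ws" using cycles_exist[OF assms] ..
  have 1: "filter_mset (\<lambda>m. \<exists>v. m = Trivial v)
      (orbit_coll E s {} (\<lambda>_. undefined :: 'v) (\<lambda>z. (e z, h z))) = {#}"
    unfolding orbit_coll_cycles[OF ws, of "{}" "\<lambda>_. undefined :: 'v", simplified]
    using ws by (auto simp: word_member_def cycles_def filter_mset_eq_conv)
  have 2: "filter_mset (\<lambda>m. \<exists>v. m = Trivial v) (image_mset Trivial V) =
      (image_mset Trivial V :: ('v, 'a dedge \<times> nat) collection)"
    by (auto simp: filter_mset_eq_conv)
  show ?thesis
    unfolding trivial_part_def height_coll_def filter_union_mset 1 2
    by (simp add: image_mset.compositionality comp_def)
qed

text \<open>As heights are distinct, the letters of \<open>C\<close> themselves serve as its abstract edges.\<close>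

definition wick_coll ::
  "('v, 'e) pre_digraph \<Rightarrow> ('v, 'e dedge \<times> nat) collection \<Rightarrow>
   ('v, 'e dedge) collection \<Rightarrow>\<^sub>0 'k::field_char_0 poly" where
  "wick_coll Q C = wick Q (fst ` adjacent_letters C) (\<lambda>a. SOME b. (a, b) \<in> adjacent_letters C)
     fst snd (trivial_part C)"

text \<open>Injective heights make the set of letters a faithful copy of \<open>E\<close> with the
  same successor, to which \<open>wick_iso\<close> applies.\<close>

lemma wick_coll_height_coll:
  assumes d: "gluing_data Q E s {} e" and h: "inj_on h E"
  shows "wick_coll Q (height_coll E s e h V) = wick Q E s e h V"
proof -
  let ?l = "\<lambda>z. (e z, h z)"
  have E: "finite E" "bij_betw s E E" using d by (auto simp: gluing_data_def)
  note adj = adjacent_letters_height_coll[OF E, of e h V]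
  have inj: "inj_on ?l E" using h by (auto simp: inj_on_def)
  have "fst ` adjacent_letters (height_coll E s e h V) = ?l ` E"
    unfolding adj by (auto simp: image_image)
  moreover have "(SOME b. (?l z, b) \<in> adjacent_letters (height_coll E s e h V)) = ?l (s z)" if z: "z \<in> E" for z
  proof (rule some_equality)
    show "(?l z, ?l (s z)) \<in> adjacent_letters (height_coll E s e h V)" unfolding adj using z by auto
    fix b assume "(?l z, b) \<in> adjacent_letters (height_coll E s e h V)"
    then obtain y where y: "y \<in> E" "?l z = ?l y" "b = ?l (s y)" unfolding adj by auto
    then show "b = ?l (s z)" using inj_onD[OF inj y(2) z y(1)] by simp
  qed
  moreover have "bij_betw ?l E (?l ` E)" using inj by (simp add: bij_betw_def)
  ultimately show ?thesis
    unfolding wick_coll_def trivial_part_height_coll[OF E]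
    by (intro wick_iso[OF d, where p = ?l]) auto
qed

section \<open>Exchange relations on arbitrary index sets\<close>

text \<open>The same rank as in \<open>restrict_heights\<close>, for an arbitrary index
  type.\<close>

definition height_rank :: "('z \<Rightarrow> nat) \<Rightarrow> 'z set \<Rightarrow> 'z \<Rightarrow> nat" where
  "height_rank h Z z = card {w \<in> Z. h w \<le> h z}"

lemma height_rank_less_iff:
  assumes "finite Z" "a \<in> Z" "b \<in> Z"
  shows "height_rank h Z a < height_rank h Z b \<longleftrightarrow> h a < h b"
proof (cases "h a < h b")
  case True
  then have "b \<notin> {w \<in> Z. h w \<le> h a}" "b \<in> {w \<in> Z. h w \<le> h b}"
    and "{w \<in> Z. h w \<le> h a} \<subseteq> {w \<in> Z. h w \<le> h b}"
    using assms by auto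
  then have "{w \<in> Z. h w \<le> h a} \<subset> {w \<in> Z. h w \<le> h b}" by blast
  then show ?thesis using assms(1) True by (auto simp: height_rank_def intro: psubset_card_mono)
next
  case False
  then have "height_rank h Z b \<le> height_rank h Z a"
    unfolding height_rank_def using assms(1) by (intro card_mono) auto
  then show ?thesis using False by simp
qed

lemma bij_betw_height_rank:
  assumes "finite Z" "inj_on h Z"
  shows "bij_betw (height_rank h Z) Z {1..card Z}"
proof -
  have inj: "inj_on (height_rank h Z) Z"
  proof (rule inj_onI)
    fix a b assume "a \<in> Z" "b \<in> Z" "height_rank h Z a = height_rank h Z b"
    then have "h a = h b"
      using height_rank_less_iff[OF assms(1), of a b h] height_rank_less_iff[OF assms(1), of b a h] by simp
    then show "a = b" using assms(2) \<open>a \<in> Z\<close> \<open>b \<in> Z\<close> by (meson inj_onD)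
  qed
  moreover have "height_rank h Z ` Z \<subseteq> {1..card Z}"
  proof
    fix n assume "n \<in> height_rank h Z ` Z"
    then obtain a where a: "a \<in> Z" "n = card {w \<in> Z. h w \<le> h a}" by (auto simp: height_rank_def)
    have "card {w \<in> Z. h w \<le> h a} \<le> card Z" using assms(1) by (intro card_mono) auto
    moreover have "0 < card {w \<in> Z. h w \<le> h a}" using a assms(1) by (auto simp: card_gt_0_iff)
    ultimately show "n \<in> {1..card Z}" using a by auto
  qed
  ultimately show ?thesis
    unfolding bij_betw_def using card_image[OF inj] by (simp add: card_subset_eq)
qed

text \<open>Heights \<open>1..n\<close> are their own ranks; hence a cut in one factor of a stack
  does not renumber the other factor internally.\<close>

lemma card_le_height:
  assumes "bij_betw h Z {1..n}" "b \<in> Z"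
  shows "card {w \<in> Z. h w \<le> h b} = h b"
proof -
  have "h ` {w \<in> Z. h w \<le> h b} = {1..h b}"
  proof (intro equalityI subsetI)
    fix m assume "m \<in> h ` {w \<in> Z. h w \<le> h b}"
    then show "m \<in> {1..h b}" using assms by (auto dest: bij_betw_apply)
  next
    fix m assume m: "m \<in> {1..h b}"
    have "h b \<le> n" using assms by (auto dest: bij_betw_apply)
    then have "m \<in> h ` Z" using assms(1) m by (auto simp: bij_betw_def)
    then show "m \<in> h ` {w \<in> Z. h w \<le> h b}" using m by auto
  qed
  moreover have "inj_on h {w \<in> Z. h w \<le> h b}"
    using assms(1) by (auto simp: bij_betw_def intro: inj_on_subset)
  ultimately show ?thesis by (metis card_image card_atLeastAtMost diff_Suc_1)
qed

text \<open>The exchange relation over an arbitrary index set. For edges that are not mutually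
  reverse the cut has no meaning and the bracket vanishes, so the last term is then given as
  zero.\<close>

definition swap_relation ::
  "('v, 'e) pre_digraph \<Rightarrow> 'z set \<Rightarrow> ('z \<Rightarrow> 'z) \<Rightarrow> ('z \<Rightarrow> 'e dedge) \<Rightarrow> ('z \<Rightarrow> nat) \<Rightarrow> 'v multiset \<Rightarrow> 'z \<Rightarrow> 'z \<Rightarrow>
   ('v, 'e dedge \<times> nat) collection \<Rightarrow>\<^sub>0 'k::field_char_0 poly" where
  "swap_relation Q E s e h V x y =
     Poly_Mapping.single (height_coll E s e h V) 1
     - Poly_Mapping.single (height_coll E s e (h(x := h y, y := h x)) V) 1
     - (if e y = rev_edge (e x) then Poly_Mapping.single
          (height_coll (E - {x, y}) (cut_next s x y) e (height_rank h (E - {x, y})) (V + cut_vertices Q s e x y))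
          (Polynomial.monom (bracket (e x) (e y)) 1) else 0)"

text \<open>Once the glued points are deleted, \<open>J\<close> misses the index set and nothing
  remains to be cut.\<close>

lemma orbit_coll_uncut:
  assumes "finite E" "bij_betw f E E" "E \<inter> J = {}"
  shows "orbit_coll E f J t lab = orbit_coll E f {} t' lab"
proof -
  obtain ws where ws: "cycles f E ws" using cycles_exist[OF assms(1,2)] ..
  have "word_member J t lab w = word_member {} t' lab w" if "w \<in> set ws" for w
  proof -
    have w: "w \<noteq> []" "set w \<subseteq> E" using ws that by (auto simp: cycles_def)
    then have "\<not> set w \<subseteq> J" using assms(3) hd_in_set[OF w(1)] by blast
    moreover have "filter (\<lambda>z. z \<notin> J) w = w" using w(2) assms(3) by (auto simp: filter_id_conv)
    ultimately show ?thesis using w by (simp add: word_member_def)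
  qed
  then have "map (word_member J t lab) ws = map (word_member {} t' lab) ws" by simp
  then show ?thesis
    using orbit_coll_cycles[OF ws, of J t lab] orbit_coll_cycles[OF ws, of "{}" t' lab] assms(3)
    by (simp only: Int_empty_right ball_empty)
qed

text \<open>The involution on \<open>{x, y}\<close> extends to the transposition of all edges, so
  \<open>glue\<close> reduces to the deletion of two points from a permutation.\<close>

lemma glue_pair:
  assumes p: "(ws, vs) \<in> presentations Q" and xy: "x \<in> abs_edges ws" "y \<in> abs_edges ws" "x \<noteq> y"
    and e: "edge_at ws y = rev_edge (edge_at ws x)"
  shows "glue Q (ws, vs) {x, y} (\<lambda>z. if z = x then y else x) (\<lambda>z. (edge_at ws z, h z)) =
    height_coll (abs_edges ws - {x, y}) (cut_next (next_edge ws) x y) (edge_at ws) h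
      (mset vs + cut_vertices Q (next_edge ws) (edge_at ws) x y)"
proof -
  let ?E = "abs_edges ws" and ?s = "next_edge ws" and ?e = "edge_at ws" and ?lab = "\<lambda>z. (edge_at ws z, h z)"
  let ?t = "dtail Q \<circ> edge_at ws"
  note d = gluing_data_presentation[OF p]
  note tp = transpose_pairing[OF xy e]
  note dp = gluing_data_pairing[OF d tp(1), unfolded tp(2)]
  note dc = gluing_data_tail[OF gluing_data_cut[OF d xy e]]
  have "glue Q (ws, vs) {x, y} (\<lambda>z. if z = x then y else x) ?lab =
      orbit_coll ?E (glue_step ws {x, y} (\<lambda>z. if z = x then y else x)) {x, y} ?t ?lab + image_mset Trivial (mset vs)"
    by (simp add: glue_def orbit_coll_def glued_member_def[abs_def] comp_def)
  also have "orbit_coll ?E (glue_step ws {x, y} (\<lambda>z. if z = x then y else x)) {x, y} ?t ?lab =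
      orbit_coll ?E (?s \<circ> transpose x y) {x, y} ?t ?lab"
    by (rule orbit_coll_cong[OF gluing_data_tail[OF dp]]) (auto simp: glue_step_def transpose_def)
  also have "\<dots> = orbit_coll (?E - {x, y}) (cut_next ?s x y) {x, y} ?t ?lab +
      image_mset Trivial (cut_vertices Q ?s ?e x y)"
    unfolding orbit_coll_remove_two[OF dp xy(1) _ xy(2) _ xy(3), simplified]
    by (simp add: cut_next_def cut_vertices_def)
  also have "orbit_coll (?E - {x, y}) (cut_next ?s x y) {x, y} ?t ?lab =
      orbit_coll (?E - {x, y}) (cut_next ?s x y) {} (\<lambda>_. undefined) ?lab"
    by (rule orbit_coll_uncut[OF dc(1,2)]) auto
  finally show ?thesis by (simp add: height_coll_def add_ac)
qed

lemma relation_eq_swap_relation: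
  assumes p: "(ws, vs) \<in> presentations Q" and xy: "x \<in> abs_edges ws" "y \<in> abs_edges ws" "H y = H x + 1"
  shows "relation Q (ws, vs) H x y =
    swap_relation Q (abs_edges ws) (next_edge ws) (edge_at ws) H (mset vs) x y"
proof -
  have ne: "x \<noteq> y" using xy by auto
  have r: "restrict_heights H Z = height_rank H Z" for Z
    by (rule ext) (simp add: restrict_heights_def height_rank_def)
  note wh = with_heights_eq_height_coll[OF presentations_nonempty[OF p]]
  show ?thesis
  proof (cases "edge_at ws y = rev_edge (edge_at ws x)")
    case True
    then show ?thesis
      by (simp add: relation_def swap_relation_def Let_def wh swap_heights_def r
          glue_pair[OF p xy(1,2) ne True])
  next
    case False
    then have "(bracket (edge_at ws x) (edge_at ws y) :: 'c) = 0" by (simp add: bracket_eq_half_sign)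
    then show ?thesis using False
      by (simp add: relation_def swap_relation_def Let_def wh swap_heights_def r)
  qed
qed

text \<open>Every ingredient of the relation, including the ranks of the remaining heights, commutes
  with a bijection of index sets.\<close>

lemma swap_relation_iso:
  assumes d: "gluing_data Q E s {} e" and p: "bij_betw p E F"
    and s: "\<And>z. z \<in> E \<Longrightarrow> s' (p z) = p (s z)" and e: "\<And>z. z \<in> E \<Longrightarrow> e' (p z) = e z"
    and h: "\<And>z. z \<in> E \<Longrightarrow> h' (p z) = h z"
    and xy: "x \<in> E" "y \<in> E" "x \<noteq> y"
  shows "swap_relation Q F s' e' h' V (p x) (p y) = swap_relation Q E s e h V x y"
proof -
  have E: "finite E" "bij_betw s E E" using d by (auto simp: gluing_data_def)
  have inj: "inj_on p E" and im: "p ` E = F" using p by (auto simp: bij_betw_def)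
  have sE: "s z \<in> E" if "z \<in> E" for z using E(2) that by (rule bij_betw_apply)
  have eq: "p a = p b \<longleftrightarrow> a = b" if "a \<in> E" "b \<in> E" for a b using inj that by (rule inj_on_eq_iff)
  have 1: "height_coll F s' e' h' V = height_coll E s e h V"
    by (rule height_coll_iso[OF E p]) (use s e h in auto)
  have 2: "height_coll F s' e' (h'(p x := h' (p y), p y := h' (p x))) V =
      height_coll E s e (h(x := h y, y := h x)) V"
    by (rule height_coll_iso[OF E p]) (use s e h eq xy in auto)
  have 3: "height_coll (F - {p x, p y}) (cut_next s' (p x) (p y)) e' (height_rank h' (F - {p x, p y}))
      (V + cut_vertices Q s' e' (p x) (p y)) =
      height_coll (E - {x, y}) (cut_next s x y) e (height_rank h (E - {x, y})) (V + cut_vertices Q s e x y)"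
    if ey: "e y = rev_edge (e x)"
  proof -
    note dc = gluing_data_tail[OF gluing_data_cut[OF d xy ey]]
    have im': "F - {p x, p y} = p ` (E - {x, y})"
      using inj_on_image_set_diff[OF inj, of E "{x, y}"] xy im by simp
    have p': "bij_betw p (E - {x, y}) (F - {p x, p y})"
      unfolding im' bij_betw_def using inj by (auto intro: inj_on_subset)
    have r: "height_rank h' (F - {p x, p y}) (p z) = height_rank h (E - {x, y}) z" if "z \<in> E - {x, y}" for z
    proof -
      have "{w \<in> F - {p x, p y}. h' w \<le> h' (p z)} = p ` {w \<in> E - {x, y}. h w \<le> h z}"
        unfolding im' using h that by auto
      moreover have "inj_on p {w \<in> E - {x, y}. h w \<le> h z}" using inj by (rule inj_on_subset) auto
      ultimately show ?thesis by (simp add: height_rank_def card_image)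
    qed
    have tr: "transpose (p x) (p y) (p z) = p (transpose x y z)" if "z \<in> E" for z
      using that xy eq by (simp add: transpose_def)
    have trE: "transpose x y z \<in> E" if "z \<in> E" for z using that xy by (simp add: transpose_def)
    have c1: "remove_point (s' \<circ> transpose (p x) (p y)) (p x) (p z) = p (remove_point (s \<circ> transpose x y) x z)"
      and c1E: "remove_point (s \<circ> transpose x y) x z \<in> E" if "z \<in> E" for z
      using that xy tr[OF that] trE[OF that] s sE eq tr[OF xy(1)] trE[OF xy(1)]
      by (auto simp: remove_point_def)
    have c2: "cut_next s' (p x) (p y) (p z) = p (cut_next s x y z)" if "z \<in> E" for z
      unfolding cut_next_def remove_point_def[of _ "p y"] remove_point_def[of _ y] c1[OF that] c1[OF xy(2)]
      using eq[OF c1E[OF that] xy(2)] by simp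
    have cv: "cut_vertices Q s' e' (p x) (p y) = cut_vertices Q s e x y"
      unfolding cut_vertices_def c1[OF xy(2)] s[OF xy(2)] e[OF xy(1)] e[OF xy(2)]
      using eq[OF c1E[OF xy(2)] xy(2)] eq[OF sE[OF xy(2)] xy(1)] by simp
    show ?thesis unfolding cv
      by (rule height_coll_iso[OF dc(1,2) p']) (use c2 e r in auto)
  qed
  show ?thesis unfolding swap_relation_def using 1 2 3 e xy by simp
qed

text \<open>A presentation realizing the index set provides the defining relation; this frees later
  arguments from the indices of presentations.\<close>

lemma swap_relation_in_relations:
  assumes d: "gluing_data Q E s {} e" and V: "set_mset V \<subseteq> verts Q" and h: "bij_betw h E {1..card E}"
    and xy: "x \<in> E" "y \<in> E" "h y = h x + 1"
  shows "swap_relation Q E s e h V x y \<in>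
    (relations Q :: (_ \<Rightarrow>\<^sub>0 'k::field_char_0 poly) set)"
proof -
  obtain ws p where ws: "\<forall>w\<in>set ws. cyclic_path Q w" "bij_betw p (abs_edges ws) E"
      "\<forall>z\<in>abs_edges ws. p (next_edge ws z) = s (p z) \<and> edge_at ws z = e (p z)"
    using gluing_data_realize[OF d] by blast
  obtain vs where vs: "mset vs = V" using ex_mset by blast
  have pr: "(ws, vs) \<in> presentations Q" using ws V vs by (auto simp: presentations_def)
  define H where "H = restrict (h \<circ> p) (abs_edges ws)"
  have c: "card (abs_edges ws) = card E" using bij_betw_same_card[OF ws(2)] .
  have "bij_betw (h \<circ> p) (abs_edges ws) {1..card E}" using ws(2) h by (rule bij_betw_trans)
  then have H: "H \<in> height_assignments (abs_edges ws)"
    unfolding height_assignments_def H_def c by (auto cong: bij_betw_cong)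
  obtain x' where x': "x' \<in> abs_edges ws" "p x' = x" using ws(2) xy(1) by (metis bij_betw_iff_bijections)
  obtain y' where y': "y' \<in> abs_edges ws" "p y' = y" using ws(2) xy(2) by (metis bij_betw_iff_bijections)
  have hh: "H y' = H x' + 1" using x' y' xy(3) by (simp add: H_def)
  have "swap_relation Q E s e h V (p x') (p y') =
      (swap_relation Q (abs_edges ws) (next_edge ws) (edge_at ws) H V x' y' :: _ \<Rightarrow>\<^sub>0 'k poly)"
    by (rule swap_relation_iso[OF gluing_data_presentation[OF pr] ws(2)])
       (use ws(3) x' y' hh in \<open>auto simp: H_def\<close>)
  then have "(swap_relation Q E s e h V x y :: _ \<Rightarrow>\<^sub>0 'k poly) = relation Q (ws, vs) H x' y'"
    unfolding relation_eq_swap_relation[OF pr x'(1) y'(1) hh] vs x'(2) y'(2) .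
  then show ?thesis
    unfolding relations_def using pr H x'(1) y'(1) hh
    by (intro CollectI exI[of _ "(ws, vs)"] exI[of _ H] exI[of _ x'] exI[of _ y']) simp
qed

lemma gluing_data_sum:
  assumes "gluing_data Q E s {} e" "gluing_data Q F r {} d"
  shows "gluing_data Q (E <+> F) (map_sum s r) {} (case_sum e d)"
  using assms bij_betw_map_sum(3)[of s E r F] unfolding gluing_data_def by auto

lemma bij_betw_sum_heights:
  assumes "finite E" "finite F" "bij_betw h E {1..card E}" "bij_betw k F {1..card F}"
  shows "bij_betw (case_sum h (\<lambda>z. k z + card E)) (E <+> F) {1..card (E <+> F)}"
proof -
  let ?g = "case_sum h (\<lambda>z. k z + card E)"
  have "bij_betw ?g (Inl ` E) {1..card E}"
    using assms(3) by (auto simp: bij_betw_def inj_on_def image_image)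
  moreover have "bij_betw ?g (Inr ` F) {Suc (card E)..card E + card F}"
  proof -
    have kF: "{1..card F} = k ` F" using assms(4) by (simp add: bij_betw_def)
    have "(\<lambda>z. k z + card E) ` F = (\<lambda>n. n + card E) ` {1..card F}"
      unfolding kF image_image ..
    also have "\<dots> = {Suc (card E)..card E + card F}" by (simp add: add.commute)
    finally show ?thesis using assms(4) by (auto simp: bij_betw_def inj_on_def image_image)
  qed
  ultimately have "bij_betw ?g (E <+> F) ({1..card E} \<union> {Suc (card E)..card E + card F})"
    unfolding Plus_def by (rule bij_betw_combine) auto
  moreover have "{1..card E} \<union> {Suc (card E)..card E + card F} = {1..card (E <+> F)}"
    using assms by (auto simp: card_Plus)
  ultimately show ?thesis by simp
qed

text \<open>All lower heights are at most \<open>N\<close> and all upper ones above it, so deleting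
  lower edges shifts every upper rank by the same amount.\<close>

lemma height_rank_sum:
  assumes fin: "finite E" "finite F" and ZE: "Z \<subseteq> E" and h: "\<And>z. z \<in> E \<Longrightarrow> h z \<le> N"
    and k: "\<And>z. z \<in> F \<Longrightarrow> 0 < k z"
  shows "a \<in> E \<Longrightarrow> height_rank (case_sum h (\<lambda>z. k z + N)) (Z <+> F) (Inl a) = height_rank h Z a"
    and "b \<in> F \<Longrightarrow> height_rank (case_sum h (\<lambda>z. k z + N)) (Z <+> F) (Inr b) = height_rank k F b + card Z"
proof -
  assume a: "a \<in> E"
  have "{w \<in> Z <+> F. case_sum h (\<lambda>z. k z + N) w \<le> h a} = Inl ` {w \<in> Z. h w \<le> h a}"
    using h[OF a] k by fastforce
  then show "height_rank (case_sum h (\<lambda>z. k z + N)) (Z <+> F) (Inl a) = height_rank h Z a"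
    by (simp add: height_rank_def card_image)
next
  assume b: "b \<in> F"
  have "{w \<in> Z <+> F. case_sum h (\<lambda>z. k z + N) w \<le> k b + N} = Z <+> {w \<in> F. k w \<le> k b}"
    using h ZE by fastforce
  then show "height_rank (case_sum h (\<lambda>z. k z + N)) (Z <+> F) (Inr b) = height_rank k F b + card Z"
    using fin ZE by (simp add: height_rank_def card_Plus finite_subset)
qed


section \<open>Linear and bilinear extension\<close>

lemma linear_ext_eq_sum:
  assumes "finite S" "Poly_Mapping.keys f \<subseteq> S"
  shows "linear_ext g f = (\<Sum>a\<in>S. scale (Poly_Mapping.lookup f a) (g a))"
  unfolding linear_ext_def
  by (rule sum.mono_neutral_left)
     (use assms in \<open>auto simp: in_keys_iff lookup_scale intro!: poly_mapping_eqI\<close>)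

lemma scale_add_right: "scale c (f + g) = scale c f + scale c g"
  by (rule poly_mapping_eqI) (simp add: lookup_scale lookup_add distrib_left)

lemma scale_add_left: "scale (c + d) f = scale c f + scale d f"
  by (rule poly_mapping_eqI) (simp add: lookup_scale lookup_add distrib_right)

lemma scale_scale: "scale c (scale d f) = scale (c * d) f"
  by (rule poly_mapping_eqI) (simp add: lookup_scale mult.assoc)

lemma scale_one [simp]: "scale 1 f = f"
  by (rule poly_mapping_eqI) (simp add: lookup_scale)

lemma scale_zero [simp]: "scale 0 f = 0" "scale c 0 = 0"
  by (rule poly_mapping_eqI; simp add: lookup_scale)+

lemma scale_minus_one: "scale (- 1) f = - f"
  by (rule poly_mapping_eqI) (simp add: lookup_scale)

lemma linear_ext_add: "linear_ext g (f + f') = linear_ext g f + linear_ext g f'"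
proof -
  let ?S = "Poly_Mapping.keys f \<union> Poly_Mapping.keys f'"
  have "finite ?S" "Poly_Mapping.keys (f + f') \<subseteq> ?S" by (simp_all add: keys_add)
  then show ?thesis
    by (simp add: linear_ext_eq_sum[of ?S] lookup_add scale_add_left sum.distrib)
qed

lemma linear_ext_scale: "linear_ext g (scale c f) = scale c (linear_ext g f)"
proof -
  have "Poly_Mapping.keys (scale c f) \<subseteq> Poly_Mapping.keys f"
    by (auto simp: in_keys_iff lookup_scale)
  then show ?thesis
    by (simp add: linear_ext_eq_sum[of "Poly_Mapping.keys f"] lookup_scale scale_sum scale_scale)
qed

lemma linear_ext_single: "linear_ext g (Poly_Mapping.single a c) = scale c (g a)"
  by (subst linear_ext_eq_sum[of "{a}"]) auto

lemma linear_ext_zero [simp]: "linear_ext g 0 = 0"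
  by (simp add: linear_ext_def)

lemma linear_ext_diff: "linear_ext g (f - f') = linear_ext g f - linear_ext g f'"
  by (metis add_diff_cancel diff_add_cancel linear_ext_add)

lemma linear_ext_sum: "linear_ext g (sum f S) = (\<Sum>x\<in>S. linear_ext g (f x))"
  by (induction S rule: infinite_finite_induct) (auto simp: linear_ext_add)

lemma linear_ext_fun_add: "linear_ext (\<lambda>a. g a + g' a) f = linear_ext g f + linear_ext g' f"
  by (simp add: linear_ext_def scale_add_right sum.distrib)

lemma linear_ext_fun_scale: "linear_ext (\<lambda>a. scale c (g a)) f = scale c (linear_ext g f)"
  by (simp add: linear_ext_def scale_sum scale_scale mult.commute)

lemma linear_ext_cong: "(\<And>a. a \<in> Poly_Mapping.keys f \<Longrightarrow> g a = g' a) \<Longrightarrow> linear_ext g f = linear_ext g' f"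
  by (simp add: linear_ext_def)

lemma keys_scale: "Poly_Mapping.keys (scale c f) \<subseteq> Poly_Mapping.keys f"
  by (auto simp: in_keys_iff lookup_scale)

lemma keys_linear_ext:
  assumes "\<And>a. a \<in> Poly_Mapping.keys f \<Longrightarrow> Poly_Mapping.keys (g a) \<subseteq> B"
  shows "Poly_Mapping.keys (linear_ext g f) \<subseteq> B"
  unfolding linear_ext_def
  using keys_sum[of "\<lambda>a. scale (Poly_Mapping.lookup f a) (g a)" "Poly_Mapping.keys f"] keys_scale assms
  by fastforce

lemma bilinear_ext_single:
  "bilinear_ext g (Poly_Mapping.single a c) (Poly_Mapping.single b d) = scale (c * d) (g a b)"
  by (simp add: bilinear_ext_def linear_ext_single scale_scale)

lemma bilinear_ext_add:
  "bilinear_ext g (f + f') u = bilinear_ext g f u + bilinear_ext g f' u"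
  "bilinear_ext g u (f + f') = bilinear_ext g u f + bilinear_ext g u f'"
  by (simp_all add: bilinear_ext_def linear_ext_add linear_ext_fun_add)

lemma bilinear_ext_scale:
  "bilinear_ext g (scale c f) u = scale c (bilinear_ext g f u)"
  "bilinear_ext g u (scale c f) = scale c (bilinear_ext g u f)"
  by (simp_all add: bilinear_ext_def linear_ext_scale linear_ext_fun_scale)

lemma bilinear_ext_diff:
  "bilinear_ext g (f - f') u = bilinear_ext g f u - bilinear_ext g f' u"
  "bilinear_ext g u (f - f') = bilinear_ext g u f - bilinear_ext g u f'"
  by (metis add_diff_cancel diff_add_cancel bilinear_ext_add(1))
     (metis add_diff_cancel diff_add_cancel bilinear_ext_add(2))

lemma bilinear_ext_zero [simp]: "bilinear_ext g 0 u = 0" "bilinear_ext g u 0 = 0"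
  by (simp_all add: bilinear_ext_def linear_ext_def)

lemma bilinear_ext_sum:
  "bilinear_ext g (sum f S) u = (\<Sum>x\<in>S. bilinear_ext g (f x) u)"
  "bilinear_ext g u (sum f S) = (\<Sum>x\<in>S. bilinear_ext g u (f x))"
  by (induction S rule: infinite_finite_induct; simp add: bilinear_ext_add)+

section \<open>The stacking product and the exchange relations\<close>

abbreviation stack_prod ::
  "(('v, 'a \<times> nat) collection \<Rightarrow>\<^sub>0 'r) \<Rightarrow> (('v, 'a \<times> nat) collection \<Rightarrow>\<^sub>0 'r) \<Rightarrow>
   (('v, 'a \<times> nat) collection \<Rightarrow>\<^sub>0 'r::comm_ring_1)" where
  "stack_prod \<equiv> bilinear_ext (\<lambda>P R. Poly_Mapping.single (stack P R) 1)"

lemma stack_prod_single: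
  "stack_prod (Poly_Mapping.single P c) (Poly_Mapping.single R d) = Poly_Mapping.single (stack P R) (c * d)"
  by (simp add: bilinear_ext_single scale_single)

text \<open>A factor placed above does not interfere with the exchange or the cut, which stay in the
  lower summand. This is one half of why the relations generate an ideal.\<close>

lemma swap_relation_stack_right:
  assumes d: "gluing_data Q E s {} e" and c: "gluing_data Q F r {} d"
    and h: "bij_betw h E {1..card E}" and k: "bij_betw k F {1..card F}"
    and xy: "x \<in> E" "y \<in> E" "x \<noteq> y"
  shows "stack_prod (swap_relation Q E s e h V x y) (Poly_Mapping.single (height_coll F r d k W) 1) =
    swap_relation Q (E <+> F) (map_sum s r) (case_sum e d) (case_sum h (\<lambda>z. k z + card E)) (V + W) (Inl x) (Inl y)"
proof -
  let ?h = "case_sum h (\<lambda>z. k z + card E)"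
  have E: "finite E" "bij_betw s E E" and F: "finite F" "bij_betw r F F"
    using d c by (auto simp: gluing_data_def)
  have hN: "h z \<le> card E" if "z \<in> E" for z using bij_betw_apply[OF h that] by simp
  have k0: "0 < k z" if "z \<in> F" for z using bij_betw_apply[OF k that] by simp
  have 2: "?h(Inl x := ?h (Inl y), Inl y := ?h (Inl x)) = case_sum (h(x := h y, y := h x)) (\<lambda>z. k z + card E)"
    by (rule ext) (auto split: sum.split)
  have 3: "height_coll ((E <+> F) - {Inl x, Inl y}) (cut_next (map_sum s r) (Inl x) (Inl y)) (case_sum e d)
        (height_rank ?h ((E <+> F) - {Inl x, Inl y})) (V + W + cut_vertices Q (map_sum s r) (case_sum e d) (Inl x) (Inl y)) =
      stack (height_coll (E - {x, y}) (cut_next s x y) e (height_rank h (E - {x, y})) (V + cut_vertices Q s e x y))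
        (height_coll F r d k W)"
    if ey: "e y = rev_edge (e x)"
  proof -
    note dc = gluing_data_tail[OF gluing_data_cut[OF d xy ey]]
    have D: "(E <+> F) - {Inl x, Inl y} = (E - {x, y}) <+> F" by auto
    have cn: "cut_next (map_sum s r) (Inl x) (Inl y) z = map_sum (cut_next s x y) r z" for z
      using xy(3) by (cases z) (auto simp: cut_next_def remove_point_def transpose_def)
    have cv: "cut_vertices Q (map_sum s r) (case_sum e d) (Inl x) (Inl y) = cut_vertices Q s e x y"
      using xy(3) by (auto simp: cut_vertices_def remove_point_def transpose_def)
    \<comment> \<open>The lower factor has lost two edges, so the upper heights are now raised by
      \<open>card (E - {x, y})\<close>, exactly the shift that \<open>stack\<close> applies above
      the cut collection.\<close>
    have rk: "height_rank ?h ((E - {x, y}) <+> F) z =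
        case_sum (height_rank h (E - {x, y})) (\<lambda>z. k z + card (E - {x, y})) z"
      if "z \<in> (E - {x, y}) <+> F" for z
    proof -
      have kb: "height_rank k F b = k b" if "b \<in> F" for b
        unfolding height_rank_def by (rule card_le_height[OF k that])
      show ?thesis
      proof (cases z)
        case (Inl a)
        then show ?thesis
          using height_rank_sum(1)[of E F "E - {x, y}" h "card E" k a] E F hN k0 that by auto
      next
        case (Inr b)
        then show ?thesis
          using height_rank_sum(2)[of E F "E - {x, y}" h "card E" k b] E F hN k0 kb that by auto
      qed
    qed
    have fs: "finite ((E - {x, y}) <+> F)" using E F by simp
    have "height_coll ((E - {x, y}) <+> F) (cut_next (map_sum s r) (Inl x) (Inl y)) (case_sum e d)
        (height_rank ?h ((E - {x, y}) <+> F)) (V + cut_vertices Q s e x y + W) =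
      height_coll ((E - {x, y}) <+> F) (map_sum (cut_next s x y) r) (case_sum e d)
        (case_sum (height_rank h (E - {x, y})) (\<lambda>z. k z + card (E - {x, y}))) (V + cut_vertices Q s e x y + W)"
      by (rule height_coll_cong[OF fs bij_betw_map_sum(3)[OF dc(2) F(2)] cn refl rk])
    then show ?thesis
      unfolding D cv height_coll_sum[OF dc(1,2) F, symmetric] by (simp add: add_ac)
  qed
  show ?thesis
    unfolding swap_relation_def 2
    using 3 by (simp add: bilinear_ext_diff stack_prod_single height_coll_sum[OF E F] del: fun_upd_apply)
qed

text \<open>The other half: the lower factor keeps its heights, and the gap left by the cut closes
  within the upper one.\<close>

lemma swap_relation_stack_left:
  assumes d: "gluing_data Q E s {} e" and c: "gluing_data Q F r {} d"
    and h: "bij_betw h E {1..card E}" and k: "bij_betw k F {1..card F}"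
    and xy: "x \<in> E" "y \<in> E" "x \<noteq> y"
  shows "stack_prod (Poly_Mapping.single (height_coll F r d k W) 1) (swap_relation Q E s e h V x y) =
    swap_relation Q (F <+> E) (map_sum r s) (case_sum d e) (case_sum k (\<lambda>z. h z + card F)) (W + V) (Inr x) (Inr y)"
proof -
  let ?h = "case_sum k (\<lambda>z. h z + card F)"
  have E: "finite E" "bij_betw s E E" and F: "finite F" "bij_betw r F F"
    using d c by (auto simp: gluing_data_def)
  have kN: "k z \<le> card F" if "z \<in> F" for z using bij_betw_apply[OF k that] by simp
  have h0: "0 < h z" if "z \<in> E" for z using bij_betw_apply[OF h that] by simp
  have 2: "?h(Inr x := ?h (Inr y), Inr y := ?h (Inr x)) = case_sum k (\<lambda>z. (h(x := h y, y := h x)) z + card F)"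
    by (rule ext) (auto split: sum.split)
  have 3: "height_coll ((F <+> E) - {Inr x, Inr y}) (cut_next (map_sum r s) (Inr x) (Inr y)) (case_sum d e)
        (height_rank ?h ((F <+> E) - {Inr x, Inr y})) (W + V + cut_vertices Q (map_sum r s) (case_sum d e) (Inr x) (Inr y)) =
      stack (height_coll F r d k W)
        (height_coll (E - {x, y}) (cut_next s x y) e (height_rank h (E - {x, y})) (V + cut_vertices Q s e x y))"
    if ey: "e y = rev_edge (e x)"
  proof -
    note dc = gluing_data_tail[OF gluing_data_cut[OF d xy ey]]
    have D: "(F <+> E) - {Inr x, Inr y} = F <+> (E - {x, y})" by auto
    have cn: "cut_next (map_sum r s) (Inr x) (Inr y) z = map_sum r (cut_next s x y) z" for z
      using xy(3) by (cases z) (auto simp: cut_next_def remove_point_def transpose_def)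
    have cv: "cut_vertices Q (map_sum r s) (case_sum d e) (Inr x) (Inr y) = cut_vertices Q s e x y"
      using xy(3) by (auto simp: cut_vertices_def remove_point_def transpose_def)
    have rk: "height_rank ?h (F <+> (E - {x, y})) z =
        case_sum k (\<lambda>z. height_rank h (E - {x, y}) z + card F) z"
      if "z \<in> F <+> (E - {x, y})" for z
    proof -
      have kb: "height_rank k F b = k b" if "b \<in> F" for b
        unfolding height_rank_def by (rule card_le_height[OF k that])
      have h0': "0 < h z" if "z \<in> E - {x, y}" for z using h0 that by simp
      have fin: "finite (E - {x, y})" using E by simp
      show ?thesis
      proof (cases z)
        case (Inl a)
        then show ?thesis
          using height_rank_sum(1)[of F "E - {x, y}" F k "card F" h a] F fin kN h0' kb that by auto
      next
        case (Inr b)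
        then show ?thesis
          using height_rank_sum(2)[of F "E - {x, y}" F k "card F" h b] F fin kN h0' that by auto
      qed
    qed
    have fs: "finite (F <+> (E - {x, y}))" using E F by simp
    have "height_coll (F <+> (E - {x, y})) (cut_next (map_sum r s) (Inr x) (Inr y)) (case_sum d e)
        (height_rank ?h (F <+> (E - {x, y}))) (W + (V + cut_vertices Q s e x y)) =
      height_coll (F <+> (E - {x, y})) (map_sum r (cut_next s x y)) (case_sum d e)
        (case_sum k (\<lambda>z. height_rank h (E - {x, y}) z + card F)) (W + (V + cut_vertices Q s e x y))"
      by (rule height_coll_cong[OF fs bij_betw_map_sum(3)[OF F(2) dc(2)] cn refl rk])
    then show ?thesis
      unfolding D cv height_coll_sum[OF F dc(1,2), symmetric] by (simp add: add_ac)
  qed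
  show ?thesis
    unfolding swap_relation_def 2
    using 3 by (simp add: bilinear_ext_diff stack_prod_single height_coll_sum[OF F E] del: fun_upd_apply)
qed

section \<open>Averaging over heights and the star product\<close>

lemma height_assignments_nonempty:
  assumes "finite D" shows "\<exists>H. H \<in> height_assignments D"
proof -
  obtain h where h: "bij_betw h D {1..card D}"
    using finite_same_card_bij[OF assms, of "{1..card D}"] by auto
  then have "restrict h D \<in> height_assignments D"
    by (auto simp: height_assignments_def cong: bij_betw_cong)
  then show ?thesis by blast
qed

text \<open>Permutations of the heights act simply transitively on the assignments. This yields
  their number and, later, their connection by transpositions.\<close>

lemma bij_betw_height_assignments:
  assumes H: "H \<in> height_assignments D"
  shows "bij_betw (\<lambda>p. restrict (p \<circ> H) D) {p. p permutes {1..card D}} (height_assignments D)"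
proof (rule bij_betw_imageI)
  have b: "bij_betw H D {1..card D}" using H by (simp add: height_assignments_def)
  show "inj_on (\<lambda>p. restrict (p \<circ> H) D) {p. p permutes {1..card D}}"
  proof (rule inj_onI, rule ext)
    fix p q m assume p: "p \<in> {p. p permutes {1..card D}}" "q \<in> {p. p permutes {1..card D}}"
      and eq: "restrict (p \<circ> H) D = restrict (q \<circ> H) D"
    show "p m = q m"
    proof (cases "m \<in> {1..card D}")
      case True
      then have "m \<in> H ` D" using bij_betw_imp_surj_on[OF b] by simp
      then obtain z where z: "z \<in> D" "m = H z" by blast
      then show ?thesis using fun_cong[OF eq, of z] by simp
    next
      case False
      have "p m = m" "q m = m" using p permutes_not_in[OF _ False] by blast+
      then show ?thesis by simp
    qed
  qed
  show "(\<lambda>p. restrict (p \<circ> H) D) ` {p. p permutes {1..card D}} = height_assignments D"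
  proof (intro equalityI subsetI)
    fix K assume "K \<in> (\<lambda>p. restrict (p \<circ> H) D) ` {p. p permutes {1..card D}}"
    then obtain p where p: "p permutes {1..card D}" "K = restrict (p \<circ> H) D" by blast
    have "bij_betw (p \<circ> H) D {1..card D}" using b permutes_imp_bij[OF p(1)] by (rule bij_betw_trans)
    then show "K \<in> height_assignments D"
      unfolding p(2) by (auto simp: height_assignments_def cong: bij_betw_cong)
  next
    fix K assume K: "K \<in> height_assignments D"
    \<comment> \<open>The permutation of heights that turns \<open>H\<close> into \<open>K\<close>,
      extended by the identity.\<close>
    define p where "p m = (if m \<in> {1..card D} then K (inv_into D H m) else m)" for m
    have "bij_betw (K \<circ> inv_into D H) {1..card D} {1..card D}"
      using bij_betw_inv_into[OF b] K by (auto simp: height_assignments_def intro: bij_betw_trans)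
    then have "bij_betw p {1..card D} {1..card D}"
      by (rule bij_betw_cong[THEN iffD1, rotated]) (simp add: p_def)
    then have "p permutes {1..card D}" by (rule bij_imp_permutes) (auto simp: p_def)
    moreover have "K = restrict (p \<circ> H) D"
    proof (rule ext)
      fix z show "K z = restrict (p \<circ> H) D z"
      proof (cases "z \<in> D")
        case True
        then have "H z \<in> {1..card D}" "inv_into D H (H z) = z"
          using b by (auto simp: bij_betw_def)
        then show ?thesis using True by (simp add: p_def)
      next
        case False
        then show ?thesis using K extensional_arb[of K D z] by (simp add: height_assignments_def)
      qed
    qed
    ultimately show "K \<in> (\<lambda>p. restrict (p \<circ> H) D) ` {p. p permutes {1..card D}}" by blast
  qed
qed

lemma card_height_assignments:
  assumes "finite D"
  shows "finite (height_assignments D)" "card (height_assignments D) = fact (card D)"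
proof -
  obtain H where H: "H \<in> height_assignments D" using height_assignments_nonempty[OF assms] ..
  note b = bij_betw_height_assignments[OF H]
  have "finite {p. p permutes {1..card D}}" by (rule finite_permutations) simp
  then show "finite (height_assignments D)" using bij_betw_finite[OF b] by simp
  have "card {p. p permutes {1..card D}} = fact (card D)" by (rule card_permutations) auto
  then show "card (height_assignments D) = fact (card D)" using bij_betw_same_card[OF b] by simp
qed

lemma swap_heights_bij:
  assumes x: "x \<in> D" "y \<in> D"
  shows "bij_betw (\<lambda>H. swap_heights H x y) (height_assignments D) (height_assignments D)"
proof -
  have m: "swap_heights H x y \<in> height_assignments D" if "H \<in> height_assignments D" for H
  proof -
    have eq: "swap_heights H x y = H \<circ> transpose x y"
      by (rule ext) (simp add: swap_heights_def transpose_def)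
    have "bij_betw (transpose x y) D D"
      by (rule permutes_imp_bij[OF permutes_swap_id[OF x]])
    then have "bij_betw (H \<circ> transpose x y) D {1..card D}"
      using that by (auto simp: height_assignments_def intro: bij_betw_trans)
    moreover have "swap_heights H x y \<in> extensional D"
      using that x by (auto simp: height_assignments_def swap_heights_def extensional_def)
    ultimately show ?thesis by (simp add: height_assignments_def eq)
  qed
  have i: "swap_heights (swap_heights H x y) x y = H" for H
    by (rule ext) (simp add: swap_heights_def)
  show ?thesis
    by (rule bij_betw_byWitness[where f' = "\<lambda>H. swap_heights H x y"]) (use m i in auto)
qed

text \<open>The substitution \<open>i\<close> shows the sum to equal its negative; characteristic 0
  leaves only zero.\<close>

lemma sum_eq_zero_if_antisymmetric:
  fixes g :: "'i \<Rightarrow> 'k::field_char_0 poly"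
  assumes "bij_betw i S S" "\<And>s. s \<in> S \<Longrightarrow> g (i s) = - g s"
  shows "sum g S = 0"
proof -
  have "sum g S = (\<Sum>s\<in>S. g (i s))" using sum.reindex_bij_betw[OF assms(1), of g] by simp
  also have "\<dots> = - sum g S" using assms(2) by (simp add: sum_negf)
  finally have "sum g S + sum g S = 0" by (simp only: eq_neg_iff_add_eq_0)
  then have "2 * sum g S = 0" by (simp only: mult_2)
  then show ?thesis by simp
qed

lemma prod_monom_one:
  "finite S \<Longrightarrow> (\<Prod>x\<in>S. Polynomial.monom (c x) 1) = Polynomial.monom (\<Prod>x\<in>S. c x) (card S)"
  by (induction S rule: finite_induct) (auto simp: mult_monom)

section \<open>Concatenated presentations and cross pairings\<close>

locale juxtaposed =
  fixes Q :: "('v, 'e) pre_digraph" and ws us :: "'e dedge list list" and vs xs :: "'v list"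
  assumes p: "(ws, vs) \<in> presentations Q" and r: "(us, xs) \<in> presentations Q"
begin

abbreviation "zs \<equiv> ws @ us"
abbreviation "low_edges \<equiv> abs_edges ws"
abbreviation "up_edges \<equiv> abs_edges zs - low_edges"
abbreviation "all_edges \<equiv> abs_edges zs"
abbreviation "verts_list \<equiv> vs @ xs"

definition shift :: "nat \<times> nat \<Rightarrow> nat \<times> nat" where
  "shift = (\<lambda>(i, j). (i + length ws, j))"

definition unshift :: "nat \<times> nat \<Rightarrow> nat \<times> nat" where
  "unshift = (\<lambda>(i, j). (i - length ws, j))"

definition joint_heights :: "(nat \<times> nat \<Rightarrow> nat) \<Rightarrow> (nat \<times> nat \<Rightarrow> nat) \<Rightarrow> nat \<times> nat \<Rightarrow> nat" where
  "joint_heights H K z = (if z \<in> low_edges then H z else K (unshift z) + card low_edges)"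

lemma pr: "(zs, verts_list) \<in> presentations Q"
  using p r by (auto simp: presentations_def)

lemma lower_subset: "low_edges \<subseteq> all_edges"
  by (auto simp: abs_edges_def nth_append)

lemma shift_upper: "z \<in> abs_edges us \<Longrightarrow> shift z \<in> up_edges"
  and unshift_upper: "z \<in> up_edges \<Longrightarrow> unshift z \<in> abs_edges us"
  and unshift_shift [simp]: "unshift (shift z) = z"
  and shift_unshift: "z \<in> up_edges \<Longrightarrow> shift (unshift z) = z"
  by (auto simp: shift_def unshift_def abs_edges_def nth_append split: if_splits prod.splits)

text \<open>The shift of word indices identifies the disjoint sum with the edges of the
  concatenation, so stacking and \<open>star_basis\<close> share one index set.\<close>

lemma stack_with_heights:
  "stack (with_heights (ws, vs) H) (with_heights (us, xs) K) =
    height_coll all_edges (next_edge zs) (edge_at zs) (joint_heights H K) (mset verts_list)"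
proof -
  let ?E = "abs_edges ws" and ?F = "abs_edges us"
  note dw = gluing_data_presentation[OF p] and du = gluing_data_presentation[OF r]
  have E: "finite ?E" "bij_betw (next_edge ws) ?E ?E" and F: "finite ?F" "bij_betw (next_edge us) ?F ?F"
    using dw du by (auto simp: gluing_data_def)
  have fs: "finite (?E <+> ?F)" using E F by simp
  have b: "bij_betw (case_sum (\<lambda>z. z) shift) (?E <+> ?F) all_edges"
    by (rule bij_betw_byWitness[where f' = "\<lambda>z. if z \<in> low_edges then Inl z else Inr (unshift z)"])
       (use shift_upper unshift_upper shift_unshift lower_subset in \<open>auto split: if_splits\<close>)
  have "stack (with_heights (ws, vs) H) (with_heights (us, xs) K) =
      height_coll (?E <+> ?F) (map_sum (next_edge ws) (next_edge us)) (case_sum (edge_at ws) (edge_at us))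
        (case_sum H (\<lambda>z. K z + card ?E)) (mset vs + mset xs)"
    unfolding with_heights_eq_height_coll[OF presentations_nonempty[OF p]]
      with_heights_eq_height_coll[OF presentations_nonempty[OF r]] by (rule height_coll_sum[OF E F, symmetric])
  also have "\<dots> = height_coll all_edges (next_edge zs) (edge_at zs) (joint_heights H K) (mset vs + mset xs)"
  proof (rule height_coll_iso[OF fs bij_betw_map_sum(3)[OF E(2) F(2)] b, symmetric])
    fix z assume z: "z \<in> ?E <+> ?F"
    show "next_edge zs (case_sum (\<lambda>z. z) shift z) =
        case_sum (\<lambda>z. z) shift (map_sum (next_edge ws) (next_edge us) z)"
      using z by (auto simp: abs_edges_def next_edge_def shift_def nth_append)
    show "edge_at zs (case_sum (\<lambda>z. z) shift z) = case_sum (edge_at ws) (edge_at us) z"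
      using z by (auto simp: abs_edges_def edge_at_def shift_def nth_append)
    show "joint_heights H K (case_sum (\<lambda>z. z) shift z) = case_sum H (\<lambda>z. K z + card ?E) z"
      using z shift_upper by (auto simp: joint_heights_def)
  qed
  finally show ?thesis by simp
qed

text \<open>The gluing data of the star product in the form of involutions: every pair has one edge
  in each factor.\<close>

definition cross_pairings :: "(nat \<times> nat \<Rightarrow> nat \<times> nat) set" where
  "cross_pairings = {\<phi> \<in> pairings all_edges (edge_at zs).
     (\<forall>z\<in>low_edges. \<phi> z \<noteq> z \<longrightarrow> \<phi> z \<in> up_edges) \<and> (\<forall>z\<in>up_edges. \<phi> z \<noteq> z \<longrightarrow> \<phi> z \<in> low_edges)}"

lemma joint_heights_bounds:
  assumes "H \<in> height_assignments low_edges" "K \<in> height_assignments (abs_edges us)"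
  shows "z \<in> low_edges \<Longrightarrow> joint_heights H K z \<le> card low_edges"
    "z \<in> up_edges \<Longrightarrow> card low_edges < joint_heights H K z"
proof -
  show "z \<in> low_edges \<Longrightarrow> joint_heights H K z \<le> card low_edges"
    using assms(1) by (auto simp: joint_heights_def height_assignments_def dest: bij_betw_apply)
  assume z: "z \<in> up_edges"
  have "K (unshift z) \<in> {1..card (abs_edges us)}"
    using assms(2) unshift_upper[OF z] by (auto simp: height_assignments_def dest: bij_betw_apply)
  then show "card low_edges < joint_heights H K z" using z by (simp add: joint_heights_def)
qed

lemma inj_joint_heights:
  assumes H: "H \<in> height_assignments low_edges" and K: "K \<in> height_assignments (abs_edges us)"
  shows "inj_on (joint_heights H K) all_edges"
proof (rule inj_onI)
  fix y z assume yz: "y \<in> all_edges" "z \<in> all_edges" and eq: "joint_heights H K y = joint_heights H K z"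
  note bd = joint_heights_bounds[OF H K]
  show "y = z"
  proof (cases "y \<in> low_edges")
    case True
    then have zl: "z \<in> low_edges" using bd(1)[of y] bd(2)[of z] eq yz by force
    have "inj_on H low_edges" using H by (simp add: height_assignments_def bij_betw_def)
    then show ?thesis using True zl eq by (auto simp: joint_heights_def dest: inj_onD)
  next
    case False
    then have zu: "z \<notin> low_edges" using bd(1)[of z] bd(2)[of y] eq yz by force
    have "inj_on K (abs_edges us)" using K by (simp add: height_assignments_def bij_betw_def)
    moreover have "K (unshift y) = K (unshift z)" using eq False zu by (simp add: joint_heights_def)
    ultimately have "unshift y = unshift z"
      using unshift_upper[of y] unshift_upper[of z] yz False zu by (auto dest: inj_onD)
    moreover have "y \<in> up_edges" "z \<in> up_edges" using yz False zu by blast+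
    ultimately show ?thesis by (metis shift_unshift)
  qed
qed

lemma sum_pair_weight_not_cross:
  assumes \<phi>: "\<phi> \<in> pairings all_edges (edge_at zs)" "\<phi> \<notin> cross_pairings"
  shows "(\<Sum>H\<in>height_assignments low_edges. \<Sum>K\<in>height_assignments (abs_edges us).
    (pair_weight all_edges (edge_at zs) (joint_heights H K) \<phi> :: 'k::field_char_0 poly)) = 0"
proof -
  let ?w = "\<lambda>H K. pair_weight all_edges (edge_at zs) (joint_heights H K) \<phi> :: 'k poly"
  note D = pairingsD[OF \<phi>(1)]
  \<comment> \<open>A pairing that is not a cross pairing has a pair inside one of the two factors;
    the sum over the assignments of that factor alone already vanishes.\<close>
  consider x where "x \<in> low_edges" "\<phi> x \<noteq> x" "\<phi> x \<in> low_edges" | x where "x \<in> up_edges" "\<phi> x \<noteq> x" "\<phi> x \<in> up_edges"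
    using \<phi> D(4) lower_subset by (auto simp: cross_pairings_def)
  then show ?thesis
  proof cases
    case 1
    have x: "x \<in> all_edges" using 1(1) lower_subset by blast
    have "(\<Sum>H\<in>height_assignments low_edges. ?w H K) = 0" if K: "K \<in> height_assignments (abs_edges us)" for K
    proof (rule sum_eq_zero_if_antisymmetric[OF swap_heights_bij[OF 1(1,3)]])
      fix H assume H: "H \<in> height_assignments low_edges"
      show "?w (swap_heights H x (\<phi> x)) K = - ?w H K"
        by (rule pair_weight_swap[OF finite_abs_edges \<phi>(1) inj_joint_heights[OF H K] x 1(2)])
           (use 1 in \<open>auto simp: joint_heights_def swap_heights_def\<close>)
    qed
    then show ?thesis by (subst sum.swap) simp
  next
    case 2
    have x: "x \<in> all_edges" using 2(1) by blast
    have u: "unshift x \<in> abs_edges us" "unshift (\<phi> x) \<in> abs_edges us"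
      using unshift_upper 2 by blast+
    \<comment> \<open>\<open>unshift\<close> is injective on the upper edges, so exchanging two
      heights in \<open>K\<close> changes no third joint height.\<close>
    have ue: "unshift z = unshift y \<longleftrightarrow> z = y" if "z \<in> up_edges" "y \<in> up_edges" for y z
      using shift_unshift that by metis
    have "(\<Sum>K\<in>height_assignments (abs_edges us). ?w H K) = 0" if H: "H \<in> height_assignments low_edges" for H
    proof (rule sum_eq_zero_if_antisymmetric[OF swap_heights_bij[OF u]])
      fix K assume K: "K \<in> height_assignments (abs_edges us)"
      show "?w H (swap_heights K (unshift x) (unshift (\<phi> x))) = - ?w H K"
      proof (rule pair_weight_swap[OF finite_abs_edges \<phi>(1) inj_joint_heights[OF H K] x 2(2)])
        let ?K = "swap_heights K (unshift x) (unshift (\<phi> x))"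
        show "joint_heights H ?K x = joint_heights H K (\<phi> x)"
          "joint_heights H ?K (\<phi> x) = joint_heights H K x"
          using 2 ue[OF 2(1,3)] by (auto simp: joint_heights_def swap_heights_def)
        fix z assume "z \<in> all_edges" "z \<noteq> x" "z \<noteq> \<phi> x"
        then show "joint_heights H ?K z = joint_heights H K z"
          using 2 ue[of z x] ue[of z "\<phi> x"] by (auto simp: joint_heights_def swap_heights_def)
      qed
    qed
    then show ?thesis by simp
  qed
qed

definition cross_weight :: "(nat \<times> nat \<Rightarrow> nat \<times> nat) \<Rightarrow> 'k::field_char_0 poly" where
  "cross_weight \<phi> = (\<Prod>x | x \<in> low_edges \<and> \<phi> x \<noteq> x. Polynomial.monom (half_sign (edge_at zs x)) 1)"

text \<open>In a cross pair the lower edge is always the one in the first factor, whatever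
  \<open>H\<close> and \<open>K\<close> are, so averaging leaves the weight alone.\<close>

lemma pair_weight_cross:
  assumes \<phi>: "\<phi> \<in> cross_pairings"
    and HK: "H \<in> height_assignments low_edges" "K \<in> height_assignments (abs_edges us)"
  shows "pair_weight all_edges (edge_at zs) (joint_heights H K) \<phi> = cross_weight \<phi>"
proof -
  have "{z. z \<in> all_edges \<and> joint_heights H K z < joint_heights H K (\<phi> z)} = {x. x \<in> low_edges \<and> \<phi> x \<noteq> x}"
  proof (rule Set.set_eqI)
    fix z
    note bd = joint_heights_bounds[OF HK]
    show "z \<in> {z. z \<in> all_edges \<and> joint_heights H K z < joint_heights H K (\<phi> z)} \<longleftrightarrow>
        z \<in> {x. x \<in> low_edges \<and> \<phi> x \<noteq> x}"
      using \<phi> lower_subset bd(1)[of z] bd(2)[of z] bd(1)[of "\<phi> z"] bd(2)[of "\<phi> z"]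
      unfolding cross_pairings_def
      by (cases "z \<in> low_edges"; cases "z \<in> all_edges"; cases "\<phi> z = z") force+
  qed
  then show ?thesis by (simp add: pair_weight_def cross_weight_def)
qed

lemma single_sum: "Poly_Mapping.single a (sum f S) = (\<Sum>x\<in>S. Poly_Mapping.single a (f x))"
  by (induction S rule: infinite_finite_induct) (auto simp: single_add)

text \<open>The factorials count the assignments, over which a cross term is constant; the
  normalization of symmetrization will cancel them.\<close>

lemma sum_wick:
  "(\<Sum>H\<in>height_assignments low_edges. \<Sum>K\<in>height_assignments (abs_edges us).
      wick_coll Q (stack (with_heights (ws, vs) H) (with_heights (us, xs) K))) =
    scale (of_nat (fact (card low_edges) * fact (card (abs_edges us))))
     (\<Sum>\<phi>\<in>cross_pairings. Poly_Mapping.single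
        (glued Q all_edges (next_edge zs) (edge_at zs) (mset verts_list) \<phi>) (cross_weight \<phi> :: 'k::field_char_0 poly))"
proof -
  let ?H = "height_assignments low_edges" and ?K = "height_assignments (abs_edges us)"
  let ?P = "pairings all_edges (edge_at zs)"
  let ?g = "glued Q all_edges (next_edge zs) (edge_at zs) (mset verts_list)"
  let ?w = "\<lambda>H K \<phi>. pair_weight all_edges (edge_at zs) (joint_heights H K) \<phi> :: 'k poly"
  note d = gluing_data_presentation[OF pr]
  have "(\<Sum>H\<in>?H. \<Sum>K\<in>?K. wick_coll Q (stack (with_heights (ws, vs) H) (with_heights (us, xs) K))) =
      (\<Sum>H\<in>?H. \<Sum>K\<in>?K. \<Sum>\<phi>\<in>?P. Poly_Mapping.single (?g \<phi>) (?w H K \<phi>))"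
    by (intro sum.cong refl)
       (simp add: stack_with_heights wick_coll_height_coll[OF d inj_joint_heights] wick_def)
  also have "\<dots> = (\<Sum>\<phi>\<in>?P. \<Sum>H\<in>?H. \<Sum>K\<in>?K. Poly_Mapping.single (?g \<phi>) (?w H K \<phi>))"
    by (subst (2) sum.swap, subst sum.swap) (intro sum.cong refl sum.swap)
  also have "\<dots> = (\<Sum>\<phi>\<in>?P. Poly_Mapping.single (?g \<phi>) (\<Sum>H\<in>?H. \<Sum>K\<in>?K. ?w H K \<phi>))"
    by (simp add: single_sum)
  also have "\<dots> = (\<Sum>\<phi>\<in>cross_pairings. Poly_Mapping.single (?g \<phi>) (\<Sum>H\<in>?H. \<Sum>K\<in>?K. ?w H K \<phi>))"
  proof (rule sum.mono_neutral_right)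
    show "finite ?P" by (rule finite_pairings[OF finite_abs_edges])
    show "cross_pairings \<subseteq> ?P" by (auto simp: cross_pairings_def)
    show "\<forall>\<phi>\<in>?P - cross_pairings. Poly_Mapping.single (?g \<phi>) (\<Sum>H\<in>?H. \<Sum>K\<in>?K. ?w H K \<phi>) = 0"
      by (simp add: sum_pair_weight_not_cross)
  qed
  also have "\<dots> = (\<Sum>\<phi>\<in>cross_pairings. scale (of_nat (fact (card low_edges) * fact (card (abs_edges us))))
      (Poly_Mapping.single (?g \<phi>) (cross_weight \<phi>)))"
    by (intro sum.cong refl)
       (simp add: pair_weight_cross card_height_assignments[OF finite_abs_edges] scale_single mult.assoc)
  finally show ?thesis by (simp add: scale_sum)
qed


lemma cross_pairings_to_gluings:
  assumes "\<phi> \<in> cross_pairings"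
  shows "({z \<in> low_edges. \<phi> z \<noteq> z}, {z \<in> up_edges. \<phi> z \<noteq> z}, restrict \<phi> {z \<in> low_edges. \<phi> z \<noteq> z})
    \<in> gluings zs low_edges up_edges"
proof -
  let ?A = "{z \<in> low_edges. \<phi> z \<noteq> z}" and ?B = "{z \<in> up_edges. \<phi> z \<noteq> z}"
  have \<phi>: "\<phi> \<in> pairings all_edges (edge_at zs)" using assms by (auto simp: cross_pairings_def)
  note D = pairingsD[OF \<phi>]
  have A: "\<phi> z \<in> ?B" if "z \<in> ?A" for z
    using assms that D(2)[of z] by (auto simp: cross_pairings_def)
  have B: "\<phi> z \<in> ?A" if "z \<in> ?B" for z
    using assms that D(2)[of z] by (auto simp: cross_pairings_def)
  have "bij_betw \<phi> ?A ?B"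
    by (rule bij_betw_byWitness[where f' = \<phi>]) (use A B D(2) in blast)+
  moreover have "bij_betw (restrict \<phi> ?A) ?A ?B \<longleftrightarrow> bij_betw \<phi> ?A ?B"
    by (rule bij_betw_cong) simp
  ultimately have "bij_betw (restrict \<phi> ?A) ?A ?B" by blast
  moreover have "edge_at zs (\<phi> z) = rev_edge (edge_at zs z)" if "z \<in> ?A" for z
    using that lower_subset by (intro D(3)) auto
  ultimately show ?thesis unfolding gluings_def by auto
qed

definition glue_involution ::
  "(nat \<times> nat) set \<Rightarrow> (nat \<times> nat) set \<Rightarrow> (nat \<times> nat \<Rightarrow> nat \<times> nat) \<Rightarrow> nat \<times> nat \<Rightarrow> nat \<times> nat" where
  "glue_involution A B \<phi> z = (if z \<in> A then \<phi> z else if z \<in> B then inv_into A \<phi> z else z)"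

text \<open>Inverse to \<open>cross_pairings_to_gluings\<close>: \<open>A\<close> and
  \<open>B\<close> are the moved lower and upper edges, and since \<open>\<phi>\<close> is
  extensional on \<open>A\<close> it is recovered from the involution by restriction.\<close>

lemma gluings_to_cross_pairings:
  assumes "(A, B, \<phi>) \<in> gluings zs low_edges up_edges"
  shows "glue_involution A B \<phi> \<in> cross_pairings"
    "{z \<in> low_edges. glue_involution A B \<phi> z \<noteq> z} = A"
    "{z \<in> up_edges. glue_involution A B \<phi> z \<noteq> z} = B"
    "restrict (glue_involution A B \<phi>) A = \<phi>"
proof -
  have A: "A \<subseteq> low_edges" and B: "B \<subseteq> up_edges" and exl: "\<phi> \<in> extensional A" and bij: "bij_betw \<phi> A B"
    and e: "\<And>z. z \<in> A \<Longrightarrow> edge_at zs (\<phi> z) = rev_edge (edge_at zs z)"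
    using assms by (auto simp: gluings_def)
  let ?g = "glue_involution A B \<phi>" and ?i = "inv_into A \<phi>"
  have gA: "?g z = \<phi> z \<and> \<phi> z \<in> B \<and> ?i (\<phi> z) = z" if "z \<in> A" for z
    using that bij by (auto simp: glue_involution_def bij_betw_def)
  have AB: "z \<notin> B" if "z \<in> A" for z using A B that by blast
  have gB: "?g z = ?i z \<and> ?i z \<in> A \<and> \<phi> (?i z) = z" if "z \<in> B" for z
  proof -
    have "z \<notin> A" using AB that by blast
    moreover have "z \<in> \<phi> ` A" using that bij by (simp add: bij_betw_def)
    ultimately show ?thesis using that by (simp add: glue_involution_def inv_into_into f_inv_into_f)
  qed
  have g0: "?g z = z" if "z \<notin> A" "z \<notin> B" for z using that by (simp add: glue_involution_def)
  have nA: "?g z \<noteq> z" if "z \<in> A" for z using gA[OF that] AB[OF that] by metis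
  have nB: "?g z \<noteq> z" if "z \<in> B" for z using gB[OF that] AB that by metis
  show 1: "{z \<in> low_edges. ?g z \<noteq> z} = A" using nA g0 A B by blast
  show 2: "{z \<in> up_edges. ?g z \<noteq> z} = B" using nB g0 A B by blast
  show "restrict ?g A = \<phi>"
  proof (rule ext)
    fix z show "restrict ?g A z = \<phi> z"
      using gA[of z] extensional_arb[OF exl, of z] by (cases "z \<in> A") simp_all
  qed
  have "?g z = z" if "z \<notin> all_edges" for z using g0[of z] A B lower_subset that by blast
  moreover have "?g (?g z) = z" for z
  proof -
    consider "z \<in> A" | "z \<in> B" | "z \<notin> A" "z \<notin> B" by blast
    then show ?thesis
    proof cases
      case 1
      then show ?thesis using gA[OF 1] gB[of "\<phi> z"] by simp
    next
      case 2
      then show ?thesis using gB[OF 2] gA[of "?i z"] by simp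
    next
      case 3
      then show ?thesis using g0 by simp
    qed
  qed
  moreover have "edge_at zs (?g z) = rev_edge (edge_at zs z)" if "?g z \<noteq> z" for z
  proof -
    consider "z \<in> A" | "z \<in> B" using \<open>?g z \<noteq> z\<close> g0 by blast
    then show ?thesis
    proof cases
      case 1
      then show ?thesis using gA e by simp
    next
      case 2
      then have "edge_at zs z = rev_edge (edge_at zs (?i z))" using gB e by metis
      then show ?thesis using gB[OF 2] by simp
    qed
  qed
  ultimately have "?g \<in> pairings all_edges (edge_at zs)" by (simp add: pairings_def)
  moreover have "?g z \<in> up_edges" if "z \<in> low_edges" "?g z \<noteq> z" for z
  proof -
    have "z \<in> A" using that 1 by blast
    from gA[OF this] show ?thesis using subsetD[OF B, of "\<phi> z"] by simp
  qed
  moreover have "?g z \<in> low_edges" if "z \<in> up_edges" "?g z \<noteq> z" for z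
  proof -
    have "z \<in> B" using that 2 by blast
    from gB[OF this] show ?thesis using subsetD[OF A, of "?i z"] by simp
  qed
  ultimately show "?g \<in> cross_pairings" by (simp add: cross_pairings_def)
qed

text \<open>An edge of the first factor has negative \<open>half_sign\<close> exactly when its
  partner in the second is original. This is the origin of the sign in the star product, which
  counts edges of the second factor only.\<close>

lemma cross_weight_eq:
  assumes "\<phi> \<in> cross_pairings"
  defines "A \<equiv> {z \<in> low_edges. \<phi> z \<noteq> z}" and "B \<equiv> {z \<in> up_edges. \<phi> z \<noteq> z}"
  shows "cross_weight \<phi> =
    (Polynomial.monom ((- 1) ^ card {y \<in> B. is_orig (edge_at zs y)} / 2 ^ card A) (card A) :: 'k::field_char_0 poly)"
proof -
  let ?sg = "\<lambda>y. if is_orig (edge_at zs y) then - 1 else 1 :: 'k"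
  have fin: "finite A" "finite B" unfolding A_def B_def
    by (rule finite_subset[OF _ finite_abs_edges[of zs]], use lower_subset in blast)+
  have g: "(A, B, restrict \<phi> A) \<in> gluings zs low_edges up_edges"
    using cross_pairings_to_gluings[OF assms(1)] unfolding A_def B_def .
  have "bij_betw (restrict \<phi> A) A B \<longleftrightarrow> bij_betw \<phi> A B" by (rule bij_betw_cong) simp
  then have bij: "bij_betw \<phi> A B" using g by (simp add: gluings_def)
  have e: "edge_at zs (\<phi> z) = rev_edge (edge_at zs z)" if "z \<in> A" for z
    using g that by (auto simp: gluings_def)
  have hs: "half_sign (edge_at zs x) = ?sg (\<phi> x) / 2" if "x \<in> A" for x
    using e[OF that] by (cases "edge_at zs x") (simp_all add: half_sign_def)
  have "(\<Prod>x\<in>A. half_sign (edge_at zs x)) = (\<Prod>x\<in>A. ?sg (\<phi> x)) / 2 ^ card A"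
    by (simp add: hs prod_dividef)
  also have "(\<Prod>x\<in>A. ?sg (\<phi> x)) = prod ?sg B" by (rule prod.reindex_bij_betw[OF bij])
  also have "prod ?sg B = (- 1) ^ card {y \<in> B. is_orig (edge_at zs y)}"
    using fin(2) by (simp add: prod.If_cases Int_def)
  finally have "(\<Prod>x\<in>A. half_sign (edge_at zs x)) =
      ((- 1) ^ card {y \<in> B. is_orig (edge_at zs y)} / 2 ^ card A :: 'k)" .
  moreover have "cross_weight \<phi> = (\<Prod>x\<in>A. Polynomial.monom (half_sign (edge_at zs x) :: 'k) 1)"
    unfolding cross_weight_def A_def by simp
  ultimately show ?thesis using prod_monom_one[OF fin(1)] by metis
qed

text \<open>On \<open>B\<close> the inverse of the restricted bijection is \<open>\<phi>\<close>
  itself, so the gluing map of \<open>star_basis\<close> agrees with \<open>\<phi>\<close> on all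
  glued edges.\<close>

lemma glue_cross:
  assumes "\<phi> \<in> cross_pairings"
  defines "A \<equiv> {z \<in> low_edges. \<phi> z \<noteq> z}" and "B \<equiv> {z \<in> up_edges. \<phi> z \<noteq> z}"
  shows "glue Q (zs, verts_list) (A \<union> B)
      (\<lambda>z. if z \<in> A then restrict \<phi> A z else inv_into A (restrict \<phi> A) z) (edge_at zs) =
    glued Q all_edges (next_edge zs) (edge_at zs) (mset verts_list) \<phi>"
proof -
  have \<phi>: "\<phi> \<in> pairings all_edges (edge_at zs)" using assms by (auto simp: cross_pairings_def)
  note D = pairingsD[OF \<phi>]
  have g: "(A, B, restrict \<phi> A) \<in> gluings zs low_edges up_edges"
    using cross_pairings_to_gluings[OF assms(1)] unfolding A_def B_def .
  have inj: "inj_on (restrict \<phi> A) A" using g by (auto simp: gluings_def bij_betw_def)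
  have inv: "inv_into A (restrict \<phi> A) z = \<phi> z" if "z \<in> B" for z
  proof -
    have pz: "\<phi> z \<in> A" using assms(1) that D(2)[of z] by (auto simp: cross_pairings_def A_def B_def)
    then have "restrict \<phi> A (\<phi> z) = z" using D(2) by simp
    then show ?thesis using inv_into_f_f[OF inj pz] by simp
  qed
  let ?\<psi> = "\<lambda>z. if z \<in> A then restrict \<phi> A z else inv_into A (restrict \<phi> A) z"
  have AB: "z \<in> A \<union> B \<longleftrightarrow> \<phi> z \<noteq> z" if "z \<in> all_edges" for z
    using that by (auto simp: A_def B_def)
  have "orbit_coll all_edges (glue_step zs (A \<union> B) ?\<psi>) (A \<union> B) (dtail Q \<circ> edge_at zs) (edge_at zs) =
      orbit_coll all_edges (next_edge zs \<circ> \<phi>) {z. \<phi> z \<noteq> z} (dtail Q \<circ> edge_at zs) (edge_at zs)"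
  proof (rule orbit_coll_cong[OF gluing_data_tail[OF gluing_data_pairing[OF gluing_data_presentation[OF pr] \<phi>]]])
    fix z assume z: "z \<in> all_edges"
    show "glue_step zs (A \<union> B) ?\<psi> z = (next_edge zs \<circ> \<phi>) z"
      using AB[OF z] inv[of z] by (auto simp: glue_step_def)
    show "z \<in> A \<union> B \<longleftrightarrow> z \<in> {z. \<phi> z \<noteq> z}" using AB[OF z] by simp
  qed auto
  then show ?thesis
    by (simp add: glue_def glued_def orbit_coll_def glued_member_def[abs_def] comp_def)
qed

end

text \<open>The chosen presentation differs from a given one at most by order and rotations, which
  preserve cyclic paths.\<close>

lemma some_pres_presentation:
  assumes "P \<in> collections Q"
  shows "some_pres P \<in> presentations Q"
proof -
  obtain ws vs where p: "(ws, vs) \<in> presentations Q" "coll_of (ws, vs) = P"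
    using assms by (auto simp: collections_def)
  obtain us xs where q: "some_pres P = (us, xs)" by (cases "some_pres P")
  have eq: "coll_of (us, xs) = coll_of (ws, vs)" using coll_of_some_pres[of P] p q by simp
  have rot: "cyclic_path Q (rotate n w)" if "cyclic_path Q w" for n w
  proof -
    have l: "length w > 0" using that by (simp add: cyclic_path_def)
    have "dhead Q (rotate n w ! j) = dtail Q (rotate n w ! (Suc j mod length w))" if j: "j < length w" for j
    proof -
      have m: "(n + j) mod length w < length w" "Suc j mod length w < length w" using l by simp_all
      have "rotate n w ! (Suc j mod length w) = w ! (Suc ((n + j) mod length w) mod length w)"
        using m by (simp add: nth_rotate mod_simps)
      then show ?thesis using \<open>cyclic_path Q w\<close> m j by (simp add: nth_rotate cyclic_path_def)
    qed
    then show ?thesis using that by (simp add: cyclic_path_def)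
  qed
  have "cyclic_path Q u" if u: "u \<in> set us" for u
  proof -
    have "Cyclic (abs_necklace u) \<in># coll_of (us, xs)" using u by (auto simp: coll_of_def)
    then obtain w where w: "w \<in> set ws" "abs_necklace u = abs_necklace w"
      unfolding eq by (auto simp: coll_of_def)
    then obtain n where "u = rotate n w" by (metis necklace.abs_eq_iff)
    then show ?thesis using rot w p by (auto simp: presentations_def)
  qed
  moreover have "x \<in> verts Q" if x: "x \<in> set xs" for x
  proof -
    have "Trivial x \<in># coll_of (us, xs)" using x by (auto simp: coll_of_def)
    then have "x \<in> set vs" unfolding eq by (auto simp: coll_of_def)
    then show ?thesis using p by (auto simp: presentations_def)
  qed
  ultimately show ?thesis unfolding q by (auto simp: presentations_def)
qed

text \<open>Replaces gluing triples by involutions, the form in which the Wick sum produces its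
  terms.\<close>

lemma star_basis_eq:
  assumes P: "some_pres P = (ws, vs)" "(ws, vs) \<in> presentations Q"
    and R: "some_pres R = (us, xs)" "(us, xs) \<in> presentations Q"
  shows "star_basis Q P R = (\<Sum>\<phi>\<in>juxtaposed.cross_pairings ws us. Poly_Mapping.single
    (glued Q (abs_edges (ws @ us)) (next_edge (ws @ us)) (edge_at (ws @ us)) (mset (vs @ xs)) \<phi>)
    (juxtaposed.cross_weight ws us \<phi>))"
proof -
  interpret juxtaposed Q ws us vs xs using P R by unfold_locales
  let ?A = "\<lambda>\<phi>. {z \<in> low_edges. \<phi> z \<noteq> z}" and ?B = "\<lambda>\<phi>. {z \<in> up_edges. \<phi> z \<noteq> z}"
  let ?f = "\<lambda>(A, B, \<phi>). Poly_Mapping.single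
      (glue Q (zs, verts_list) (A \<union> B) (\<lambda>z. if z \<in> A then \<phi> z else inv_into A \<phi> z) (edge_at zs))
      (Polynomial.monom ((- 1) ^ card {y \<in> B. is_orig (edge_at zs y)} / 2 ^ card A) (card A))"
  have "star_basis Q P R = (\<Sum>g\<in>gluings zs low_edges up_edges. ?f g)"
    by (simp add: star_basis_def Let_def P R juxtapose_def)
  also have "\<dots> = (\<Sum>\<phi>\<in>cross_pairings. Poly_Mapping.single
    (glued Q all_edges (next_edge zs) (edge_at zs) (mset verts_list) \<phi>) (cross_weight \<phi>))"
  proof (rule sum.reindex_bij_witness[where i = "\<lambda>\<phi>. (?A \<phi>, ?B \<phi>, restrict \<phi> (?A \<phi>))"
        and j = "\<lambda>(A, B, \<phi>). glue_involution A B \<phi>"])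
    fix g assume g: "g \<in> gluings zs low_edges up_edges"
    obtain A B \<phi> where g': "g = (A, B, \<phi>)" by (cases g)
    note G = gluings_to_cross_pairings[OF g[unfolded g']]
    show "(case g of (A, B, \<phi>) \<Rightarrow> glue_involution A B \<phi>) \<in> cross_pairings"
      using G(1) g' by simp
    show 1: "(?A (case g of (A, B, \<phi>) \<Rightarrow> glue_involution A B \<phi>), ?B (case g of (A, B, \<phi>) \<Rightarrow> glue_involution A B \<phi>),
        restrict (case g of (A, B, \<phi>) \<Rightarrow> glue_involution A B \<phi>) (?A (case g of (A, B, \<phi>) \<Rightarrow> glue_involution A B \<phi>))) = g"
      using G(2-4) g' by simp
    show "Poly_Mapping.single (glued Q all_edges (next_edge zs) (edge_at zs) (mset verts_list)
        (case g of (A, B, \<phi>) \<Rightarrow> glue_involution A B \<phi>))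
        (cross_weight (case g of (A, B, \<phi>) \<Rightarrow> glue_involution A B \<phi>)) = ?f g"
      unfolding g' prod.case
      unfolding glue_cross[OF G(1), symmetric] cross_weight_eq[OF G(1)] G(2,3,4) ..
  next
    fix \<phi> assume \<phi>: "\<phi> \<in> cross_pairings"
    note G = cross_pairings_to_gluings[OF \<phi>]
    show "(?A \<phi>, ?B \<phi>, restrict \<phi> (?A \<phi>)) \<in> gluings zs low_edges up_edges" by (rule G)
    have D: "\<phi> \<in> pairings all_edges (edge_at zs)" using \<phi> by (auto simp: cross_pairings_def)
    have "glue_involution (?A \<phi>) (?B \<phi>) (restrict \<phi> (?A \<phi>)) z = \<phi> z" for z
    proof -
      have "inj_on (restrict \<phi> (?A \<phi>)) (?A \<phi>)" using G by (auto simp: gluings_def bij_betw_def)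
      note inv = inv_into_f_f[OF this, of "\<phi> z"]
      show ?thesis
      proof (cases "z \<in> ?B \<phi>")
        case True
        then have "\<phi> z \<in> ?A \<phi>" using \<phi> pairingsD(2)[OF D, of z] by (auto simp: cross_pairings_def)
        then show ?thesis using inv True pairingsD(2)[OF D, of z] by (simp add: glue_involution_def)
      next
        case False
        then show ?thesis using pairingsD(1)[OF D, of z] by (auto simp: glue_involution_def)
      qed
    qed
    then show "(case (?A \<phi>, ?B \<phi>, restrict \<phi> (?A \<phi>)) of (A, B, \<phi>) \<Rightarrow> glue_involution A B \<phi>) = \<phi>" by auto
  qed
  finally show ?thesis .
qed

text \<open>The core of multiplicativity, before any quotient is taken: the denominators of the two
  averages cancel the factorials in \<open>sum_wick\<close>.\<close>

lemma wick_coll_stack_symm_basis: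
  assumes P: "P \<in> collections Q" and R: "R \<in> collections Q"
  shows "linear_ext (wick_coll Q) (stack_prod (symm_basis P) (symm_basis R)) =
    (star_basis Q P R :: _ \<Rightarrow>\<^sub>0 'k::field_char_0 poly)"
proof -
  obtain ws vs where P': "some_pres P = (ws, vs)" by (cases "some_pres P")
  obtain us xs where R': "some_pres R = (us, xs)" by (cases "some_pres R")
  have pp: "(ws, vs) \<in> presentations Q" "(us, xs) \<in> presentations Q"
    using some_pres_presentation[OF P] some_pres_presentation[OF R] P' R' by simp_all
  interpret juxtaposed Q ws us vs xs using pp by unfold_locales
  let ?c = "[:1 / fact (card low_edges):] * [:1 / fact (card (abs_edges us)):] :: 'k poly"
  have "linear_ext (wick_coll Q) (stack_prod (symm_basis P) (symm_basis R)) =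
      scale ?c (\<Sum>H\<in>height_assignments low_edges. \<Sum>K\<in>height_assignments (abs_edges us).
        wick_coll Q (stack (with_heights (ws, vs) H) (with_heights (us, xs) K)))"
    by (simp add: symm_basis_def Let_def P' R' bilinear_ext_sum stack_prod_single linear_ext_sum linear_ext_single scale_sum
        del: mult_pCons_left mult_pCons_right) (rule sum.swap)
  also have "\<dots> = star_basis Q P R"
  proof -
    have "?c * of_nat (fact (card low_edges) * fact (card (abs_edges us))) = 1"
      by (simp add: of_nat_poly one_pCons)
    then show ?thesis
      unfolding sum_wick scale_scale star_basis_eq[OF P' pp(1) R' pp(2)] by (simp only: scale_one)
  qed
  finally show ?thesis .
qed

section \<open>Free modules and height assignments\<close>

lemma kh_simps [simp]:
  "carrier kh = UNIV" "\<zero>\<^bsub>kh\<^esub> = 0" "\<one>\<^bsub>kh\<^esub> = 1"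
  "x \<oplus>\<^bsub>kh\<^esub> y = x + y" "x \<otimes>\<^bsub>kh\<^esub> y = x * y"
  by (simp_all add: ring_of_type_algebra_def)

text \<open>Shared by the symmetric algebra and the free module on height collections, which have
  the same additive structure over different bases.\<close>

locale free_module =
  fixes B :: "'b set" and M :: "('k::field_char_0 poly, 'b \<Rightarrow>\<^sub>0 'k poly) module"
  assumes carrier_M: "carrier M = {f. Poly_Mapping.keys f \<subseteq> B}"
    and zero_M [simp]: "\<zero>\<^bsub>M\<^esub> = 0" and add_M [simp]: "add M = (+)" and smult_M [simp]: "module.smult M = scale"
begin

lemma add_carrier: "f \<in> carrier M \<Longrightarrow> g \<in> carrier M \<Longrightarrow> f + g \<in> carrier M"
  using keys_add[of f g] by (auto simp: carrier_M)

lemma scale_carrier: "f \<in> carrier M \<Longrightarrow> scale c f \<in> carrier M"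
  using keys_scale[of c f] by (auto simp: carrier_M)

lemma uminus_carrier: "f \<in> carrier M \<Longrightarrow> - f \<in> carrier M"
  using scale_carrier[of f "- 1"] by (simp add: scale_minus_one)

lemma diff_carrier: "f \<in> carrier M \<Longrightarrow> g \<in> carrier M \<Longrightarrow> f - g \<in> carrier M"
  using add_carrier[of f "- g"] uminus_carrier by simp

lemma zero_carrier: "0 \<in> carrier M"
  by (simp add: carrier_M)

lemma sum_carrier: "(\<And>x. x \<in> S \<Longrightarrow> f x \<in> carrier M) \<Longrightarrow> sum f S \<in> carrier M"
  by (induction S rule: infinite_finite_induct) (auto simp: zero_carrier add_carrier)

lemma single_carrier: "b \<in> B \<Longrightarrow> Poly_Mapping.single b c \<in> carrier M"
  by (auto simp: carrier_M)

lemma abelian_group: "abelian_group M"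
proof (rule abelian_groupI)
  fix x assume "x \<in> carrier M"
  then show "\<exists>y\<in>carrier M. y \<oplus>\<^bsub>M\<^esub> x = \<zero>\<^bsub>M\<^esub>"
    by (intro bexI[of _ "- x"] uminus_carrier) auto
qed (auto simp: add_carrier zero_carrier add_ac)

lemma module: "Module.module kh M"
  by (rule moduleI)
     (auto simp: cring_from_type_algebra abelian_group scale_carrier scale_add_left scale_add_right scale_scale)

lemma a_inv_eq: "f \<in> carrier M \<Longrightarrow> \<ominus>\<^bsub>M\<^esub> f = - f"
  by (rule abelian_group.minus_equality[OF abelian_group]) (auto intro: uminus_carrier)

lemma submodule_iff:
  "submodule K kh M \<longleftrightarrow>
    K \<subseteq> carrier M \<and> 0 \<in> K \<and> (\<forall>f\<in>K. \<forall>g\<in>K. f + g \<in> K) \<and> (\<forall>c. \<forall>f\<in>K. scale c f \<in> K)"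
proof
  assume s: "submodule K kh M"
  note E = module.submoduleE[OF module s]
  obtain f where "f \<in> K" using E(2) by blast
  then have "scale 0 f \<in> K" using E(4)[of 0 f] by simp
  then show "K \<subseteq> carrier M \<and> 0 \<in> K \<and> (\<forall>f\<in>K. \<forall>g\<in>K. f + g \<in> K) \<and> (\<forall>c. \<forall>f\<in>K. scale c f \<in> K)"
    using E(1,4,5) by auto
next
  assume K: "K \<subseteq> carrier M \<and> 0 \<in> K \<and> (\<forall>f\<in>K. \<forall>g\<in>K. f + g \<in> K) \<and> (\<forall>c. \<forall>f\<in>K. scale c f \<in> K)"
  have "- f \<in> K" if "f \<in> K" for f using K that by (metis scale_minus_one)
  then show "submodule K kh M"
    using K by (intro module.submoduleI[OF module]) (auto simp: a_inv_eq subset_iff)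
qed

end

section \<open>Stacking as an associative product\<close>

lemma poly_mapping_expand: "f = (\<Sum>a\<in>Poly_Mapping.keys f. Poly_Mapping.single a (Poly_Mapping.lookup f a))"
proof (rule poly_mapping_eqI)
  fix k
  show "Poly_Mapping.lookup f k = Poly_Mapping.lookup
      (\<Sum>a\<in>Poly_Mapping.keys f. Poly_Mapping.single a (Poly_Mapping.lookup f a)) k"
    by (simp add: lookup_sum lookup_single when_def in_keys_iff)
qed

lemma stack_prod_assoc: "stack_prod (stack_prod f g) u = stack_prod f (stack_prod g u)"
proof -
  let ?x = "\<lambda>f. \<Sum>a\<in>Poly_Mapping.keys f. Poly_Mapping.single a (Poly_Mapping.lookup f a)"
  have "stack_prod (stack_prod (?x f) (?x g)) (?x u) = stack_prod (?x f) (stack_prod (?x g) (?x u))"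
    by (simp add: bilinear_ext_sum stack_prod_single stack_assoc mult.assoc)
  then show ?thesis by (simp only: poly_mapping_expand[symmetric])
qed

lemma stack_prod_one:
  "stack_prod (Poly_Mapping.single {#} 1) f = f" "stack_prod f (Poly_Mapping.single {#} 1) = f"
proof -
  let ?x = "\<Sum>a\<in>Poly_Mapping.keys f. Poly_Mapping.single a (Poly_Mapping.lookup f a)"
  have "stack_prod (Poly_Mapping.single {#} 1) ?x = ?x" "stack_prod ?x (Poly_Mapping.single {#} 1) = ?x"
    by (simp_all add: bilinear_ext_sum stack_prod_single del: single_one)
  then show "stack_prod (Poly_Mapping.single {#} 1) f = f" "stack_prod f (Poly_Mapping.single {#} 1) = f"
    by (simp_all only: poly_mapping_expand[symmetric])
qed

lemma stack_in_height_collections: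
  assumes C: "C \<in> height_collections Q" and D: "D \<in> height_collections Q"
  shows "stack C D \<in> height_collections Q"
proof -
  obtain ws vs H where c: "(ws, vs) \<in> presentations Q" "H \<in> height_assignments (abs_edges ws)"
      "C = height_coll (abs_edges ws) (next_edge ws) (edge_at ws) H (mset vs)"
      "gluing_data Q (abs_edges ws) (next_edge ws) {} (edge_at ws)"
    using C by (rule height_collectionsE)
  obtain us xs K where d: "(us, xs) \<in> presentations Q" "K \<in> height_assignments (abs_edges us)"
      "D = height_coll (abs_edges us) (next_edge us) (edge_at us) K (mset xs)"
      "gluing_data Q (abs_edges us) (next_edge us) {} (edge_at us)"
    using D by (rule height_collectionsE)
  show ?thesis
    unfolding c(3) d(3)
      height_coll_sum[OF gluing_data_tail(1,2)[OF c(4)] gluing_data_tail(1,2)[OF d(4)], symmetric]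
    using c(1,2) d(1,2)
    by (intro height_coll_in gluing_data_sum c(4) d(4) bij_betw_sum_heights)
       (auto simp: presentations_def height_assignments_def finite_abs_edges)
qed

lemma empty_in_collections:
  fixes Q :: "('v, 'e) pre_digraph"
  shows "{#} \<in> height_collections Q" "{#} \<in> collections Q"
proof -
  have p: "([], []) \<in> presentations Q" by (simp add: presentations_def)
  obtain H where H: "H \<in> height_assignments (abs_edges ([] :: 'e dedge list list))"
    using height_assignments_nonempty[OF finite_abs_edges] by blast
  have "with_heights ([], []) H = ({#} :: ('v, 'e dedge \<times> nat) collection)"
    by (simp add: with_heights_def coll_of_def)
  then show "{#} \<in> height_collections Q"
    unfolding height_collections_def using p H
    by (intro CollectI exI[of _ "([], [])"] exI[of _ H]) simp
  have "coll_of ([], []) = ({#} :: ('v, 'e dedge) collection)" by (simp add: coll_of_def)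
  then show "{#} \<in> collections Q" unfolding collections_def using p by (metis imageI)
qed

lemma cut_vertices_subset:
  assumes "wf_digraph Q" "e ` E \<subseteq> dedges Q" "x \<in> E" "y \<in> E"
  shows "set_mset (cut_vertices Q s e x y) \<subseteq> verts Q"
  using assms dtail_in_verts[of Q "e x"] dtail_in_verts[of Q "e y"] by (auto simp: cut_vertices_def)

text \<open>The new trivial paths lie at end points of arcs; well-formedness of \<open>Q\<close>
  makes these vertices, so the relation stays in the free module.\<close>

lemma cut_height_coll_in:
  assumes Q: "wf_digraph Q" and d: "gluing_data Q E s {} e" and V: "set_mset V \<subseteq> verts Q"
    and h: "bij_betw h E {1..card E}" and xy: "x \<in> E" "y \<in> E" "x \<noteq> y" "e y = rev_edge (e x)"
  shows "height_coll (E - {x, y}) (cut_next s x y) e (height_rank h (E - {x, y})) (V + cut_vertices Q s e x y)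
    \<in> height_collections Q"
proof (rule height_coll_in[OF gluing_data_cut[OF d xy]])
  show "set_mset (V + cut_vertices Q s e x y) \<subseteq> verts Q"
    using V cut_vertices_subset[OF Q _ xy(1,2)] d by (auto simp: gluing_data_def)
  have "inj_on h (E - {x, y})" using h by (auto simp: bij_betw_def intro: inj_on_subset)
  then show "bij_betw (height_rank h (E - {x, y})) (E - {x, y}) {1..card (E - {x, y})}"
    using d by (intro bij_betw_height_rank) (auto simp: gluing_data_def)
qed

text \<open>Adjacent transpositions generate all permutations. The relation \<open>S\<close> stays
  abstract; it will be congruence modulo \<open>reachable\<close>.\<close>

lemma adjacent_swaps_connect:
  fixes S :: "(nat \<times> nat \<Rightarrow> nat) \<Rightarrow> (nat \<times> nat \<Rightarrow> nat) \<Rightarrow> bool"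
  assumes refl: "\<And>H. S H H" and trans: "\<And>H K L. S H K \<Longrightarrow> S K L \<Longrightarrow> S H L"
    and adj: "\<And>H x y. H \<in> height_assignments D \<Longrightarrow> x \<in> D \<Longrightarrow> y \<in> D \<Longrightarrow> H y = H x + 1 \<Longrightarrow> S H (swap_heights H x y)"
    and HK: "H \<in> height_assignments D" "K \<in> height_assignments D"
  shows "S H K"
proof -
  have mem: "swap_heights L x y \<in> height_assignments D" if "L \<in> height_assignments D" "x \<in> D" "y \<in> D" for L x y
    using swap_heights_bij[OF that(2,3)] that(1) by (rule bij_betw_apply)
  have swap: "S L (swap_heights L x y)"
    if "L \<in> height_assignments D" "x \<in> D" "y \<in> D" "L y = L x + Suc d" for L x y d
    using that
  proof (induction d arbitrary: L x y)
    case 0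
    then show ?case using adj by simp
  next
    case (Suc d)
    note L = Suc.prems
    have "bij_betw L D {1..card D}" using L(1) by (simp add: height_assignments_def)
    moreover have "L x + Suc d \<in> {1..card D}"
      using bij_betw_apply[OF calculation L(3)] L(4) by simp
    \<comment> \<open>\<open>z\<close> lies just below \<open>y\<close>. Exchanging
      \<open>z, y\<close>, then \<open>x, y\<close> at the smaller distance, then
      \<open>x, z\<close> amounts to exchanging \<open>x, y\<close>.\<close>
    ultimately obtain z where z: "z \<in> D" "L z = L x + Suc d" by (metis bij_betw_iff_bijections)
    have ne: "z \<noteq> x" "z \<noteq> y" "x \<noteq> y" using z L by auto
    let ?L1 = "swap_heights L z y"
    let ?L2 = "swap_heights ?L1 x y"
    have 1: "S L ?L1" using adj[OF L(1) z(1) L(3)] z(2) L(4) by simp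
    have m1: "?L1 \<in> height_assignments D" using mem L z by blast
    have 2: "S ?L1 ?L2"
      by (rule Suc.IH[OF m1 L(2,3)]) (use ne z in \<open>simp add: swap_heights_def\<close>)
    have m2: "?L2 \<in> height_assignments D" using mem m1 L by blast
    have 3: "S ?L2 (swap_heights ?L2 x z)"
      by (rule adj[OF m2 L(2) z(1)]) (use ne z L in \<open>simp add: swap_heights_def\<close>)
    have "swap_heights ?L2 x z = swap_heights L x y"
      using ne by (auto simp: swap_heights_def fun_eq_iff)
    then show ?case using 1 2 3 trans by metis
  qed
  have any: "S L (swap_heights L x y)" if L: "L \<in> height_assignments D" "x \<in> D" "y \<in> D" "x \<noteq> y" for L x y
  proof -
    have "L x \<noteq> L y" using L by (auto simp: height_assignments_def bij_betw_def dest: inj_onD)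
    then consider "L x < L y" | "L y < L x" by linarith
    then show ?thesis
    proof cases
      case 1
      then have "L y = L x + Suc (L y - L x - 1)" by simp
      then show ?thesis using swap[OF L(1,2,3)] by blast
    next
      case 2
      then have "L x = L y + Suc (L x - L y - 1)" by simp
      then have "S L (swap_heights L y x)" using swap[OF L(1,3,2)] by blast
      moreover have "swap_heights L y x = swap_heights L x y"
        using L(4) by (auto simp: swap_heights_def fun_eq_iff)
      ultimately show ?thesis by simp
    qed
  qed
  have bH: "bij_betw H D {1..card D}" using HK(1) by (simp add: height_assignments_def)
  note bP = bij_betw_height_assignments[OF HK(1)]
  have perm: "S H (restrict (p \<circ> H) D)" if "p permutes {1..card D}" for p
    using that finite_atLeastAtMost
  proof (induction rule: permutes_induct)
    case id
    have "restrict (id \<circ> H) D = H"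
      using HK(1) by (auto simp: height_assignments_def extensional_restrict)
    then show ?case using refl by simp
  next
    case (swap a b p)
    let ?L = "restrict (p \<circ> H) D"
    have L: "?L \<in> height_assignments D" using bij_betw_apply[OF bP] swap.hyps by blast
    then have bL: "bij_betw ?L D {1..card D}" by (simp add: height_assignments_def)
    have ab: "a \<in> ?L ` D" "b \<in> ?L ` D" unfolding bij_betw_imp_surj_on[OF bL] by (fact swap.hyps)+
    obtain x where x: "x \<in> D" "?L x = a" using ab(1) by (metis (no_types) imageE)
    obtain y where y: "y \<in> D" "?L y = b" using ab(2) by (metis (no_types) imageE)
    have "x \<noteq> y" using x y swap.hyps by auto
    \<comment> \<open>Transposing the values \<open>a\<close> and \<open>b\<close> amounts to
      exchanging the heights of the edges that carry them.\<close>
    have "restrict (transpose a b \<circ> p \<circ> H) D = swap_heights ?L x y"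
    proof (rule ext)
      fix z
      have "?L z = a \<longleftrightarrow> z = x" "?L z = b \<longleftrightarrow> z = y" if "z \<in> D"
        unfolding x(2)[symmetric] y(2)[symmetric]
        using inj_on_eq_iff[OF bij_betw_imp_inj_on[OF bL] that] x(1) y(1) by blast+
      then show "restrict (transpose a b \<circ> p \<circ> H) D z = swap_heights ?L x y z"
        using x y \<open>x \<noteq> y\<close> by (cases "z \<in> D") (auto simp: swap_heights_def transpose_def)
    qed
    then show ?case using any[OF L x(1) y(1) \<open>x \<noteq> y\<close>] swap.IH trans by metis
  qed
  obtain p where "p permutes {1..card D}" "K = restrict (p \<circ> H) D"
    using bP HK(2) by (auto simp: bij_betw_def)
  then show ?thesis using perm by simp
qed

section \<open>Heights on the chosen presentation\<close>

lemma coll_of_parts: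
  assumes "coll_of (ws, vs) = coll_of (us, xs)"
  shows "mset (map abs_necklace ws) = mset (map abs_necklace us)" "mset vs = mset xs"
proof -
  define cyc :: "('a, 'b) member \<Rightarrow> 'b necklace multiset"
    where "cyc m = (case m of Trivial v \<Rightarrow> {#} | Cyclic n \<Rightarrow> {#n#})" for m
  define tri :: "('a, 'b) member \<Rightarrow> 'a multiset"
    where "tri m = (case m of Trivial v \<Rightarrow> {#v#} | Cyclic n \<Rightarrow> {#})" for m
  have z: "(\<Sum>x\<in>#A. {#}) = ({#} :: 'y multiset)" for A :: "'x multiset" by (induction A) auto
  have s: "(\<Sum>x\<in>#A. {#f x#}) = image_mset f A" for f :: "'x \<Rightarrow> 'y" and A by (induction A) auto
  have c: "sum_mset (image_mset cyc (coll_of (ws, vs))) = mset (map abs_necklace ws)" for ws :: "'b list list" and vs :: "'a list"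
    by (simp add: coll_of_def cyc_def image_mset.compositionality comp_def z s)
  have t: "sum_mset (image_mset tri (coll_of (ws, vs))) = mset vs" for ws :: "'b list list" and vs :: "'a list"
    by (simp add: coll_of_def tri_def image_mset.compositionality comp_def z s)
  show "mset (map abs_necklace ws) = mset (map abs_necklace us)" "mset vs = mset xs"
    using assms c t by metis+
qed

lemma mset_rotate: "mset (rotate n w) = mset w"
proof (induction n)
  case (Suc n)
  have "mset (rotate1 u) = mset u" for u :: "'a list" by (cases u) auto
  then show ?case using Suc by simp
qed simp

lemma mset_concat_cong: "mset us = mset vs \<Longrightarrow> mset (concat us) = mset (concat vs)"
  by (metis mset_concat mset_map sum_mset_sum_list)

text \<open>Symmetrization averages over the chosen presentation, whereas a height collection may
  come with another one. Reordering the labelled words, and rotating them to match the chosen words,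
  carries the heights over.\<close>

lemma lift_heights:
  assumes H: "H \<in> height_assignments (abs_edges ws)" and eq: "coll_of (us, xs) = coll_of (ws, vs)"
  shows "\<exists>K\<in>height_assignments (abs_edges us). with_heights (us, xs) K = with_heights (ws, vs) H"
proof -
  let ?wh = "map (map (\<lambda>z. (edge_at ws z, H z))) (edge_lists ws)"
  have fst: "map (map fst) ?wh = ws" using map_edge_at[of ws] by (simp add: comp_def)
  let ?R = "\<lambda>n w. n = abs_necklace (map fst w)"
  have "list_all2 ?R (map abs_necklace ws) ?wh"
    by (subst fst[symmetric]) (simp add: list_all2_conv_all_nth)
  moreover note parts = coll_of_parts[OF eq]
  \<comment> \<open>The labelled words are permuted so that they match the rotation classes of
    \<open>us\<close> one by one.\<close>
  ultimately obtain wh where wh: "list_all2 ?R (map abs_necklace us) wh" "mset wh = mset ?wh"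
    using list_all2_reorder_left_invariance by blast
  have len: "length wh = length us" using wh(1) by (simp add: list_all2_conv_all_nth)
  have "\<exists>n. us ! i = rotate n (map fst (wh ! i))" if "i < length us" for i
  proof -
    have "abs_necklace (map fst (wh ! i)) = abs_necklace (us ! i)"
      using wh(1) that by (simp add: list_all2_conv_all_nth)
    then show ?thesis by (simp only: necklace.abs_eq_iff)
  qed
  then obtain n where n: "\<And>i. i < length us \<Longrightarrow> us ! i = rotate (n i) (map fst (wh ! i))" by metis
  define wk where "wk = map (\<lambda>i. rotate (n i) (wh ! i)) [0..<length us]"
  have wk: "length wk = length us" "\<And>i. i < length us \<Longrightarrow> wk ! i = rotate (n i) (wh ! i)"
    by (simp_all add: wk_def)
  have fst_wk: "map fst (wk ! i) = us ! i" if "i < length us" for i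
    using n[OF that] wk(2)[OF that] by (simp add: rotate_map)
  define K where "K = restrict (\<lambda>(i, j). snd (wk ! i ! j)) (abs_edges us)"
  have K_wk: "map (map (\<lambda>z. (edge_at us z, K z))) (edge_lists us) = wk"
  proof (rule nth_equalityI)
    fix i assume "i < length (map (map (\<lambda>z. (edge_at us z, K z))) (edge_lists us))"
    then have i: "i < length us" by (simp add: edge_lists_def)
    have l: "length (wk ! i) = length (us ! i)" using fst_wk[OF i] by (metis length_map)
    have "(us ! i ! j, snd (wk ! i ! j)) = wk ! i ! j" if "j < length (us ! i)" for j
      using fst_wk[OF i] that l by (metis nth_map prod.collapse)
    then show "map (map (\<lambda>z. (edge_at us z, K z))) (edge_lists us) ! i = wk ! i"
      using i l by (intro nth_equalityI) (auto simp: edge_lists_def edge_at_def K_def abs_edges_def)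
  qed (simp add: edge_lists_def wk)
  have coll: "coll_of (wk, xs) = coll_of (?wh, vs)"
  proof -
    have "map abs_necklace wk = map abs_necklace wh"
      by (rule nth_equalityI) (simp_all add: wk len abs_necklace_rotate)
    then have "mset (map abs_necklace wk) = mset (map abs_necklace ?wh)"
      using wh(2) by (simp only: mset_map)
    then have "image_mset Cyclic (mset (map abs_necklace wk)) = image_mset Cyclic (mset (map abs_necklace ?wh))"
      by (simp only:)
    then show ?thesis using parts(2)
      by (simp add: coll_of_def image_mset.compositionality comp_def)
  qed
  \<comment> \<open>Reordering and rotation keep the multiset of labels, so the new heights still
    run through all values exactly once.\<close>
  have conc: "mset (concat wk) = mset (concat ?wh)"
  proof -
    have "map mset wk = map mset wh"
      by (rule nth_equalityI) (simp_all add: wk len mset_rotate)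
    then have "mset (concat wk) = mset (concat wh)" by (simp only: mset_concat)
    also have "\<dots> = mset (concat ?wh)" using wh(2) by (rule mset_concat_cong)
    finally show ?thesis .
  qed
  have "map K (concat (edge_lists us)) = map snd (concat wk)"
    by (subst K_wk[symmetric]) (simp add: map_concat comp_def)
  moreover have "map H (concat (edge_lists ws)) = map snd (concat ?wh)"
    by (simp add: map_concat comp_def)
  ultimately have m: "mset (map K (concat (edge_lists us))) = mset (map H (concat (edge_lists ws)))"
    using conc by (simp only: mset_map)
  have dist: "distinct (concat (edge_lists ws))" for ws :: "'a list list"
    unfolding edge_lists_def by (intro distinct_concat_Pair) auto
  have bH: "bij_betw H (abs_edges ws) {1..card (abs_edges ws)}"
    using H by (simp add: height_assignments_def)
  then have "distinct (map H (concat (edge_lists ws)))"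
    unfolding distinct_map set_edge_lists using dist by (simp add: bij_betw_def)
  then have "distinct (map K (concat (edge_lists us)))" using mset_eq_imp_distinct_iff[OF m] by blast
  then have "inj_on K (abs_edges us)" unfolding distinct_map set_edge_lists by blast
  moreover have "K ` abs_edges us = H ` abs_edges ws"
    using mset_eq_setD[OF m] unfolding set_map set_edge_lists .
  moreover have "card (abs_edges us) = card (abs_edges ws)"
    using coll_length_coll_of[of "(us, xs)"] coll_length_coll_of[of "(ws, vs)"] eq by simp
  ultimately have "K \<in> height_assignments (abs_edges us)"
    using bH by (simp add: height_assignments_def bij_betw_def K_def)
  moreover have "with_heights (us, xs) K = with_heights (ws, vs) H"
    unfolding with_heights_edge_lists K_wk coll ..
  ultimately show ?thesis by blast
qed

section \<open>The isomorphism\<close>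

lemma some_pres_empty: "some_pres ({#} :: ('v, 'a) collection) = ([], [])"
proof -
  obtain ws vs where p: "some_pres ({#} :: ('v, 'a) collection) = (ws, vs)" by force
  have "coll_of (ws, vs) = {#}" using coll_of_some_pres[of "{#} :: ('v, 'a) collection"] p by simp
  then show ?thesis using p by (simp add: coll_of_def)
qed

lemma symm_basis_empty:
  "symm_basis ({#} :: ('v, 'e dedge) collection) =
    (Poly_Mapping.single {#} 1 :: _ \<Rightarrow>\<^sub>0 'k::field_char_0 poly)"
proof -
  have e: "abs_edges ([] :: 'e dedge list list) = {}" by (auto simp: abs_edges_def)
  have "height_assignments {} = {\<lambda>_. undefined}" by (auto simp: height_assignments_def bij_betw_def)
  moreover have "with_heights ([], []) H = ({#} :: ('v, 'e dedge \<times> nat) collection)" for H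
    by (simp add: with_heights_def coll_of_def)
  ultimately show ?thesis
    by (simp add: symm_basis_def some_pres_empty Let_def e one_pCons del: single_one)
qed

text \<open>Without edges in the second factor only the empty pairing is a cross pairing.\<close>

lemma star_basis_empty:
  assumes P: "P \<in> collections Q"
  shows "star_basis Q P {#} = (Poly_Mapping.single P 1 :: _ \<Rightarrow>\<^sub>0 'k::field_char_0 poly)"
proof -
  obtain ws vs where P': "some_pres P = (ws, vs)" by force
  have pp: "(ws, vs) \<in> presentations Q" using some_pres_presentation[OF P] P' by simp
  have pe: "([], []) \<in> presentations Q" by (simp add: presentations_def)
  interpret juxtaposed Q ws "[]" vs "[]" using pp pe by unfold_locales
  have "cross_pairings = {id}"
  proof
    show "cross_pairings \<subseteq> {id}"
    proof
      fix \<phi> assume "\<phi> \<in> cross_pairings"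
      then have "\<phi> \<in> pairings low_edges (edge_at ws)" "\<forall>z\<in>low_edges. \<phi> z = z"
        by (auto simp: cross_pairings_def)
      then have "\<phi> z = z" for z using pairingsD(1)[of \<phi> low_edges "edge_at ws" z] by (cases "z \<in> low_edges") auto
      then show "\<phi> \<in> {id}" by auto
    qed
    show "{id} \<subseteq> cross_pairings" by (auto simp: cross_pairings_def pairings_def)
  qed
  moreover have "cross_weight id = (1 :: 'k poly)" by (simp add: cross_weight_def)
  moreover have "glued Q low_edges (next_edge ws) (edge_at ws) (mset vs) id = P"
    using coll_of_eq_orbit_coll[OF presentations_nonempty[OF pp], of vs "dtail Q \<circ> edge_at ws"]
      coll_of_some_pres[of P] P'
    by (simp add: glued_def)
  ultimately show ?thesis
    by (simp add: star_basis_eq[OF P' pp some_pres_empty pe])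
qed

text \<open>The structures are parameters with defining equations, which fixes one coefficient field
  for all of them.\<close>

locale quantum_necklaces =
  fixes Q :: "('v, 'e) pre_digraph"
    and F :: "('k::field_char_0 poly, ('v, 'e dedge \<times> nat) collection \<Rightarrow>\<^sub>0 'k poly) module"
    and N :: "(('v, 'e dedge \<times> nat) collection \<Rightarrow>\<^sub>0 'k poly) set"
    and S :: "('k poly, ('v, 'e dedge) collection \<Rightarrow>\<^sub>0 'k poly) module"
  assumes wf: "wf_digraph Q" and F_def: "F = free_h Q" and N_def: "N = relation_submodule Q"
    and S_def: "S = sym_h Q"
begin

sublocale F: free_module "height_collections Q" F
  by unfold_locales (simp_all add: F_def free_h_def)

sublocale S: free_module "collections Q" S
  by unfold_locales (simp_all add: S_def sym_h_def)

lemma mult_F [simp]: "monoid.mult F = stack_prod" and one_F [simp]: "one F = Poly_Mapping.single {#} 1"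
  by (simp_all add: F_def free_h_def)

lemma mult_S [simp]: "monoid.mult S = bilinear_ext (star_basis Q)" and one_S [simp]: "one S = Poly_Mapping.single {#} 1"
  by (simp_all add: S_def sym_h_def)

lemma stack_prod_carrier:
  assumes "f \<in> carrier F" "g \<in> carrier F" shows "stack_prod f g \<in> carrier F"
proof -
  have "Poly_Mapping.keys (Poly_Mapping.single (stack P R) (1 :: 'k poly)) \<subseteq> height_collections Q"
    if "P \<in> Poly_Mapping.keys f" "R \<in> Poly_Mapping.keys g" for P R
    using assms that stack_in_height_collections[of P Q R] by (auto simp: F.carrier_M)
  then show ?thesis
    unfolding F.carrier_M bilinear_ext_def by (intro CollectI keys_linear_ext)
qed

lemma ring_F: "ring F"
proof (rule ringI[OF F.abelian_group])
  show "Group.monoid F"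
    by (rule monoidI)
       (use empty_in_collections(1) in \<open>auto simp: stack_prod_carrier stack_prod_assoc stack_prod_one simp del: single_one
          intro: F.single_carrier\<close>)
qed (simp_all add: bilinear_ext_add)

lemma relations_cases:
  assumes "r \<in> (relations Q :: (_ \<Rightarrow>\<^sub>0 'k poly) set)"
  obtains ws vs H x y where "(ws, vs) \<in> presentations Q" "H \<in> height_assignments (abs_edges ws)"
    "x \<in> abs_edges ws" "y \<in> abs_edges ws" "H y = H x + 1"
    "r = swap_relation Q (abs_edges ws) (next_edge ws) (edge_at ws) H (mset vs) x y"
proof -
  obtain p H x y where p: "r = relation Q p H x y" "p \<in> presentations Q"
      "H \<in> height_assignments (abs_edges (fst p))" "x \<in> abs_edges (fst p)" "y \<in> abs_edges (fst p)" "H y = H x + 1"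
    using assms unfolding relations_def by blast
  obtain ws vs where "p = (ws, vs)" by (cases p)
  then show ?thesis
    using that[of ws vs H x y] p relation_eq_swap_relation[of ws vs Q x y H] by simp
qed

lemma swap_relation_carrier:
  assumes d: "gluing_data Q E s {} e" and V: "set_mset V \<subseteq> verts Q" and h: "bij_betw h E {1..card E}"
    and xy: "x \<in> E" "y \<in> E" "x \<noteq> y"
  shows "swap_relation Q E s e h V x y \<in> carrier F"
proof -
  have "bij_betw (h \<circ> transpose x y) E {1..card E}"
    using permutes_imp_bij[OF permutes_swap_id[OF xy(1,2)]] h by (rule bij_betw_trans)
  moreover have "h \<circ> transpose x y = h(x := h y, y := h x)" by (auto simp: fun_eq_iff transpose_def)
  ultimately have h': "bij_betw (h(x := h y, y := h x)) E {1..card E}" by simp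
  show ?thesis unfolding swap_relation_def
    using height_coll_in[OF d V h] height_coll_in[OF d V h'] cut_height_coll_in[OF wf d V h xy]
    by (auto intro!: F.diff_carrier F.single_carrier F.zero_carrier)
qed

lemma relations_carrier: "relations Q \<subseteq> carrier F"
proof
  fix r assume "r \<in> (relations Q :: (_ \<Rightarrow>\<^sub>0 'k poly) set)"
  then obtain ws vs H x y where r: "(ws, vs) \<in> presentations Q" "H \<in> height_assignments (abs_edges ws)"
    "x \<in> abs_edges ws" "y \<in> abs_edges ws" "H y = H x + 1"
    "r = swap_relation Q (abs_edges ws) (next_edge ws) (edge_at ws) H (mset vs) x y"
    by (rule relations_cases)
  show "r \<in> carrier F" unfolding r(6)
    by (rule swap_relation_carrier[OF gluing_data_presentation[OF r(1)]])
       (use r in \<open>auto simp: presentations_def height_assignments_def\<close>)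
qed

lemma N_minimal:
  assumes "K \<subseteq> carrier F" "0 \<in> K" "\<And>f g. f \<in> K \<Longrightarrow> g \<in> K \<Longrightarrow> f + g \<in> K"
    "\<And>c f. f \<in> K \<Longrightarrow> scale c f \<in> K" "relations Q \<subseteq> K"
  shows "N \<subseteq> K"
  unfolding N_def relation_submodule_def F_def[symmetric]
proof (rule hull_minimal[OF assms(5)])
  show "submodule K kh F" unfolding F.submodule_iff using assms(1-4) by blast
qed

lemma relations_subset_N: "relations Q \<subseteq> N"
  unfolding N_def relation_submodule_def by (rule hull_subset)

lemma N_carrier: "N \<subseteq> carrier F"
  by (rule N_minimal) (auto simp: F.zero_carrier F.add_carrier F.scale_carrier relations_carrier[THEN subsetD])

lemma N_zero: "0 \<in> N" and N_add: "f \<in> N \<Longrightarrow> g \<in> N \<Longrightarrow> f + g \<in> N" and N_scale: "f \<in> N \<Longrightarrow> scale c f \<in> N"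
  unfolding N_def relation_submodule_def F_def[symmetric] hull_def by (auto simp: F.submodule_iff)

lemma N_uminus: "f \<in> N \<Longrightarrow> - f \<in> N"
  using N_scale[of f "- 1"] by (simp add: scale_minus_one)

lemma N_diff: "f \<in> N \<Longrightarrow> g \<in> N \<Longrightarrow> f - g \<in> N"
  using N_add[OF _ N_uminus, of f g] by simp

lemma N_sum: "(\<And>x. x \<in> X' \<Longrightarrow> f x \<in> N) \<Longrightarrow> sum f X' \<in> N"
  by (induction X' rule: infinite_finite_induct) (auto simp: N_zero N_add)

lemma relation_stack_in_N:
  assumes r: "r \<in> relations Q" and C: "C \<in> height_collections Q"
  shows "stack_prod r (Poly_Mapping.single C 1) \<in> N" "stack_prod (Poly_Mapping.single C 1) r \<in> N"
proof -
  obtain ws vs H x y where r: "(ws, vs) \<in> presentations Q" "H \<in> height_assignments (abs_edges ws)"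
    "x \<in> abs_edges ws" "y \<in> abs_edges ws" "H y = H x + 1"
    "r = swap_relation Q (abs_edges ws) (next_edge ws) (edge_at ws) H (mset vs) x y"
    using r by (rule relations_cases)
  obtain us xs K where c: "(us, xs) \<in> presentations Q" "K \<in> height_assignments (abs_edges us)"
      "C = height_coll (abs_edges us) (next_edge us) (edge_at us) K (mset xs)"
      "gluing_data Q (abs_edges us) (next_edge us) {} (edge_at us)"
    using C by (rule height_collectionsE)
  note d = gluing_data_presentation[OF r(1)]
  have b: "bij_betw H (abs_edges ws) {1..card (abs_edges ws)}" "bij_betw K (abs_edges us) {1..card (abs_edges us)}"
    using r c by (auto simp: height_assignments_def)
  have ne: "x \<noteq> y" using r by auto
  have V: "set_mset (mset vs + mset xs) \<subseteq> verts Q" "set_mset (mset xs + mset vs) \<subseteq> verts Q"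
    using r(1) c(1) by (auto simp: presentations_def)
  note fin = finite_abs_edges[of ws] finite_abs_edges[of us]
  show "stack_prod r (Poly_Mapping.single C 1) \<in> N"
    unfolding r(6) c(3) swap_relation_stack_right[OF d c(4) b r(3,4) ne]
    by (rule subsetD[OF relations_subset_N],
        rule swap_relation_in_relations[OF gluing_data_sum[OF d c(4)] V(1) bij_betw_sum_heights[OF fin b]])
       (use r in auto)
  show "stack_prod (Poly_Mapping.single C 1) r \<in> N"
    unfolding r(6) c(3) swap_relation_stack_left[OF d c(4) b r(3,4) ne]
    by (rule subsetD[OF relations_subset_N],
        rule swap_relation_in_relations[OF gluing_data_sum[OF c(4) d] V(2) bij_betw_sum_heights[OF fin(2,1) b(2,1)]])
       (use r in auto)
qed

text \<open>Elements whose products with all single collections lie in \<open>N\<close> form a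
  submodule containing the relations, hence containing \<open>N\<close>; the other factor is then
  expanded in single collections.\<close>

lemma N_stack_prod:
  assumes n: "n \<in> N" and f: "f \<in> carrier F"
  shows "stack_prod n f \<in> N" "stack_prod f n \<in> N"
proof -
  let ?K = "{n \<in> carrier F. \<forall>C\<in>height_collections Q.
    stack_prod n (Poly_Mapping.single C 1) \<in> N \<and> stack_prod (Poly_Mapping.single C 1) n \<in> N}"
  have "N \<subseteq> ?K"
    by (rule N_minimal)
       (auto simp: F.zero_carrier F.add_carrier F.scale_carrier N_zero N_add N_scale bilinear_ext_add
          bilinear_ext_scale relation_stack_in_N relations_carrier[THEN subsetD])
  then have K: "stack_prod n (Poly_Mapping.single C 1) \<in> N" "stack_prod (Poly_Mapping.single C 1) n \<in> N"
    if "C \<in> height_collections Q" for C using n that by auto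
  let ?x = "\<Sum>a\<in>Poly_Mapping.keys f. scale (Poly_Mapping.lookup f a) (Poly_Mapping.single a 1)"
  have x: "?x = f" using poly_mapping_expand[of f] by (simp add: scale_single)
  have "a \<in> height_collections Q" if "a \<in> Poly_Mapping.keys f" for a using f that by (auto simp: F.carrier_M)
  then have "stack_prod n ?x \<in> N" "stack_prod ?x n \<in> N"
    unfolding bilinear_ext_sum bilinear_ext_scale using K by (auto intro!: N_sum N_scale)
  then show "stack_prod n f \<in> N" "stack_prod f n \<in> N" unfolding x .
qed

lemma ideal_N: "ideal N F"
proof (rule idealI[OF ring_F])
  have "submodule N kh F"
    using N_carrier N_zero N_add N_scale by (auto simp: F.submodule_iff)
  then show "subgroup N (add_monoid F)" by (rule submodule.axioms(1))
qed (simp_all add: N_stack_prod)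

section \<open>The quotient algebra\<close>

lemma in_coset_iff: "u \<in> N +>\<^bsub>F\<^esub> f \<longleftrightarrow> u - f \<in> N"
  by (auto simp: a_r_coset_def' intro: bexI[of _ "u - f"])

lemma coset_eq_iff: "N +>\<^bsub>F\<^esub> f = N +>\<^bsub>F\<^esub> g \<longleftrightarrow> f - g \<in> N"
proof -
  have c: "N +>\<^bsub>F\<^esub> f = {u. u - f \<in> N}" for f
    using in_coset_iff by blast
  show ?thesis
  proof
    assume eq: "N +>\<^bsub>F\<^esub> f = N +>\<^bsub>F\<^esub> g"
    have "f \<in> N +>\<^bsub>F\<^esub> g" unfolding eq[symmetric] in_coset_iff using N_zero by simp
    then show "f - g \<in> N" unfolding in_coset_iff .
  next
    assume fg: "f - g \<in> N"
    have "u - f \<in> N \<longleftrightarrow> u - g \<in> N" for u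
      using N_add[of "u - f" "f - g"] N_diff[of "u - g" "f - g"] fg by auto
    then show "N +>\<^bsub>F\<^esub> f = N +>\<^bsub>F\<^esub> g" unfolding c by simp
  qed
qed

lemma coset_self: "f \<in> N +>\<^bsub>F\<^esub> f"
  by (simp add: in_coset_iff N_zero)

abbreviation A where "A \<equiv> A_h Q :: ('k poly, (('v, 'e dedge \<times> nat) collection \<Rightarrow>\<^sub>0 'k poly) set) module"

lemma A_eq: "A = \<lparr>carrier = carrier (F Quot N), mult = mult (F Quot N), one = one (F Quot N),
    zero = zero (F Quot N), add = add (F Quot N),
    module.smult = (\<lambda>c U. \<Union>u\<in>U. N +>\<^bsub>F\<^esub> (c \<odot>\<^bsub>F\<^esub> u))\<rparr>"
  by (simp add: A_h_def Let_def F_def N_def)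

lemma carrier_A: "carrier A = (\<lambda>f. N +>\<^bsub>F\<^esub> f) ` carrier F"
  by (auto simp: A_eq FactRing_def A_RCOSETS_def')

lemma A_add: "f \<in> carrier F \<Longrightarrow> g \<in> carrier F \<Longrightarrow> (N +>\<^bsub>F\<^esub> f) \<oplus>\<^bsub>A\<^esub> (N +>\<^bsub>F\<^esub> g) = N +>\<^bsub>F\<^esub> (f + g)"
  using abelian_subgroup.a_rcos_sum[OF abelian_subgroupI3[OF ideal.axioms(1)[OF ideal_N] F.abelian_group], of f g]
  by (simp add: A_eq FactRing_def)

lemma A_mult: "f \<in> carrier F \<Longrightarrow> g \<in> carrier F \<Longrightarrow>
    (N +>\<^bsub>F\<^esub> f) \<otimes>\<^bsub>A\<^esub> (N +>\<^bsub>F\<^esub> g) = N +>\<^bsub>F\<^esub> stack_prod f g"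
  using ideal.rcoset_mult_add[OF ideal_N, of f g] by (simp add: A_eq FactRing_def)

text \<open>Representatives differ by elements of \<open>N\<close>, which scaling preserves, so the
  union in the definition runs over equal cosets.\<close>

lemma A_smult: "c \<odot>\<^bsub>A\<^esub> (N +>\<^bsub>F\<^esub> f) = N +>\<^bsub>F\<^esub> scale c f"
proof -
  have "N +>\<^bsub>F\<^esub> scale c u = N +>\<^bsub>F\<^esub> scale c f" if "u \<in> N +>\<^bsub>F\<^esub> f" for u
  proof -
    have "scale c (u - f) \<in> N" using that N_scale by (simp add: in_coset_iff)
    moreover have "scale c (u - f) = scale c u - scale c f"
      using scale_add_right[of c "u - f" f] by (simp add: algebra_simps)
    ultimately show ?thesis by (simp add: coset_eq_iff)
  qed
  moreover have "N +>\<^bsub>F\<^esub> f \<noteq> {}" using coset_self[of f] by (metis empty_iff)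
  ultimately have "(\<Union>u\<in>N +>\<^bsub>F\<^esub> f. N +>\<^bsub>F\<^esub> scale c u) = N +>\<^bsub>F\<^esub> scale c f"
    by (metis (no_types, lifting) SUP_eq_const)
  then show ?thesis by (simp add: A_eq)
qed

lemma A_one: "\<one>\<^bsub>A\<^esub> = N +>\<^bsub>F\<^esub> Poly_Mapping.single {#} 1"
  by (simp add: A_eq FactRing_def)

lemma A_zero: "\<zero>\<^bsub>A\<^esub> = N +>\<^bsub>F\<^esub> 0"
  by (simp add: A_eq FactRing_def a_r_coset_def')

lemma A_closed: "f \<in> carrier F \<Longrightarrow> N +>\<^bsub>F\<^esub> f \<in> carrier A"
  unfolding carrier_A by (rule imageI)

lemma ring_A: "ring A"
proof (rule ringI)
  show "abelian_group A"
  proof (rule abelian_groupI)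
    fix U W T assume "U \<in> carrier A" "W \<in> carrier A" "T \<in> carrier A"
    then obtain f g u where *: "f \<in> carrier F" "U = N +>\<^bsub>F\<^esub> f" "g \<in> carrier F" "W = N +>\<^bsub>F\<^esub> g"
        "u \<in> carrier F" "T = N +>\<^bsub>F\<^esub> u"
      unfolding carrier_A by blast
    then show "U \<oplus>\<^bsub>A\<^esub> W \<in> carrier A" "U \<oplus>\<^bsub>A\<^esub> W \<oplus>\<^bsub>A\<^esub> T = U \<oplus>\<^bsub>A\<^esub> (W \<oplus>\<^bsub>A\<^esub> T)"
      "U \<oplus>\<^bsub>A\<^esub> W = W \<oplus>\<^bsub>A\<^esub> U" "\<zero>\<^bsub>A\<^esub> \<oplus>\<^bsub>A\<^esub> U = U"
      by (simp_all add: A_add A_zero A_closed F.add_carrier F.zero_carrier add_ac)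
    show "\<exists>W\<in>carrier A. W \<oplus>\<^bsub>A\<^esub> U = \<zero>\<^bsub>A\<^esub>"
      using * by (intro bexI[of _ "N +>\<^bsub>F\<^esub> (- f)"]) (simp_all add: A_add A_zero A_closed F.uminus_carrier)
  qed (simp add: A_zero A_closed F.zero_carrier)
  have one: "Poly_Mapping.single {#} 1 \<in> carrier F"
    using empty_in_collections(1) by (rule F.single_carrier)
  show "Group.monoid A"
  proof (rule monoidI)
    show "\<one>\<^bsub>A\<^esub> \<in> carrier A" unfolding A_one using one by (rule A_closed)
    fix U W T assume "U \<in> carrier A" "W \<in> carrier A" "T \<in> carrier A"
    then obtain f g u where "f \<in> carrier F" "U = N +>\<^bsub>F\<^esub> f" "g \<in> carrier F" "W = N +>\<^bsub>F\<^esub> g"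
        "u \<in> carrier F" "T = N +>\<^bsub>F\<^esub> u"
      unfolding carrier_A by blast
    then show "U \<otimes>\<^bsub>A\<^esub> W \<in> carrier A" "U \<otimes>\<^bsub>A\<^esub> W \<otimes>\<^bsub>A\<^esub> T = U \<otimes>\<^bsub>A\<^esub> (W \<otimes>\<^bsub>A\<^esub> T)"
      "\<one>\<^bsub>A\<^esub> \<otimes>\<^bsub>A\<^esub> U = U" "U \<otimes>\<^bsub>A\<^esub> \<one>\<^bsub>A\<^esub> = U"
      using one by (simp_all add: A_mult A_one A_closed stack_prod_carrier stack_prod_assoc stack_prod_one
          del: single_one)
  qed
  fix U W T assume "U \<in> carrier A" "W \<in> carrier A" "T \<in> carrier A"
  then obtain f g u where "f \<in> carrier F" "U = N +>\<^bsub>F\<^esub> f" "g \<in> carrier F" "W = N +>\<^bsub>F\<^esub> g"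
      "u \<in> carrier F" "T = N +>\<^bsub>F\<^esub> u"
    unfolding carrier_A by blast
  then show "(U \<oplus>\<^bsub>A\<^esub> W) \<otimes>\<^bsub>A\<^esub> T = U \<otimes>\<^bsub>A\<^esub> T \<oplus>\<^bsub>A\<^esub> W \<otimes>\<^bsub>A\<^esub> T"
    "T \<otimes>\<^bsub>A\<^esub> (U \<oplus>\<^bsub>A\<^esub> W) = T \<otimes>\<^bsub>A\<^esub> U \<oplus>\<^bsub>A\<^esub> T \<otimes>\<^bsub>A\<^esub> W"
    by (simp_all add: A_add A_mult F.add_carrier stack_prod_carrier bilinear_ext_add)
qed

lemma module_A: "Module.module kh A"
proof (rule moduleI)
  show "cring (kh :: 'k poly ring)" by (rule cring_from_type_algebra)
  show "abelian_group A" using ring_A by (rule ring.is_abelian_group)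
next
  have E: "\<exists>f\<in>carrier F. U = N +>\<^bsub>F\<^esub> f" if "U \<in> carrier A" for U
    using that unfolding carrier_A by blast
  note simps = A_add A_smult F.scale_carrier A_closed F.add_carrier scale_add_left scale_add_right scale_scale
  fix c d :: "'k poly" and U assume U: "U \<in> carrier A"
  obtain f where f: "f \<in> carrier F" "U = N +>\<^bsub>F\<^esub> f" using E[OF U] by blast
  show "c \<odot>\<^bsub>A\<^esub> U \<in> carrier A" "\<one>\<^bsub>kh\<^esub> \<odot>\<^bsub>A\<^esub> U = U"
    using f by (simp_all add: simps)
  show "(c \<oplus>\<^bsub>kh\<^esub> d) \<odot>\<^bsub>A\<^esub> U = (c \<odot>\<^bsub>A\<^esub> U) \<oplus>\<^bsub>A\<^esub> (d \<odot>\<^bsub>A\<^esub> U)"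
    using f by (simp add: simps)
  show "(c \<otimes>\<^bsub>kh\<^esub> d) \<odot>\<^bsub>A\<^esub> U = c \<odot>\<^bsub>A\<^esub> (d \<odot>\<^bsub>A\<^esub> U)"
    using f by (simp add: simps)
  fix W assume W: "W \<in> carrier A"
  obtain g where g: "g \<in> carrier F" "W = N +>\<^bsub>F\<^esub> g" using E[OF W] by blast
  show "c \<odot>\<^bsub>A\<^esub> (U \<oplus>\<^bsub>A\<^esub> W) = (c \<odot>\<^bsub>A\<^esub> U) \<oplus>\<^bsub>A\<^esub> (c \<odot>\<^bsub>A\<^esub> W)"
    using f g by (simp add: simps)
qed

lemma assoc_algebra_A: "assoc_algebra kh A"
proof (rule assoc_algebra.intro[OF module_A ring_A], rule assoc_algebra_axioms.intro)
  fix c U W assume "U \<in> carrier A" "W \<in> carrier A"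
  then obtain f g where f: "f \<in> carrier F" "U = N +>\<^bsub>F\<^esub> f" and g: "g \<in> carrier F" "W = N +>\<^bsub>F\<^esub> g"
    unfolding carrier_A by blast
  show "(c \<odot>\<^bsub>A\<^esub> U) \<otimes>\<^bsub>A\<^esub> W = c \<odot>\<^bsub>A\<^esub> (U \<otimes>\<^bsub>A\<^esub> W)"
    "U \<otimes>\<^bsub>A\<^esub> (c \<odot>\<^bsub>A\<^esub> W) = c \<odot>\<^bsub>A\<^esub> (U \<otimes>\<^bsub>A\<^esub> W)"
    using f g by (simp_all add: A_mult A_smult F.scale_carrier bilinear_ext_scale)
qed

section \<open>The Wick map as a left inverse of symmetrization\<close>

lemma wick_relation_zero:
  assumes "r \<in> relations Q"
  shows "linear_ext (wick_coll Q) r = (0 :: _ \<Rightarrow>\<^sub>0 'k poly)"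
proof -
  obtain ws vs H x y where r: "(ws, vs) \<in> presentations Q" "H \<in> height_assignments (abs_edges ws)"
    "x \<in> abs_edges ws" "y \<in> abs_edges ws" "H y = H x + 1"
    "r = swap_relation Q (abs_edges ws) (next_edge ws) (edge_at ws) H (mset vs) x y"
    using assms by (rule relations_cases)
  let ?E = "abs_edges ws" and ?s = "next_edge ws" and ?e = "edge_at ws" and ?V = "mset vs"
  let ?H' = "H(x := H y, y := H x)" and ?H'' = "height_rank H (abs_edges ws - {x, y})"
  note d = gluing_data_presentation[OF r(1)]
  have ne: "x \<noteq> y" using r by auto
  have inj: "inj_on H ?E" using r by (simp add: height_assignments_def bij_betw_def)
  have inj': "inj_on ?H' ?E" using inj r(3,4) ne by (auto simp: inj_on_def)
  \<comment> \<open>Ranks are again injective, so \<open>wick\<close> also computes the image of the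
    cut collection.\<close>
  have inj'': "inj_on ?H'' (?E - {x, y})"
    using bij_betw_height_rank[of "?E - {x, y}" H] inj finite_abs_edges[of ws]
    by (auto simp: bij_betw_def intro: inj_on_subset)
  have rel: "wick Q ?E ?s ?e H ?V - wick Q ?E ?s ?e ?H' ?V =
    (if ?e y = rev_edge (?e x)
     then scale (Polynomial.monom (bracket (?e x) (?e y)) 1)
       (wick Q (?E - {x, y}) (cut_next ?s x y) ?e ?H'' (?V + cut_vertices Q ?s ?e x y))
     else (0 :: _ \<Rightarrow>\<^sub>0 'k poly))"
    by (rule wick_relation[OF d inj r(3,4,5)])
       (use ne finite_abs_edges[of ws] in \<open>auto simp: height_rank_less_iff\<close>)
  show ?thesis
  proof (cases "?e y = rev_edge (?e x)")
    case True
    show ?thesis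
      using rel True
      by (simp add: r(6) swap_relation_def linear_ext_diff linear_ext_single wick_coll_height_coll[OF d inj]
          wick_coll_height_coll[OF d inj'] wick_coll_height_coll[OF gluing_data_cut[OF d r(3,4) ne True] inj''])
  next
    case False
    then show ?thesis
      using rel by (simp add: r(6) swap_relation_def linear_ext_diff linear_ext_single wick_coll_height_coll[OF d inj]
          wick_coll_height_coll[OF d inj'])
  qed
qed

abbreviation wick_map :: "(('v, 'e dedge \<times> nat) collection \<Rightarrow>\<^sub>0 'k poly) \<Rightarrow> ('v, 'e dedge) collection \<Rightarrow>\<^sub>0 'k poly"
  where "wick_map \<equiv> linear_ext (wick_coll Q)"

abbreviation symm_map :: "(('v, 'e dedge) collection \<Rightarrow>\<^sub>0 'k poly) \<Rightarrow> ('v, 'e dedge \<times> nat) collection \<Rightarrow>\<^sub>0 'k poly"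
  where "symm_map \<equiv> linear_ext symm_basis"

lemma wick_map_N: "n \<in> N \<Longrightarrow> wick_map n = 0"
proof -
  have "N \<subseteq> {f \<in> carrier F. wick_map f = 0}"
    by (rule N_minimal)
       (auto simp: F.zero_carrier F.add_carrier F.scale_carrier linear_ext_add linear_ext_scale
          wick_relation_zero relations_carrier[THEN subsetD])
  then show "n \<in> N \<Longrightarrow> wick_map n = 0" by auto
qed

lemma with_heights_some_pres:
  assumes "P \<in> collections Q" "H \<in> height_assignments (abs_edges (fst (some_pres P)))"
  shows "with_heights (some_pres P) H \<in> height_collections Q"
  unfolding height_collections_def using assms some_pres_presentation by blast

lemma symm_map_carrier: "f \<in> carrier S \<Longrightarrow> symm_map f \<in> carrier F"
proof -
  assume f: "f \<in> carrier S"
  have "symm_basis P \<in> carrier F" if "P \<in> collections Q" for P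
    using with_heights_some_pres[OF that]
    by (auto simp: symm_basis_def Let_def intro!: F.sum_carrier F.single_carrier)
  then have "Poly_Mapping.keys (symm_basis P :: _ \<Rightarrow>\<^sub>0 'k poly) \<subseteq> height_collections Q"
    if "P \<in> Poly_Mapping.keys f" for P
    using f that by (auto simp: F.carrier_M S.carrier_M)
  then show "symm_map f \<in> carrier F"
    unfolding F.carrier_M by (intro CollectI keys_linear_ext)
qed

lemma wick_map_stack_prod:
  assumes f: "f \<in> carrier S" and g: "g \<in> carrier S"
  shows "wick_map (stack_prod (symm_map f) (symm_map g)) = bilinear_ext (star_basis Q) f g"
proof -
  have "wick_map (stack_prod (symm_map f) (symm_map g)) =
      (\<Sum>P\<in>Poly_Mapping.keys f. \<Sum>R\<in>Poly_Mapping.keys g. scale (Poly_Mapping.lookup f P)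
        (scale (Poly_Mapping.lookup g R) (wick_map (stack_prod (symm_basis P) (symm_basis R)))))"
    unfolding linear_ext_def[of symm_basis f] linear_ext_def[of symm_basis g]
    by (simp add: bilinear_ext_sum(1) bilinear_ext_scale(1) linear_ext_sum linear_ext_scale
         bilinear_ext_sum(2) bilinear_ext_scale(2) scale_sum)
       (subst sum.swap, simp add: scale_scale mult.commute)
  also have "\<dots> = (\<Sum>P\<in>Poly_Mapping.keys f. \<Sum>R\<in>Poly_Mapping.keys g. scale (Poly_Mapping.lookup f P)
        (scale (Poly_Mapping.lookup g R) (star_basis Q P R)))"
    using f g by (intro sum.cong refl) (auto simp: S.carrier_M subset_iff wick_coll_stack_symm_basis)
  also have "\<dots> = bilinear_ext (star_basis Q) f g"
    by (simp add: bilinear_ext_def linear_ext_def scale_sum)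
  finally show ?thesis .
qed

lemma wick_map_symm_map:
  assumes f: "f \<in> carrier S" shows "wick_map (symm_map f) = f"
proof -
  have one: "Poly_Mapping.single {#} 1 \<in> carrier S"
    using empty_in_collections(2) by (rule S.single_carrier)
  \<comment> \<open>The unit is the symmetrization of the empty collection, so the product formula
    applies with the unit as second factor.\<close>
  have "wick_map (symm_map f) = wick_map (stack_prod (symm_map f) (symm_map (Poly_Mapping.single {#} 1)))"
    by (simp add: linear_ext_single symm_basis_empty stack_prod_one del: single_one)
  also have "\<dots> = bilinear_ext (star_basis Q) f (Poly_Mapping.single {#} 1)"
    using wick_map_stack_prod[OF f one] .
  also have "\<dots> = linear_ext (\<lambda>P. star_basis Q P {#}) f"
    by (simp add: bilinear_ext_def linear_ext_single del: single_one)
  also have "\<dots> = linear_ext (\<lambda>P. Poly_Mapping.single P 1) f"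
    using f by (intro linear_ext_cong star_basis_empty) (auto simp: S.carrier_M)
  also have "\<dots> = f"
    by (simp add: linear_ext_def scale_single poly_mapping_expand[symmetric])
  finally show ?thesis .
qed

section \<open>Surjectivity of symmetrization\<close>

definition reachable :: "(('v, 'e dedge \<times> nat) collection \<Rightarrow>\<^sub>0 'k poly) set" where
  "reachable = {f. \<exists>g\<in>carrier S. f - symm_map g \<in> N}"

lemma reachable_add: "f \<in> reachable \<Longrightarrow> f' \<in> reachable \<Longrightarrow> f + f' \<in> reachable"
proof -
  assume "f \<in> reachable" "f' \<in> reachable"
  then obtain g g' where g: "g \<in> carrier S" "f - symm_map g \<in> N" "g' \<in> carrier S" "f' - symm_map g' \<in> N"
    by (auto simp: reachable_def)
  have "f + f' - symm_map (g + g') = (f - symm_map g) + (f' - symm_map g')" by (simp add: linear_ext_add)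
  then show "f + f' \<in> reachable"
    unfolding reachable_def using g S.add_carrier N_add by (metis (mono_tags, lifting) mem_Collect_eq)
qed

lemma reachable_scale: "f \<in> reachable \<Longrightarrow> scale c f \<in> reachable"
proof -
  assume "f \<in> reachable"
  then obtain g where g: "g \<in> carrier S" "f - symm_map g \<in> N" by (auto simp: reachable_def)
  have "scale c f - symm_map (scale c g) = scale c (f - symm_map g)"
    using scale_add_right[of c "f - symm_map g" "symm_map g"] by (simp add: linear_ext_scale algebra_simps)
  then show "scale c f \<in> reachable"
    unfolding reachable_def using g S.scale_carrier N_scale by (metis (mono_tags, lifting) mem_Collect_eq)
qed

lemma reachable_N: "f \<in> N \<Longrightarrow> f \<in> reachable"
  unfolding reachable_def by (auto intro!: bexI[of _ 0] S.zero_carrier)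

lemma reachable_symm: "g \<in> carrier S \<Longrightarrow> symm_map g \<in> reachable"
  unfolding reachable_def by (auto intro!: bexI[of _ g] N_zero)

lemma reachable_sum: "(\<And>x. x \<in> D \<Longrightarrow> f x \<in> reachable) \<Longrightarrow> sum f D \<in> reachable"
  by (induction D rule: infinite_finite_induct) (auto simp: reachable_add reachable_N N_zero)

text \<open>Exchanging two adjacent heights changes a collection by one with fewer edges, modulo the relations.\<close>

lemma single_reachable:
  "C \<in> height_collections Q \<Longrightarrow> Poly_Mapping.single C 1 \<in> reachable"
proof (induction "coll_length C" arbitrary: C rule: less_induct)
  case less
  obtain ws vs H where c: "(ws, vs) \<in> presentations Q" "H \<in> height_assignments (abs_edges ws)"
    "C = with_heights (ws, vs) H"
    using less.prems by (rule height_collectionsE)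
  define P where "P = coll_of (ws, vs)"
  have P: "P \<in> collections Q" using c(1) by (auto simp: P_def collections_def)
  obtain us xs where p: "some_pres P = (us, xs)" by force
  have pr: "(us, xs) \<in> presentations Q" using some_pres_presentation[OF P] p by simp
  let ?E = "abs_edges us" and ?s = "next_edge us" and ?e = "edge_at us"
  let ?HA = "height_assignments ?E"
  let ?D = "\<lambda>H. Poly_Mapping.single (with_heights (us, xs) H) 1 :: _ \<Rightarrow>\<^sub>0 'k poly"
  have "coll_of (us, xs) = coll_of (ws, vs)" using coll_of_some_pres[of P] p by (simp add: P_def)
  \<comment> \<open>\<open>C\<close> is rewritten over the presentation that
    \<open>symm_basis\<close> uses, so that it occurs as a term of that average.\<close>
  then obtain K where K: "K \<in> ?HA" "with_heights (us, xs) K = C"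
    using lift_heights[OF c(2)] c(3) by blast
  note d = gluing_data_presentation[OF pr]
  have wh: "with_heights (us, xs) H = height_coll ?E ?s ?e H (mset xs)" for H
    by (rule with_heights_eq_height_coll[OF presentations_nonempty[OF pr]])
  have len: "coll_length C = card ?E"
    using coll_length_height_coll[OF gluing_data_tail(1,2)[OF d], of ?e K "mset xs"] K(2) wh[of K] by simp
  have V: "set_mset (mset xs) \<subseteq> verts Q" using pr by (auto simp: presentations_def)
  have adj: "?D H - ?D (swap_heights H x y) \<in> reachable"
    if H: "H \<in> ?HA" and xy: "x \<in> ?E" "y \<in> ?E" "H y = H x + 1" for H x y
  proof -
    have b: "bij_betw H ?E {1..card ?E}" using H by (simp add: height_assignments_def)
    have ne: "x \<noteq> y" using xy by auto
    let ?C = "height_coll (?E - {x, y}) (cut_next ?s x y) ?e (height_rank H (?E - {x, y}))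
        (mset xs + cut_vertices Q ?s ?e x y)"
    let ?r = "swap_relation Q ?E ?s ?e H (mset xs) x y :: _ \<Rightarrow>\<^sub>0 'k poly"
    have "?r \<in> N"
      using swap_relation_in_relations[OF d V b xy] relations_subset_N by blast
    then have r: "?r \<in> reachable" by (rule reachable_N)
    have sw: "H(x := H y, y := H x) = swap_heights H x y" by (simp add: swap_heights_def)
    show ?thesis
    proof (cases "?e y = rev_edge (?e x)")
      case True
      note dc = gluing_data_tail[OF gluing_data_cut[OF d xy(1,2) ne True]]
      have "card (?E - {x, y}) < card ?E"
        by (rule psubset_card_mono[OF finite_abs_edges]) (use xy in auto)
      then have "coll_length ?C < coll_length C"
        unfolding len coll_length_height_coll[OF dc(1,2)] .
      moreover have "?C \<in> height_collections Q"
        by (rule cut_height_coll_in[OF wf d V b xy(1,2) ne True])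
      ultimately have "Poly_Mapping.single ?C 1 \<in> reachable" by (rule less.hyps)
      then have "scale (Polynomial.monom (bracket (?e x) (?e y)) 1) (Poly_Mapping.single ?C 1) \<in> reachable"
        by (rule reachable_scale)
      then have "?r + Poly_Mapping.single ?C (Polynomial.monom (bracket (?e x) (?e y)) 1) \<in> reachable"
        using r by (intro reachable_add) (simp_all add: scale_single)
      moreover have "?D H - ?D (swap_heights H x y) =
          ?r + Poly_Mapping.single ?C (Polynomial.monom (bracket (?e x) (?e y)) 1)"
        unfolding swap_relation_def sw wh using True by simp
      ultimately show ?thesis by (simp only:)
    next
      case False
      then have "?D H - ?D (swap_heights H x y) = ?r"
        unfolding swap_relation_def sw wh by simp
      then show ?thesis using r by (simp only:)
    qed
  qed
  have any: "?D K - ?D L \<in> reachable" if "L \<in> ?HA" for L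
  proof (rule adjacent_swaps_connect[where S = "\<lambda>H K. ?D H - ?D K \<in> reachable", OF _ _ adj K(1) that])
    show "?D H - ?D H \<in> reachable" for H using reachable_N[OF N_zero] by simp
    fix H1 H2 H3 assume "?D H1 - ?D H2 \<in> reachable" "?D H2 - ?D H3 \<in> reachable"
    then have "(?D H1 - ?D H2) + (?D H2 - ?D H3) \<in> reachable" by (rule reachable_add)
    then show "?D H1 - ?D H3 \<in> reachable" by simp
  qed
  let ?c = "[:1 / fact (card ?E):] :: 'k poly"
  have one: "?c * of_nat (fact (card ?E)) = 1" by (simp add: of_nat_poly one_pCons)
  have sb: "symm_basis P = (\<Sum>L\<in>?HA. scale ?c (?D L))"
    by (simp add: symm_basis_def p Let_def scale_single)
  \<comment> \<open>The single term is the average of equal copies of itself; comparing it with the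
    average over all \<open>L\<close> leaves a sum of differences, each reachable through
    exchanges.\<close>
  have "(\<Sum>L\<in>?HA. scale ?c (?D K)) = scale (of_nat (fact (card ?E))) (scale ?c (?D K))"
    by (rule poly_mapping_eqI)
       (simp only: lookup_sum lookup_scale, simp only: sum_constant card_height_assignments[OF finite_abs_edges])
  also have "\<dots> = ?D K" unfolding scale_scale mult.commute[of _ ?c] one by (rule scale_one)
  finally have "?D K = symm_basis P + (\<Sum>L\<in>?HA. scale ?c (?D K - ?D L))"
    unfolding sb sum.distrib[symmetric] scale_add_right[symmetric] by simp
  moreover have "symm_basis P \<in> reachable"
    using reachable_symm[OF S.single_carrier[OF P, of 1]] by (simp add: linear_ext_single)
  ultimately have "?D K \<in> reachable"
    using any by (metis (no_types, lifting) reachable_add reachable_sum reachable_scale)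
  then show ?case unfolding K(2) .
qed

lemma all_reachable: "f \<in> carrier F \<Longrightarrow> f \<in> reachable"
proof -
  assume f: "f \<in> carrier F"
  have "(\<Sum>a\<in>Poly_Mapping.keys f. scale (Poly_Mapping.lookup f a) (Poly_Mapping.single a 1)) \<in> reachable"
    using f by (intro reachable_sum reachable_scale single_reachable) (auto simp: F.carrier_M)
  then show "f \<in> reachable" using poly_mapping_expand[of f] by (simp add: scale_single)
qed

section \<open>Transport of the algebra structure along symmetrization\<close>

lemma Phi_W_eq: "Phi_W Q f = N +>\<^bsub>F\<^esub> symm_map f"
  by (simp add: Phi_W_def N_def F_def)

lemma bij_Phi_W: "bij_betw (Phi_W Q) (carrier S) (carrier A)"
proof (rule bij_betw_imageI)
  show "inj_on (Phi_W Q) (carrier S)"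
  proof (rule inj_onI)
    fix f g assume f: "f \<in> carrier S" and g: "g \<in> carrier S" and "Phi_W Q f = Phi_W Q g"
    then have "symm_map f - symm_map g \<in> N" by (simp add: Phi_W_eq coset_eq_iff)
    then have "wick_map (symm_map f) - wick_map (symm_map g) = 0"
      using wick_map_N by (simp add: linear_ext_diff[symmetric])
    then show "f = g" using wick_map_symm_map f g by simp
  qed
  show "Phi_W Q ` carrier S = carrier A"
  proof
    show "Phi_W Q ` carrier S \<subseteq> carrier A" by (auto simp: Phi_W_eq carrier_A symm_map_carrier)
    show "carrier A \<subseteq> Phi_W Q ` carrier S"
    proof
      fix U assume "U \<in> carrier A"
      then obtain f where f: "f \<in> carrier F" "U = N +>\<^bsub>F\<^esub> f" by (auto simp: carrier_A)
      then obtain g where g: "g \<in> carrier S" "f - symm_map g \<in> N"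
        using all_reachable by (auto simp: reachable_def)
      then have "U = Phi_W Q g" using f by (simp add: Phi_W_eq coset_eq_iff)
      then show "U \<in> Phi_W Q ` carrier S" using g by blast
    qed
  qed
qed

lemma Phi_W_add: "f \<in> carrier S \<Longrightarrow> g \<in> carrier S \<Longrightarrow> Phi_W Q (f + g) = Phi_W Q f \<oplus>\<^bsub>A\<^esub> Phi_W Q g"
  by (simp add: Phi_W_eq A_add symm_map_carrier linear_ext_add)

lemma Phi_W_scale: "Phi_W Q (scale c f) = c \<odot>\<^bsub>A\<^esub> Phi_W Q f"
  by (simp add: Phi_W_eq A_smult linear_ext_scale)

text \<open>By surjectivity the product of two symmetrized elements is congruent to some
  \<open>symm_map u\<close>, and the Wick map identifies \<open>u\<close> with the star product. In
  particular the star product lies in the carrier without any inspection of glued paths.\<close>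

lemma star_in_carrier_and_Phi_W_mult:
  assumes f: "f \<in> carrier S" and g: "g \<in> carrier S"
  shows "bilinear_ext (star_basis Q) f g \<in> carrier S"
    "Phi_W Q (bilinear_ext (star_basis Q) f g) = Phi_W Q f \<otimes>\<^bsub>A\<^esub> Phi_W Q g"
proof -
  let ?fg = "stack_prod (symm_map f) (symm_map g)"
  obtain u where u: "u \<in> carrier S" "?fg - symm_map u \<in> N"
    using all_reachable[OF stack_prod_carrier[OF symm_map_carrier[OF f] symm_map_carrier[OF g]]]
    by (auto simp: reachable_def)
  have "wick_map ?fg - wick_map (symm_map u) = 0"
    using wick_map_N[OF u(2)] by (simp add: linear_ext_diff)
  then have eq: "bilinear_ext (star_basis Q) f g = u"
    using wick_map_stack_prod[OF f g] wick_map_symm_map[OF u(1)] by simp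
  show "bilinear_ext (star_basis Q) f g \<in> carrier S" using u eq by simp
  have "N +>\<^bsub>F\<^esub> ?fg = N +>\<^bsub>F\<^esub> symm_map u" using u(2) by (simp add: coset_eq_iff)
  then show "Phi_W Q (bilinear_ext (star_basis Q) f g) = Phi_W Q f \<otimes>\<^bsub>A\<^esub> Phi_W Q g"
    unfolding eq by (simp add: Phi_W_eq A_mult symm_map_carrier f g)
qed

lemma Phi_W_one: "Phi_W Q (Poly_Mapping.single {#} 1) = \<one>\<^bsub>A\<^esub>"
  by (simp add: Phi_W_eq A_one linear_ext_single symm_basis_empty del: single_one)

text \<open>Associativity and the unit laws hold after applying the injective \<open>Phi_W\<close>,
  where they are those of the quotient.\<close>

lemma ring_S: "ring S"
proof (rule ringI[OF S.abelian_group])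
  have inj: "f = g" if "f \<in> carrier S" "g \<in> carrier S" "Phi_W Q f = Phi_W Q g" for f g
    using bij_Phi_W that by (auto simp: bij_betw_def dest: inj_onD)
  have PhA: "Phi_W Q f \<in> carrier A" if "f \<in> carrier S" for f
    using bij_Phi_W that by (rule bij_betw_apply)
  note star = star_in_carrier_and_Phi_W_mult
  have one: "Poly_Mapping.single {#} 1 \<in> carrier S"
    using empty_in_collections(2) by (rule S.single_carrier)
  interpret A: ring A by (rule ring_A)
  show "Group.monoid S"
  proof (rule monoidI)
    fix f g u assume f: "f \<in> carrier S" and g: "g \<in> carrier S" and u: "u \<in> carrier S"
    show "f \<otimes>\<^bsub>S\<^esub> g \<in> carrier S" using star(1)[OF f g] by simp
    have "Phi_W Q (f \<otimes>\<^bsub>S\<^esub> g \<otimes>\<^bsub>S\<^esub> u) = Phi_W Q (f \<otimes>\<^bsub>S\<^esub> (g \<otimes>\<^bsub>S\<^esub> u))"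
      using f g u by (simp add: star PhA A.m_assoc)
    then show "f \<otimes>\<^bsub>S\<^esub> g \<otimes>\<^bsub>S\<^esub> u = f \<otimes>\<^bsub>S\<^esub> (g \<otimes>\<^bsub>S\<^esub> u)"
      using f g u by (intro inj) (simp_all add: star)
  next
    show "\<one>\<^bsub>S\<^esub> \<in> carrier S" using one by simp
    fix f assume f: "f \<in> carrier S"
    have "Phi_W Q (\<one>\<^bsub>S\<^esub> \<otimes>\<^bsub>S\<^esub> f) = Phi_W Q f" "Phi_W Q (f \<otimes>\<^bsub>S\<^esub> \<one>\<^bsub>S\<^esub>) = Phi_W Q f"
      using f one by (simp_all add: star PhA Phi_W_one del: single_one)
    moreover have "\<one>\<^bsub>S\<^esub> \<otimes>\<^bsub>S\<^esub> f \<in> carrier S" "f \<otimes>\<^bsub>S\<^esub> \<one>\<^bsub>S\<^esub> \<in> carrier S"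
      using f one by (simp_all add: star del: single_one)
    ultimately show "\<one>\<^bsub>S\<^esub> \<otimes>\<^bsub>S\<^esub> f = f" "f \<otimes>\<^bsub>S\<^esub> \<one>\<^bsub>S\<^esub> = f"
      using f by (blast intro: inj)+
  qed
qed (simp_all add: bilinear_ext_add)

lemma assoc_algebra_S: "assoc_algebra kh S"
  by (rule assoc_algebra.intro[OF S.module ring_S], rule assoc_algebra_axioms.intro)
     (simp_all add: bilinear_ext_scale)

lemma Phi_W_module_iso: "Phi_W Q \<in> module_iso kh S A"
  unfolding module_iso_def using S.module module_A bij_Phi_W Phi_W_add Phi_W_scale by auto

lemma Phi_W_algebra_iso: "Phi_W Q \<in> algebra_iso kh S A"
proof -
  have "Phi_W Q \<in> ring_hom S A"
    unfolding ring_hom_def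
    using bij_Phi_W Phi_W_add star_in_carrier_and_Phi_W_mult(2) Phi_W_one
    by (auto dest: bij_betw_apply simp del: single_one)
  then show ?thesis
    unfolding algebra_iso_def ring_iso_def
    using Phi_W_module_iso bij_Phi_W assoc_algebra_S assoc_algebra_A by auto
qed

end

theorem mainTheorem4:
  fixes Q :: "('v, 'e) pre_digraph"
  assumes "wf_digraph Q"
  shows "Phi_W Q \<in> module_iso (kh :: 'k::field_char_0 poly ring) (sym_h Q) (A_h Q) \<and>
    (\<forall>P\<in>carrier (sym_h Q). \<forall>R\<in>carrier (sym_h Q).
       (Phi_W Q (P \<otimes>\<^bsub>sym_h Q\<^esub> R) :: (('v, 'e dedge \<times> nat) collection \<Rightarrow>\<^sub>0 'k poly) set)
         = Phi_W Q P \<otimes>\<^bsub>A_h Q\<^esub> Phi_W Q R) \<and>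
    Phi_W Q \<in> algebra_iso (kh :: 'k poly ring) (sym_h Q) (A_h Q)"
proof -
  interpret quantum_necklaces Q "free_h Q :: ('k poly, _) module" "relation_submodule Q" "sym_h Q"
    using assms by (rule quantum_necklaces.intro) (rule refl)+
  show ?thesis
    using Phi_W_module_iso Phi_W_algebra_iso star_in_carrier_and_Phi_W_mult(2) by simp
qed

end
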